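(* Fix some angle $\alpha$ and length $\ell$. Let $P_n$ be a random polygon in the hyperbolic plane with (cyclic) vertices $p_0,p_1,\dots,p_n$, where $d(p_i,p_{i+1})=\ell$ for each $0\le i\le n-1$ and an angle of $\pm\alpha$ at each $p_i$ with $0<i<n$, with signs independently and uniformly chosen from $\pm1$. Let $A_n$ be the algebraic area enclosed by $P_n$, and $W_n$ the winding number of $\partial P_n$. Then $A_n$ and $W_n$ both satisfy a central limit theorem with mean $0$.
   Context: The polygon is generated by starting at the origin $p_0$ of the hyperbolic plane $\mathbb{H}^2$ and alternately moving forward a distance $\ell$ along a geodesic and turning left or right through the angle $\alpha$ (so the signed turning angle at $p_i$, $0<i<n$, is $\pm\alpha$); $p_0,p_1,\dots$ are the locations after successive forward moves, and $P_n$ is the closed polygon with cyclic vertices $p_0,\dots,p_n$. Identify $\mathbb{H}^2$ with an open disc in $\mathbb{R}^2$. For a $C^1$ immersion $\gamma:S^1\to\mathbb{R}^2$, the winding number is the degree of the Gauss map $\theta\mapsto\gamma'(\theta)/|\gamma'(\theta)|$. The winding number $W_n$ of $\partial P_n$ is that of the smoothing of $\partial P_n$ obtained by rotating the tangent vector left or right through the angle $\alpha$ at each $p_i$, $0<i<n$ (according to the chosen sign), and in an arbitrary way at $p_0$ and $p_n$. The algebraic area enclosed by a closed curve $\gamma$ is $\int \mathrm{wind}(\gamma,p)\,d\mathrm{area}(p)$ (hyperbolic area), where $\mathrm{wind}(\gamma,p)$ is the degree of $\theta\mapsto(\gamma(\theta)-p)/|\gamma(\theta)-p|$. "$X_n$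 satisfies a central limit theorem with mean $0$" means that there is a constant $\sigma\ge0$ (possibly $0$) such that $n^{-1/2}X_n$ converges in distribution to the Gaussian $N(0,\sigma)$ as $n\to\infty$. *)

theory Defs
  imports "HOL-Probability.Probability" "HOL-Complex_Analysis.Complex_Analysis"
begin

section \<open>The hyperbolic plane\<close>

text \<open>
  The hyperbolic plane (curvature \<open>-1\<close>) is the Poincare disc \<open>ball 0 1\<close>, with metric
  \<open>2 |dz| / (1 - |z|^2)\<close>. The model is conformal, so hyperbolic angles are Euclidean
  angles, and counterclockwise (left) angles are positive.
\<close>

definition hdist :: "complex \<Rightarrow> complex \<Rightarrow> real" where
  "hdist z w = arcosh (1 + 2 * (cmod (z - w))\<^sup>2 / ((1 - (cmod z)\<^sup>2) * (1 - (cmod w)\<^sup>2)))"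

text \<open>The isometry that takes \<open>0\<close> to \<open>p\<close>. Its derivative at \<open>0\<close> is the positive real number
  \<open>1 - |p|^2\<close>, so it preserves the direction of tangent vectors at \<open>0\<close>.\<close>

definition htrans :: "complex \<Rightarrow> complex \<Rightarrow> complex" where
  "htrans p z = (z + p) / (1 + cnj p * z)"

text \<open>The unit speed geodesic that starts at \<open>p\<close> in the direction \<open>u\<close>, where \<open>|u| = 1\<close>
  (see \<open>hgeod_0\<close>, \<open>hdist_hgeod\<close> and \<open>hgeod_direction\<close> below).\<close>

definition hgeod :: "complex \<Rightarrow> complex \<Rightarrow> real \<Rightarrow> complex" where
  "hgeod p u t = htrans p (of_real (tanh (t / 2)) * u)"

text \<open>The geodesic segment from \<open>p\<close> to \<open>q\<close>, parametrised by \<open>{0..1}\<close>: the image under an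
  isometry of a Euclidean segment that starts at \<open>0\<close>. The parametrisation is regular, but not
  of constant hyperbolic speed.\<close>

definition hseg :: "complex \<Rightarrow> complex \<Rightarrow> real \<Rightarrow> complex" where
  "hseg p q t = htrans p (of_real t * htrans (- p) q)"

definition harea :: "complex measure" where
  "harea = density lborel
     (\<lambda>z. ennreal (4 / (1 - (cmod z)\<^sup>2)\<^sup>2) * indicator (ball 0 1) z)"

lemma htrans_denom_nonzero:
  assumes "cmod p < 1" "cmod z < 1"
  shows "1 + cnj p * z \<noteq> 0"
proof
  assume "1 + cnj p * z = 0"
  then have "cnj p * z = - 1" by (simp add: eq_neg_iff_add_eq_0 add.commute)
  then have "cmod p * cmod z = 1"
    by (metis complex_mod_cnj norm_minus_cancel norm_mult norm_one)
  moreover have "cmod p * cmod z < 1 * 1"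
    using assms by (intro mult_strict_mono') auto
  ultimately show False by simp
qed

lemma one_minus_cmod_htrans:
  assumes "cmod p < 1" "cmod z < 1"
  shows "1 - (cmod (htrans p z))\<^sup>2
    = (1 - (cmod p)\<^sup>2) * (1 - (cmod z)\<^sup>2) / (cmod (1 + cnj p * z))\<^sup>2"
proof -
  let ?d = "1 + cnj p * z"
  have nz: "(cmod ?d)\<^sup>2 \<noteq> 0" using htrans_denom_nonzero[OF assms] by simp
  have "(cmod ?d)\<^sup>2 - (cmod (z + p))\<^sup>2 = (1 - (cmod p)\<^sup>2) * (1 - (cmod z)\<^sup>2)"
    unfolding cmod_power2 by (simp add: power2_eq_square algebra_simps)
  then show ?thesis
    unfolding htrans_def norm_divide power_divide using nz by (simp add: field_simps)
qed

lemma cmod_htrans_less_1: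
  assumes "cmod p < 1" "cmod z < 1"
  shows "cmod (htrans p z) < 1"
proof -
  have "0 < 1 - (cmod (htrans p z))\<^sup>2"
    unfolding one_minus_cmod_htrans[OF assms] using assms htrans_denom_nonzero[OF assms]
    by (intro divide_pos_pos mult_pos_pos) (auto simp: abs_square_less_1)
  then show ?thesis by (simp add: abs_square_less_1)
qed

lemma hdist_htrans:
  assumes "cmod p < 1" "cmod z < 1" "cmod w < 1"
  shows "hdist (htrans p z) (htrans p w) = hdist z w"
proof -
  let ?a = "1 + cnj p * z" and ?b = "1 + cnj p * w"
  have nz: "?a \<noteq> 0" "?b \<noteq> 0" using htrans_denom_nonzero assms by auto
  have "htrans p z - htrans p w = (z - w) * (1 - p * cnj p) / (?a * ?b)"
    unfolding htrans_def using nz by (simp add: divide_simps) (simp add: algebra_simps)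
  also have "1 - p * cnj p = complex_of_real (1 - (cmod p)\<^sup>2)"
    by (metis complex_norm_square of_real_1 of_real_diff)
  finally have "cmod (htrans p z - htrans p w)
      = cmod (z - w) * \<bar>1 - (cmod p)\<^sup>2\<bar> / (cmod ?a * cmod ?b)"
    by (simp add: norm_mult norm_divide del: of_real_diff)
  then have *: "(cmod (htrans p z - htrans p w))\<^sup>2
      = (cmod (z - w))\<^sup>2 * (1 - (cmod p)\<^sup>2)\<^sup>2 / ((cmod ?a)\<^sup>2 * (cmod ?b)\<^sup>2)"
    by (simp add: power_mult_distrib power_divide)
  have pos: "1 - (cmod p)\<^sup>2 \<noteq> 0" "1 - (cmod z)\<^sup>2 \<noteq> 0" "1 - (cmod w)\<^sup>2 \<noteq> 0"
    using assms abs_square_less_1[of "cmod p"] abs_square_less_1[of "cmod z"]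
      abs_square_less_1[of "cmod w"] by auto
  have cancel: "2 * (x * P\<^sup>2 / (A * B)) / ((P * Z / A) * (P * V / B)) = 2 * x / (Z * V)"
    if "P \<noteq> 0" "Z \<noteq> 0" "V \<noteq> 0" "A \<noteq> 0" "B \<noteq> 0" for x P Z V A B :: real
    using that by (simp add: field_simps power2_eq_square)
  show ?thesis
    unfolding hdist_def * one_minus_cmod_htrans[OF assms(1,2)] one_minus_cmod_htrans[OF assms(1,3)]
    by (subst cancel) (use pos nz in auto)
qed

lemma hgeod_0: "hgeod p u 0 = p"
  by (simp add: hgeod_def htrans_def)

lemma cmod_hgeod_less_1:
  assumes "cmod p < 1" "cmod u = 1"
  shows "cmod (hgeod p u t) < 1"
  unfolding hgeod_def using assms tanh_real_lt_1[of "t/2"] tanh_real_gt_neg1[of "t/2"]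
  by (intro cmod_htrans_less_1) (auto simp: norm_mult abs_less_iff)

lemma hdist_hgeod:
  assumes "cmod p < 1" "cmod u = 1"
  shows "hdist (hgeod p u s) (hgeod p u t) = \<bar>s - t\<bar>"
proof -
  define x y where "x = tanh (s / 2)" and "y = tanh (t / 2)"
  define S C S' C' where "S = sinh (s / 2)" and "C = cosh (s / 2)"
    and "S' = sinh (t / 2)" and "C' = cosh (t / 2)"
  have bnd: "\<bar>x\<bar> < 1" "\<bar>y\<bar> < 1"
    unfolding x_def y_def
    using tanh_real_lt_1 tanh_real_gt_neg1 by (auto simp: abs_less_iff minus_less_iff)
  have C: "C \<noteq> 0" "C' \<noteq> 0" "C\<^sup>2 = S\<^sup>2 + 1" "C'\<^sup>2 = S'\<^sup>2 + 1"
    unfolding C_def C'_def S_def S'_def by (auto simp: cosh_square_eq)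
  have xy: "x = S / C" "y = S' / C'"
    by (simp_all add: x_def y_def S_def C_def S'_def C'_def tanh_def)
  have nz: "S\<^sup>2 + 1 \<noteq> 0" "S'\<^sup>2 + 1 \<noteq> 0"
    by (smt (verit) zero_le_power2)+
  have one: "1 - x\<^sup>2 = 1 / C\<^sup>2" "1 - y\<^sup>2 = 1 / C'\<^sup>2"
    unfolding xy using C nz by (simp_all add: power_divide divide_simps)
  have "(x - y)\<^sup>2 * (C\<^sup>2 * C'\<^sup>2) = (S * C' - C * S')\<^sup>2"
    unfolding xy using C(1,2) by (simp add: field_simps power2_eq_square)
  also have "S * C' - C * S' = sinh ((s - t) / 2)"
    unfolding S_def C_def S'_def C'_def by (simp add: sinh_diff diff_divide_distrib)
  finally have "1 + 2 * (x - y)\<^sup>2 / ((1 - x\<^sup>2) * (1 - y\<^sup>2)) = 1 + 2 * (sinh ((s - t) / 2))\<^sup>2"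
    unfolding one by simp
  also have "\<dots> = cosh (s - t)"
  proof -
    have "2 * ((s - t) / 2) = s - t" by simp
    then show ?thesis using cosh_double_cosh[of "(s - t) / 2"] by (simp only: cosh_square_eq) simp
  qed
  finally have key: "1 + 2 * (x - y)\<^sup>2 / ((1 - x\<^sup>2) * (1 - y\<^sup>2)) = cosh (s - t)" .
  have "hdist (hgeod p u s) (hgeod p u t) = hdist (of_real x * u) (of_real y * u)"
    unfolding hgeod_def x_def[symmetric] y_def[symmetric]
    using assms bnd by (intro hdist_htrans) (auto simp: norm_mult)
  also have "\<dots> = arcosh (cosh (s - t))"
  proof -
    have "cmod (of_real x * u - of_real y * u) = \<bar>x - y\<bar>"
      by (metis assms(2) left_diff_distrib mult.right_neutral norm_mult norm_of_real of_real_diff)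
    then show ?thesis
      unfolding hdist_def by (simp add: norm_mult assms(2) key)
  qed
  also have "\<dots> = \<bar>s - t\<bar>"
    using arcosh_cosh_real[OF abs_ge_zero, of "s - t"] by (simp only: cosh_real_abs)
  finally show ?thesis .
qed

lemma hgeod_direction:
  assumes "cmod p < 1" "cmod u = 1"
  shows "sgn (vector_derivative (hgeod p u) (at 0)) = u"
proof -
  have t: "((\<lambda>t. of_real (tanh (t / 2)) * u) has_vector_derivative (u / 2)) (at 0)"
    by (rule has_vector_derivative_eq_rhs,
        rule has_vector_derivative_mult_left,
        rule has_vector_derivative_of_real, (auto intro!: derivative_eq_intros))
  have h: "(htrans p has_field_derivative (1 - of_real ((cmod p)\<^sup>2)))
     (at (of_real (tanh (0 / 2)) * u))"
    unfolding htrans_def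
    by (rule derivative_eq_intros refl | simp)+
       (simp add: complex_norm_square[symmetric] mult.commute)
  have "(hgeod p u has_vector_derivative (u / 2 * (1 - of_real ((cmod p)\<^sup>2)))) (at 0)"
    using field_vector_diff_chain_at[OF t h] by (simp add: o_def hgeod_def[abs_def])
  then have "vector_derivative (hgeod p u) (at 0) = ((1 - (cmod p)\<^sup>2) / 2) *\<^sub>R u"
    by (subst vector_derivative_at) (auto simp: scaleR_conv_of_real)
  moreover have "0 < (1 - (cmod p)\<^sup>2) / 2"
    using assms(1) by (simp add: abs_square_less_1)
  ultimately show ?thesis
    using assms(2) by (simp only: sgn_scaleR sgn_pos) (simp add: sgn_div_norm)
qed

lemma hgeod_regular:
  assumes "cmod p < 1" "cmod u = 1"
  shows "vector_derivative (hgeod p u) (at t) \<noteq> 0"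
proof -
  let ?z = "of_real (tanh (t / 2)) * u"
  have z: "cmod ?z < 1"
    using assms(2) tanh_real_lt_1[of "t/2"] tanh_real_gt_neg1[of "t/2"]
    by (auto simp: norm_mult abs_less_iff)
  note nz = htrans_denom_nonzero[OF assms(1) z]
  have 1: "((\<lambda>t. of_real (tanh (t / 2)) * u) has_vector_derivative
      (of_real ((1 - tanh (t / 2) ^ 2) / 2) * u)) (at t)"
    by (rule has_vector_derivative_eq_rhs,
        rule has_vector_derivative_mult_left,
        rule has_vector_derivative_of_real, (auto intro!: derivative_eq_intros))
  have 2: "(htrans p has_field_derivative ((1 - p * cnj p) / (1 + cnj p * ?z)\<^sup>2)) (at ?z)"
    unfolding htrans_def
    by (rule derivative_eq_intros refl nz | simp)+
       (simp add: power2_eq_square algebra_simps)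
  have "(hgeod p u has_vector_derivative (of_real ((1 - tanh (t / 2) ^ 2) / 2) * u *
      ((1 - p * cnj p) / (1 + cnj p * ?z)\<^sup>2))) (at t)"
    using field_vector_diff_chain_at[OF 1 2] by (simp add: o_def hgeod_def[abs_def])
  then have eq: "vector_derivative (hgeod p u) (at t) = of_real ((1 - tanh (t / 2) ^ 2) / 2) * u *
      ((1 - p * cnj p) / (1 + cnj p * ?z)\<^sup>2)"
    by (rule vector_derivative_at)
  have "tanh (t / 2) ^ 2 < 1"
    using tanh_real_lt_1[of "t/2"] tanh_real_gt_neg1[of "t/2"]
    by (simp add: abs_square_less_1 abs_less_iff)
  then have a: "complex_of_real ((1 - tanh (t / 2) ^ 2) / 2) \<noteq> 0"
    by (subst of_real_eq_0_iff) simp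
  have b: "1 - p * cnj p \<noteq> 0"
  proof
    assume "1 - p * cnj p = 0"
    then have "(cmod p)\<^sup>2 = 1"
      by (metis complex_norm_square eq_iff_diff_eq_0 of_real_eq_1_iff)
    then show False using assms(1) abs_square_less_1[of "cmod p"] by simp
  qed
  have "u \<noteq> 0" using assms(2) by auto
  then show ?thesis unfolding eq using a b nz by simp
qed


section \<open>The walk and the polygon\<close>

text \<open>
  \<open>walk l \<alpha> u s i\<close> is the pair of the location \<open>p\<^sub>i\<close> after \<open>i\<close> forward moves of length \<open>l\<close>
  and the direction of the next move, where \<open>u\<close> is the direction of the first move, and the signed
  turning angle at \<open>p\<^sub>i\<close> is \<open>s i * \<alpha>\<close> for \<open>i > 0\<close>.
\<close>

primrec walk ::
    "real \<Rightarrow> real \<Rightarrow> complex \<Rightarrow> (nat \<Rightarrow> real) \<Rightarrow> nat \<Rightarrow> complex \<times> complex" where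
  "walk l \<alpha> u s 0 = (0, u)"
| "walk l \<alpha> u s (Suc i) =
     (let (p, v) = walk l \<alpha> u s i;
          w = sgn (vector_derivative (hgeod p v) (at l))
      in (hgeod p v l, cis (s (Suc i) * \<alpha>) * w))"

lemma walk_unit:
  assumes "cmod u = 1"
  shows "cmod (fst (walk l \<alpha> u s i)) < 1 \<and> cmod (snd (walk l \<alpha> u s i)) = 1"
proof (induction i)
  case 0
  then show ?case using assms by simp
next
  case (Suc i)
  obtain p v where pv: "walk l \<alpha> u s i = (p, v)" by fastforce
  with Suc have "cmod p < 1" "cmod v = 1" by auto
  then show ?case
    using cmod_hgeod_less_1 hgeod_regular by (auto simp: pv norm_mult norm_sgn)
qed

lemma hdist_walk:
  assumes "cmod u = 1" "l > 0"
  shows "hdist (fst (walk l \<alpha> u s i)) (fst (walk l \<alpha> u s (Suc i))) = l"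
proof -
  obtain p v where pv: "walk l \<alpha> u s i = (p, v)" by fastforce
  have "cmod p < 1" "cmod v = 1" using walk_unit[OF assms(1), of l \<alpha> s i] by (auto simp: pv)
  then have "hdist (hgeod p v 0) (hgeod p v l) = l"
    using hdist_hgeod[of p v 0 l] assms(2) by simp
  then show ?thesis by (simp add: pv hgeod_0)
qed

text \<open>The vertices \<open>p\<^sub>0, \<dots>, p\<^sub>n\<close> of the polygon, indexed cyclically modulo \<open>n + 1\<close>.\<close>

definition polygon_vertex ::
    "real \<Rightarrow> real \<Rightarrow> complex \<Rightarrow> (nat \<Rightarrow> real) \<Rightarrow> nat \<Rightarrow> nat \<Rightarrow> complex" where
  "polygon_vertex l \<alpha> u s n i = fst (walk l \<alpha> u s (i mod Suc n))"

primrec hchain :: "(nat \<Rightarrow> complex) \<Rightarrow> nat \<Rightarrow> real \<Rightarrow> complex" where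
  "hchain p 0 = (\<lambda>_. p 0)"
| "hchain p (Suc k) = hchain p k +++ hseg (p k) (p (Suc k))"

text \<open>The boundary of \<open>P\<^sub>n\<close>, as a closed path: \<open>n + 1\<close> geodesic segments, of which the last
  one goes from \<open>p\<^sub>n\<close> back to \<open>p\<^sub>0\<close>.\<close>

definition polygon_boundary ::
    "real \<Rightarrow> real \<Rightarrow> complex \<Rightarrow> (nat \<Rightarrow> real) \<Rightarrow> nat \<Rightarrow> real \<Rightarrow> complex" where
  "polygon_boundary l \<alpha> u s n = hchain (polygon_vertex l \<alpha> u s n) (Suc n)"


section \<open>Algebraic area\<close>

text \<open>The curve itself has measure zero; it is left out because \<open>winding_number\<close> is not
  specified there.\<close>

definition algebraic_area :: "(real \<Rightarrow> complex) \<Rightarrow> real" where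
  "algebraic_area \<gamma> = (LINT z:- path_image \<gamma>|harea. Re (winding_number \<gamma> z))"


section \<open>Winding number of the boundary\<close>

text \<open>Immersions of the circle are written as functions of period \<open>1\<close>.\<close>

definition closed_immersion :: "(real \<Rightarrow> complex) \<Rightarrow> bool" where
  "closed_immersion c \<longleftrightarrow> (\<forall>t. c (t + 1) = c t) \<and> c C1_differentiable_on UNIV
     \<and> (\<forall>t. vector_derivative c (at t) \<noteq> 0)"

definition gauss_map :: "(real \<Rightarrow> complex) \<Rightarrow> real \<Rightarrow> complex" where
  "gauss_map c t = sgn (vector_derivative c (at t))"

text \<open>The degree of a loop in the unit circle is its winding number about \<open>0\<close>.\<close>

definition immersion_winding :: "(real \<Rightarrow> complex) \<Rightarrow> real" where
  "immersion_winding c = Re (winding_number (gauss_map c) 0)"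

text \<open>
  Paths of pairs (location, unit tangent direction). The first one runs along the geodesic segment
  from \<open>p\<close> to \<open>q\<close>; a degenerate segment, which only occurs as closing edge when \<open>p\<^sub>n = p\<^sub>0\<close>, gets
  the direction \<open>1\<close>. The second one stays at \<open>p\<close> and rotates the direction \<open>v\<close> through \<open>\<theta>\<close>.
\<close>

definition edge_lift :: "complex \<Rightarrow> complex \<Rightarrow> real \<Rightarrow> complex \<times> complex" where
  "edge_lift p q t =
     (hseg p q t, if p = q then 1 else sgn (vector_derivative (hseg p q) (at t)))"

definition turn_lift :: "complex \<Rightarrow> complex \<Rightarrow> real \<Rightarrow> real \<Rightarrow> complex \<times> complex" where
  "turn_lift p v \<theta> t = (p, cis (t * \<theta>) * v)"

text \<open>Run along the first \<open>k\<close> edges of \<open>p 0, p 1, \<dots>\<close>, and rotate the tangent vector through the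
  angle \<open>\<tau> i\<close> at each \<open>p i\<close>, \<open>0 < i \<le> k\<close>.\<close>

primrec tangent_lift ::
    "(nat \<Rightarrow> complex) \<Rightarrow> (nat \<Rightarrow> real) \<Rightarrow> nat \<Rightarrow> real \<Rightarrow> complex \<times> complex" where
  "tangent_lift p \<tau> 0 = (\<lambda>_. edge_lift (p 0) (p 1) 0)"
| "tangent_lift p \<tau> (Suc k) = tangent_lift p \<tau> k +++
     (edge_lift (p k) (p (Suc k)) +++
      turn_lift (p (Suc k)) (snd (edge_lift (p k) (p (Suc k)) 1)) (\<tau> (Suc k)))"

text \<open>
  A smoothing of the polygon with tangent lift \<open>L\<close> is an immersed closed curve whose point and
  direction stay close to \<open>L\<close>. For \<open>\<delta> \<le> 1\<close> its Gauss map is never opposite to the direction of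
  \<open>L\<close>, so the tangent vector of the smoothing turns at each vertex in the way \<open>L\<close> prescribes.
\<close>

definition is_smoothing ::
    "real \<Rightarrow> (real \<Rightarrow> complex \<times> complex) \<Rightarrow> (real \<Rightarrow> complex) \<Rightarrow> bool" where
  "is_smoothing \<delta> L c \<longleftrightarrow> closed_immersion c \<and> range c \<subseteq> ball 0 1 \<and>
     (\<forall>t\<in>{0..1}. dist (c t) (fst (L t)) < \<delta> \<and> dist (gauss_map c t) (snd (L t)) < \<delta>)"

text \<open>
  \<open>w\<close> is the winding number of a smoothing of the boundary of \<open>P\<^sub>n\<close>. The rotation angles \<open>\<tau> n\<close>
  at \<open>p\<^sub>n\<close> and \<open>\<tau> (n + 1)\<close> at \<open>p\<^sub>0\<close> are arbitrary, up to the bound \<open>C\<close>, subject only to the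
  directions matching up: the tangent lift has to be continuous and closed. At the other vertices
  the directions match by the definition of \<open>walk\<close>.
\<close>

definition polygon_winding ::
    "real \<Rightarrow> real \<Rightarrow> real \<Rightarrow> real \<Rightarrow> complex \<Rightarrow> (nat \<Rightarrow> real) \<Rightarrow> nat \<Rightarrow> real \<Rightarrow> bool" where
  "polygon_winding \<delta> C l \<alpha> u s n w \<longleftrightarrow>
     (\<exists>\<tau> c. let L = tangent_lift (polygon_vertex l \<alpha> u s n) \<tau> (Suc n) in
        (\<forall>i. 0 < i \<and> i < n \<longrightarrow> \<tau> i = s i * \<alpha>) \<and>
        \<bar>\<tau> n\<bar> \<le> C \<and> \<bar>\<tau> (Suc n)\<bar> \<le> C \<and>
        path L \<and> pathfinish L = pathstart L \<and>
        is_smoothing \<delta> L c \<and> w = immersion_winding c)"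


section \<open>Central limit theorem\<close>

definition gaussian :: "real \<Rightarrow> real measure" where
  "gaussian \<sigma> = (if \<sigma> = 0 then return borel 0
     else density lborel (\<lambda>x. ennreal (normal_density 0 \<sigma> x)))"

definition satisfies_clt_mean_0 :: "'a measure \<Rightarrow> (nat \<Rightarrow> 'a \<Rightarrow> real) \<Rightarrow> bool" where
  "satisfies_clt_mean_0 M X \<longleftrightarrow> (\<forall>n. X n \<in> borel_measurable M) \<and>
     (\<exists>\<sigma>\<ge>0. weak_conv_m (\<lambda>n. distr M borel (\<lambda>\<omega>. X n \<omega> / sqrt (real n))) (gaussian \<sigma>))"

end

theory Submission
  imports Defs "HOL-Real_Asymp.Real_Asymp"
begin

text \<open>
  Both statistics are, up to a bounded error, functionals \<open>G\<close> of the sign word that are additive up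
  to a bounded defect: \<open>\<bar>G (xs @ ys) - G xs - G ys\<bar> \<le> D\<close>. Every centred functional of this kind
  satisfies a central limit theorem (\<open>chf_tendsto\<close>), whatever \<open>\<alpha>\<close> and \<open>l\<close> are. Cut a word of
  length \<open>n\<close> into \<open>k\<close> blocks, where \<open>k\<close> tends to infinity more slowly than \<open>sqrt n\<close>. The block
  contributions are independent, and their sum differs from \<open>G\<close> by \<open>O(k)\<close>, which is negligible
  against \<open>sqrt n\<close>. Flipping one sign changes \<open>G\<close> by a bounded amount, so the second and
  fourth moments are bounded as for a random walk (\<open>sign_avg_moments\<close>), and the variance divided by the
  length converges since doubling the length changes the normalised standard deviation by
  \<open>O(1 / sqrt n)\<close> only (\<open>norm_sd_diff\<close>).

  The geometry enters through one cocycle, \<open>fan_area p q = - 2 Arg (1 - cnj p * q)\<close>, the signed area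
  of the geodesic triangle with vertices \<open>0\<close>, \<open>p\<close>, \<open>q\<close>. The algebraic area of a closed geodesic
  polygon is the sum of \<open>fan_area\<close> over its edges (\<open>algebraic_area_hchain\<close>). To see this, write
  winding numbers as Cauchy integrals and exchange the two integrations. The
  inner integral, the Cauchy transform of hyperbolic area on a disc, is \<open>4 pi cnj w / (1 - |w|^2)\<close> by
  rotation invariance (\<open>cauchy_transform_hball\<close>), and its contour integral along a geodesic segment
  is elementary (\<open>hseg_area_integral\<close>).

  An isometry changes \<open>fan_area\<close> by a bounded coboundary (\<open>fan_area_htrans\<close>), and the walk after \<open>m\<close>
  moves is an isometric copy of a walk driven by the remaining signs (\<open>walk_add\<close>). Hence the area is
  additive up to the error \<open>pi\<close>. It is centred because reversing all signs reflects the walk.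

  The winding number follows by a Gauss-Bonnet identity: the tangent direction rotates by exactly
  \<open>- fan_area p q\<close> along the edge from \<open>p\<close> to \<open>q\<close> (\<open>unit_rotation_edge\<close>), so \<open>2 pi\<close> times the
  winding number is the sum of the turning angles minus the area.
\<close>

section \<open>Averages over finite sign sequences\<close>

text \<open>The expectation for independent uniform signs. The recursion on the first letter makes
  independence of consecutive blocks an identity, \<open>sign_avg_append\<close>.\<close>

primrec sign_avg :: "nat \<Rightarrow> (real list \<Rightarrow> 'b::real_vector) \<Rightarrow> 'b" where
  "sign_avg 0 f = f []"
| "sign_avg (Suc n) f =
     (1 / 2) *\<^sub>R (sign_avg n (\<lambda>xs. f (1 # xs)) + sign_avg n (\<lambda>xs. f (- 1 # xs)))"

definition sign_lists :: "nat \<Rightarrow> real list set" where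
  "sign_lists n = {xs. length xs = n \<and> set xs \<subseteq> {1, - 1}}"

lemma sign_lists_0 [simp]: "sign_lists 0 = {[]}"
  by (auto simp: sign_lists_def)

lemma Cons_in_sign_lists [simp]:
  "x # xs \<in> sign_lists (Suc n) \<longleftrightarrow> x \<in> {1, - 1} \<and> xs \<in> sign_lists n"
  by (auto simp: sign_lists_def)

lemma sign_avg_cong:
  "(\<And>xs. xs \<in> sign_lists n \<Longrightarrow> f xs = g xs) \<Longrightarrow> sign_avg n f = sign_avg n g"
proof (induction n arbitrary: f g)
  case (Suc n)
  have "sign_avg n (\<lambda>xs. f (x # xs)) = sign_avg n (\<lambda>xs. g (x # xs))" if "x \<in> {1, - 1}" for x
    using that by (intro Suc.IH Suc.prems) auto
  then show ?case by simp
qed simp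

lemma sign_avg_const [simp]: "sign_avg n (\<lambda>_. c) = c"
proof (induction n)
  case (Suc n)
  then show ?case by (simp add: scaleR_2[symmetric])
qed simp

lemma sign_avg_add: "sign_avg n (\<lambda>xs. f xs + g xs) = sign_avg n f + sign_avg n g"
  by (induction n arbitrary: f g) (auto simp: algebra_simps)

lemma sign_avg_linear: "linear h \<Longrightarrow> sign_avg n (\<lambda>xs. h (f xs)) = h (sign_avg n f)"
  by (induction n arbitrary: f) (auto simp: linear_add linear_scale)

lemma sign_avg_mult_left: "sign_avg n (\<lambda>xs. c * f xs) = c * sign_avg n f"
  for c :: "'b::real_algebra"
  by (intro sign_avg_linear) (auto intro: linearI simp: algebra_simps)

lemma sign_avg_mult_right: "sign_avg n (\<lambda>xs. f xs * c) = sign_avg n f * c"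
  for c :: "'b::real_algebra"
  by (rule sign_avg_linear[where h = "\<lambda>x. x * c"]) (auto intro: linearI simp: algebra_simps)

lemma sign_avg_diff: "sign_avg n (\<lambda>xs. f xs - g xs) = sign_avg n f - sign_avg n g"
  by (induction n arbitrary: f g) (simp_all add: scaleR_diff_right[symmetric])

lemma sign_avg_append:
  "sign_avg (m + n) f = sign_avg m (\<lambda>xs. sign_avg n (\<lambda>ys. f (xs @ ys)))"
  by (induction m arbitrary: f) auto

lemma sign_avg_mono:
  fixes f :: "real list \<Rightarrow> real"
  shows "(\<And>xs. xs \<in> sign_lists n \<Longrightarrow> f xs \<le> g xs) \<Longrightarrow> sign_avg n f \<le> sign_avg n g"
proof (induction n arbitrary: f g)
  case (Suc n)
  have "sign_avg n (\<lambda>xs. f (x # xs)) \<le> sign_avg n (\<lambda>xs. g (x # xs))" if "x \<in> {1, - 1}" for x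
    using that by (intro Suc.IH Suc.prems) auto
  then show ?case by (simp add: add_mono)
qed simp

lemma norm_sign_avg_le:
  fixes f :: "real list \<Rightarrow> 'b::real_normed_vector"
  shows "norm (sign_avg n f) \<le> sign_avg n (\<lambda>xs. norm (f xs))"
proof (induction n arbitrary: f)
  case (Suc n)
  show ?case
    using norm_triangle_ineq[of "sign_avg n (\<lambda>xs. f (1 # xs))" "sign_avg n (\<lambda>xs. f (- 1 # xs))"]
      Suc.IH[of "\<lambda>xs. f (1 # xs)"] Suc.IH[of "\<lambda>xs. f (- 1 # xs)"]
    by simp
qed simp

lemma norm_sign_avg_bound:
  fixes f :: "real list \<Rightarrow> 'b::real_normed_vector"
  assumes "\<And>xs. xs \<in> sign_lists n \<Longrightarrow> norm (f xs) \<le> B"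
  shows "norm (sign_avg n f) \<le> B"
  using norm_sign_avg_le[of n f] sign_avg_mono[of n "\<lambda>xs. norm (f xs)" "\<lambda>_. B"] assms by simp

lemma norm_sign_avg_diff_le:
  fixes f g :: "real list \<Rightarrow> 'b::real_normed_vector"
  assumes "\<And>xs. xs \<in> sign_lists n \<Longrightarrow> norm (f xs - g xs) \<le> B"
  shows "norm (sign_avg n f - sign_avg n g) \<le> B"
  unfolding sign_avg_diff[symmetric] using assms by (rule norm_sign_avg_bound)

lemma sign_avg_nonneg:
  fixes f :: "real list \<Rightarrow> real"
  shows "(\<And>xs. f xs \<ge> 0) \<Longrightarrow> sign_avg n f \<ge> 0"
  using sign_avg_mono[of n "\<lambda>_. 0" f] by simp

lemma sign_avg_abs_le_sqrt:
  fixes f :: "real list \<Rightarrow> real"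
  shows "sign_avg n (\<lambda>xs. \<bar>f xs\<bar>) \<le> sqrt (sign_avg n (\<lambda>xs. (f xs)\<^sup>2))"
proof (rule real_le_rsqrt)
  let ?a = "sign_avg n (\<lambda>xs. \<bar>f xs\<bar>)"
  have "0 \<le> sign_avg n (\<lambda>xs. (\<bar>f xs\<bar> - ?a)\<^sup>2)"
    by (rule sign_avg_nonneg) simp
  also have "(\<lambda>xs. (\<bar>f xs\<bar> - ?a)\<^sup>2) = (\<lambda>xs. ((f xs)\<^sup>2 + ?a\<^sup>2) - (2 * ?a) * \<bar>f xs\<bar>)"
    by (auto simp: power2_diff)
  also have "sign_avg n \<dots> = sign_avg n (\<lambda>xs. (f xs)\<^sup>2) + ?a\<^sup>2 - 2 * ?a * ?a"
    by (subst sign_avg_diff, subst sign_avg_add, subst sign_avg_mult_left) simp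
  finally show "?a\<^sup>2 \<le> sign_avg n (\<lambda>xs. (f xs)\<^sup>2)" by (simp add: power2_eq_square)
qed

text \<open>Minkowski's inequality for a bounded perturbation; the mixed term is controlled by
  \<open>sign_avg_abs_le_sqrt\<close>.\<close>

lemma sqrt_sign_avg_square_perturb_le:
  fixes f e :: "real list \<Rightarrow> real"
  assumes "\<And>xs. xs \<in> sign_lists n \<Longrightarrow> \<bar>e xs\<bar> \<le> D" "0 \<le> D"
  shows "sqrt (sign_avg n (\<lambda>xs. (f xs + e xs)\<^sup>2)) \<le> sqrt (sign_avg n (\<lambda>xs. (f xs)\<^sup>2)) + D"
proof (rule real_le_lsqrt)
  let ?V = "sign_avg n (\<lambda>xs. (f xs)\<^sup>2)"
  have V: "0 \<le> ?V" by (rule sign_avg_nonneg) simp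
  show "0 \<le> sqrt ?V + D" using V assms by simp
  have "sign_avg n (\<lambda>xs. (f xs + e xs)\<^sup>2) \<le> sign_avg n (\<lambda>xs. (f xs)\<^sup>2 + D\<^sup>2 + (2 * D) * \<bar>f xs\<bar>)"
  proof (rule sign_avg_mono)
    fix xs assume xs: "xs \<in> sign_lists n"
    have "(f xs + e xs)\<^sup>2 \<le> (\<bar>f xs\<bar> + D)\<^sup>2"
      using assms(1)[OF xs] by (intro power2_le_iff_abs_le[THEN iffD2]) (auto simp: assms)
    then show "(f xs + e xs)\<^sup>2 \<le> (f xs)\<^sup>2 + D\<^sup>2 + (2 * D) * \<bar>f xs\<bar>"
      by (simp add: power2_sum algebra_simps)
  qed
  also have "\<dots> = ?V + D\<^sup>2 + 2 * D * sign_avg n (\<lambda>xs. \<bar>f xs\<bar>)"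
    by (simp add: sign_avg_add sign_avg_mult_left)
  also have "\<dots> \<le> ?V + D\<^sup>2 + 2 * D * sqrt ?V"
    using assms(2) sign_avg_abs_le_sqrt[of n f] by (intro add_left_mono mult_left_mono) auto
  also have "\<dots> = (sqrt ?V + D)\<^sup>2" using V by (simp add: power2_sum algebra_simps)
  finally show "sign_avg n (\<lambda>xs. (f xs + e xs)\<^sup>2) \<le> (sqrt ?V + D)\<^sup>2" .
qed

lemma sqrt_sign_avg_square_diff_le:
  fixes f g :: "real list \<Rightarrow> real"
  assumes "\<And>xs. xs \<in> sign_lists n \<Longrightarrow> \<bar>f xs - g xs\<bar> \<le> D" "0 \<le> D"
  shows "\<bar>sqrt (sign_avg n (\<lambda>xs. (f xs)\<^sup>2)) - sqrt (sign_avg n (\<lambda>xs. (g xs)\<^sup>2))\<bar> \<le> D"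
  using sqrt_sign_avg_square_perturb_le[of n "\<lambda>xs. f xs - g xs" D g]
    sqrt_sign_avg_square_perturb_le[of n "\<lambda>xs. g xs - f xs" D f] assms
  by (simp add: abs_minus_commute abs_le_iff)

text \<open>Averaging over the first letter splits \<open>f\<close> into \<open>g \<plusminus> d\<close>, where \<open>g\<close> has the same properties for the
  remaining letters and \<open>\<bar>d\<bar> \<le> c\<close>. Odd powers of \<open>d\<close> cancel, so the moments obey the recursion for
  a random walk with steps bounded by \<open>c\<close>.\<close>

lemma sign_avg_moments:
  fixes f :: "real list \<Rightarrow> real"
  assumes "\<And>us vs. us @ 1 # vs \<in> sign_lists n \<Longrightarrow> \<bar>f (us @ 1 # vs) - f (us @ - 1 # vs)\<bar> \<le> 2 * c"
    and "sign_avg n f = 0"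
  shows "sign_avg n (\<lambda>xs. (f xs)\<^sup>2) \<le> n * c\<^sup>2 \<and> sign_avg n (\<lambda>xs. (f xs) ^ 4) \<le> 3 * (real n)\<^sup>2 * c ^ 4"
  using assms
proof (induction n arbitrary: f)
  case 0
  then show ?case by simp
next
  case (Suc n)
  define g where "g xs = (f (1 # xs) + f (- 1 # xs)) / 2" for xs
  define d where "d xs = (f (1 # xs) - f (- 1 # xs)) / 2" for xs
  have f: "f (1 # xs) = g xs + d xs" "f (- 1 # xs) = g xs - d xs" for xs
    by (simp_all add: g_def d_def field_simps)
  have d: "\<bar>d xs\<bar> \<le> c" if "xs \<in> sign_lists n" for xs
    using Suc.prems(1)[of "[]" xs] that by (simp add: d_def)
  have d2: "(d xs)\<^sup>2 \<le> c\<^sup>2" if "xs \<in> sign_lists n" for xs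
    using d[OF that] power_mono[of "\<bar>d xs\<bar>" c 2] by simp
  have d4: "(d xs) ^ 4 \<le> c ^ 4" if "xs \<in> sign_lists n" for xs
    using d[OF that] power_mono[of "\<bar>d xs\<bar>" c 4] by simp
  have IH: "sign_avg n (\<lambda>xs. (g xs)\<^sup>2) \<le> n * c\<^sup>2" "sign_avg n (\<lambda>xs. (g xs) ^ 4) \<le> 3 * (real n)\<^sup>2 * c ^ 4"
  proof -
    have "\<bar>g (us @ 1 # vs) - g (us @ - 1 # vs)\<bar> \<le> 2 * c" if "us @ 1 # vs \<in> sign_lists n" for us vs
      using Suc.prems(1)[of "1 # us" vs] Suc.prems(1)[of "- 1 # us" vs] that
      by (simp add: g_def abs_le_iff diff_divide_distrib[symmetric] pos_divide_le_eq)
    moreover have "sign_avg n g = 0"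
      using Suc.prems(2) by (simp add: f sign_avg_add sign_avg_diff)
    ultimately have "sign_avg n (\<lambda>xs. (g xs)\<^sup>2) \<le> n * c\<^sup>2
        \<and> sign_avg n (\<lambda>xs. (g xs) ^ 4) \<le> 3 * (real n)\<^sup>2 * c ^ 4"
      by (rule Suc.IH)
    then show "sign_avg n (\<lambda>xs. (g xs)\<^sup>2) \<le> n * c\<^sup>2" "sign_avg n (\<lambda>xs. (g xs) ^ 4) \<le> 3 * (real n)\<^sup>2 * c ^ 4"
      by auto
  qed
  have "sign_avg (Suc n) (\<lambda>xs. (f xs)\<^sup>2) = sign_avg n (\<lambda>xs. (g xs)\<^sup>2 + (d xs)\<^sup>2)"
    by (simp add: f power2_sum power2_diff sign_avg_add sign_avg_diff)
  also have "\<dots> \<le> sign_avg n (\<lambda>xs. (g xs)\<^sup>2 + c\<^sup>2)"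
    by (intro sign_avg_mono add_left_mono d2)
  also have "\<dots> \<le> Suc n * c\<^sup>2" using IH(1) by (simp add: sign_avg_add algebra_simps)
  finally have 1: "sign_avg (Suc n) (\<lambda>xs. (f xs)\<^sup>2) \<le> Suc n * c\<^sup>2" .
  have pow4: "(1/2) * ((a + b) ^ 4 + (a - b) ^ 4) = a ^ 4 + 6 * a\<^sup>2 * b\<^sup>2 + b ^ 4" for a b :: real
    by (simp add: power4_eq_xxxx power2_eq_square field_simps)
  have "sign_avg (Suc n) (\<lambda>xs. (f xs) ^ 4)
      = sign_avg n (\<lambda>xs. (1/2) * ((g xs + d xs) ^ 4 + (g xs - d xs) ^ 4))"
    unfolding sign_avg_mult_left sign_avg_add by (simp add: f)
  also have "\<dots> = sign_avg n (\<lambda>xs. (g xs) ^ 4 + 6 * (g xs)\<^sup>2 * (d xs)\<^sup>2 + (d xs) ^ 4)"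
    unfolding pow4 ..
  also have "\<dots> \<le> sign_avg n (\<lambda>xs. (g xs) ^ 4 + (6 * c\<^sup>2) * (g xs)\<^sup>2 + c ^ 4)"
  proof (intro sign_avg_mono add_mono d4 order_refl)
    fix xs assume "xs \<in> sign_lists n"
    from mult_left_mono[OF d2[OF this], of "6 * (g xs)\<^sup>2"]
    show "6 * (g xs)\<^sup>2 * (d xs)\<^sup>2 \<le> (6 * c\<^sup>2) * (g xs)\<^sup>2" by (simp add: mult.commute mult.left_commute)
  qed
  also have "\<dots> = sign_avg n (\<lambda>xs. (g xs) ^ 4) + 6 * c\<^sup>2 * sign_avg n (\<lambda>xs. (g xs)\<^sup>2) + c ^ 4"
    by (simp add: sign_avg_add sign_avg_mult_left)
  also have "\<dots> \<le> 3 * (real n)\<^sup>2 * c ^ 4 + 6 * c\<^sup>2 * (n * c\<^sup>2) + c ^ 4"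
    using IH by (intro add_mono mult_left_mono) auto
  also have "\<dots> \<le> 3 * (real (Suc n))\<^sup>2 * c ^ 4"
  proof -
    have "3 * (real n)\<^sup>2 * c ^ 4 + 6 * c\<^sup>2 * (n * c\<^sup>2) + c ^ 4 = (3 * (real n)\<^sup>2 + 6 * n + 1) * c ^ 4"
      by (simp add: algebra_simps power4_eq_xxxx power2_eq_square)
    also have "\<dots> \<le> 3 * (real (Suc n))\<^sup>2 * c ^ 4"
      by (intro mult_right_mono) (auto simp: power2_eq_square algebra_simps)
    finally show ?thesis .
  qed
  finally show ?case using 1 by blast
qed

section \<open>Additive functionals up to bounded error\<close>

locale sign_quasimorphism =
  fixes G :: "real list \<Rightarrow> real" and D :: real
  assumes defect: "set xs \<subseteq> {1, - 1} \<Longrightarrow> set ys \<subseteq> {1, - 1} \<Longrightarrow> \<bar>G (xs @ ys) - G xs - G ys\<bar> \<le> D"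
    and letter: "x \<in> {1, - 1} \<Longrightarrow> \<bar>G [x]\<bar> \<le> D"
    and centred: "sign_avg n G = 0"
begin

definition V :: "nat \<Rightarrow> real" where
  "V n = sign_avg n (\<lambda>xs. (G xs)\<^sup>2)"

definition norm_sd :: "nat \<Rightarrow> real" where
  "norm_sd n = sqrt (V n / n)"

definition chf :: "nat \<Rightarrow> real \<Rightarrow> complex" where
  "chf n \<theta> = sign_avg n (\<lambda>xs. iexp (\<theta> * G xs))"

lemma D_nonneg: "0 \<le> D"
  using letter[of 1] by simp

lemma defect_lists:
  "xs \<in> sign_lists m \<Longrightarrow> ys \<in> sign_lists n \<Longrightarrow> \<bar>G (xs @ ys) - (G xs + G ys)\<bar> \<le> D"
  using defect[of xs ys] by (auto simp: sign_lists_def algebra_simps)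

lemma abs_G_le: "set xs \<subseteq> {1, - 1} \<Longrightarrow> \<bar>G xs\<bar> \<le> D * (1 + 2 * length xs)"
proof (induction xs)
  case Nil
  then show ?case using defect[of "[]" "[]"] by simp
next
  case (Cons x xs)
  then show ?case using defect[of "[x]" xs] letter[of x] D_nonneg
    by (simp add: algebra_simps)
qed

lemma G_flip:
  assumes "us @ 1 # vs \<in> sign_lists n"
  shows "\<bar>G (us @ 1 # vs) - G (us @ - 1 # vs)\<bar> \<le> 2 * (3 * D)"
proof -
  have "set us \<subseteq> {1, - 1}" "set vs \<subseteq> {1, - 1}" using assms by (auto simp: sign_lists_def)
  then show ?thesis
    using defect[of us "1 # vs"] defect[of us "- 1 # vs"] defect[of "[1]" vs] defect[of "[- 1]" vs]
      letter[of 1] letter[of "- 1"] by simp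
qed

lemma V_nonneg: "0 \<le> V n"
  unfolding V_def by (rule sign_avg_nonneg) simp

lemma V_le: "V n \<le> n * (3 * D)\<^sup>2"
  and fourth_moment_le: "sign_avg n (\<lambda>xs. (G xs) ^ 4) \<le> 3 * (real n)\<^sup>2 * (3 * D) ^ 4"
  using sign_avg_moments[of n G "3 * D", OF G_flip centred] by (auto simp: V_def)

lemma third_moment_le: "sign_avg n (\<lambda>xs. \<bar>G xs\<bar> ^ 3) \<le> 2 * (3 * D) ^ 3 * sqrt n ^ 3"
proof (cases "n = 0 \<or> D = 0")
  case True
  then have "G xs = 0" if "xs \<in> sign_lists n" for xs
    using abs_G_le[of xs] that centred[of 0] by (auto simp: sign_lists_def)
  then have "sign_avg n (\<lambda>xs. \<bar>G xs\<bar> ^ 3) = sign_avg n (\<lambda>xs. 0)"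
    by (intro sign_avg_cong) auto
  then show ?thesis using D_nonneg by simp
next
  case False
  define c where "c = 3 * D * sqrt n"
  have c: "c > 0" using False D_nonneg by (auto simp: c_def)
  have 2: "V n \<le> c\<^sup>2" using V_le[of n] by (simp add: c_def power_mult_distrib mult.commute)
  have 4: "sign_avg n (\<lambda>xs. (G xs) ^ 4) \<le> 3 * c ^ 4"
  proof -
    have "sqrt (real n) ^ 4 = (real n)\<^sup>2"
      using real_sqrt_pow2[of "real n"] by (simp only: power2_eq_square power4_eq_xxxx) simp
    then show ?thesis using fourth_moment_le[of n] by (simp add: c_def power_mult_distrib mult_ac)
  qed
  \<comment> \<open>the arithmetic-geometric mean inequality interpolates between the second and fourth moments\<close>
  have "\<bar>x\<bar> ^ 3 \<le> (c / 2) * x\<^sup>2 + (1 / (2 * c)) * x ^ 4" for x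
  proof -
    have "0 \<le> (\<bar>x\<bar> - c)\<^sup>2 * x\<^sup>2 / (2 * c)" using c by simp
    also have "\<dots> = (c / 2) * x\<^sup>2 + (1 / (2 * c)) * x ^ 4 - \<bar>x\<bar> ^ 3"
      using c by (cases "x \<ge> 0") (simp_all add: field_simps power2_eq_square power3_eq_cube power4_eq_xxxx)
    finally show ?thesis by simp
  qed
  then have "sign_avg n (\<lambda>xs. \<bar>G xs\<bar> ^ 3)
      \<le> sign_avg n (\<lambda>xs. (c / 2) * (G xs)\<^sup>2 + (1 / (2 * c)) * (G xs) ^ 4)"
    by (intro sign_avg_mono)
  also have "\<dots> = (c / 2) * V n + (1 / (2 * c)) * sign_avg n (\<lambda>xs. (G xs) ^ 4)"
    unfolding sign_avg_add sign_avg_mult_left V_def ..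
  also have "\<dots> \<le> (c / 2) * c\<^sup>2 + (1 / (2 * c)) * (3 * c ^ 4)"
    using c 2 4 by (intro add_mono mult_left_mono) auto
  also have "\<dots> = 2 * c ^ 3" using c by (simp add: field_simps power2_eq_square power3_eq_cube power4_eq_xxxx)
  finally show ?thesis by (simp add: c_def power_mult_distrib)
qed

text \<open>If \<open>G\<close> were additive, the second moments of independent centred blocks would add up; the defect
  moves the \<open>L\<^sup>2\<close> norm by at most \<open>D\<close>.\<close>

lemma sqrt_V_add: "\<bar>sqrt (V (m + n)) - sqrt (V m + V n)\<bar> \<le> D"
proof -
  define e where "e xs = G xs - (G (take m xs) + G (drop m xs))" for xs
  have split: "take m xs \<in> sign_lists m \<and> drop m xs \<in> sign_lists n" if "xs \<in> sign_lists (m + n)" for xs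
    using that by (auto simp: sign_lists_def dest: in_set_takeD in_set_dropD)
  have "\<bar>sqrt (sign_avg (m + n) (\<lambda>xs. (G xs)\<^sup>2))
      - sqrt (sign_avg (m + n) (\<lambda>xs. (G (take m xs) + G (drop m xs))\<^sup>2))\<bar> \<le> D"
    by (rule sqrt_sign_avg_square_diff_le[OF _ D_nonneg])
      (metis append_take_drop_id defect_lists split)
  also have "sign_avg (m + n) (\<lambda>xs. (G (take m xs) + G (drop m xs))\<^sup>2)
      = sign_avg m (\<lambda>xs. sign_avg n (\<lambda>ys. (G xs + G ys)\<^sup>2))"
    unfolding sign_avg_append by (intro sign_avg_cong) (auto simp: sign_lists_def)
  also have "(\<lambda>xs. sign_avg n (\<lambda>ys. (G xs + G ys)\<^sup>2)) = (\<lambda>xs. (G xs)\<^sup>2 + V n)"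
    by (simp add: power2_sum sign_avg_add sign_avg_mult_left centred V_def)
  also have "sign_avg m \<dots> = V m + V n" by (simp add: sign_avg_add V_def)
  finally show ?thesis by (simp add: V_def)
qed

lemma sqrt_add_Lipschitz:
  assumes "0 \<le> x" "0 \<le> y" "0 \<le> a"
  shows "\<bar>sqrt (x + a) - sqrt (y + a)\<bar> \<le> \<bar>sqrt x - sqrt y\<bar>"
  using real_sqrt_sum_squares_triangle_ineq[of "sqrt x" "sqrt y - sqrt x" "sqrt a" 0]
    real_sqrt_sum_squares_triangle_ineq[of "sqrt y" "sqrt x - sqrt y" "sqrt a" 0] assms
  by (simp add: abs_le_iff)

lemma sqrt_V_mult: "\<bar>sqrt (V (k * m)) - sqrt (k * V m)\<bar> \<le> D * k"
proof (induction k)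
  case 0
  have "V 0 = 0" using centred[of 0] by (simp add: V_def)
  then show ?case by simp
next
  case (Suc k)
  have "\<bar>sqrt (V (k * m + m)) - sqrt (V (k * m) + V m)\<bar> \<le> D" by (rule sqrt_V_add)
  moreover have "\<bar>sqrt (V (k * m) + V m) - sqrt (k * V m + V m)\<bar> \<le> D * k"
    using sqrt_add_Lipschitz[of "V (k * m)" "k * V m" "V m"] Suc.IH V_nonneg by simp
  ultimately show ?case by (simp add: algebra_simps)
qed

lemma norm_sd_mult:
  assumes "m > 0" "k > 0"
  shows "\<bar>norm_sd (k * m) - norm_sd m\<bar> \<le> D * sqrt k / sqrt m"
proof -
  have "norm_sd (k * m) = sqrt (V (k * m)) / sqrt (k * m)" by (simp add: norm_sd_def real_sqrt_divide)
  moreover have "norm_sd m = sqrt (k * V m) / sqrt (k * m)"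
    using assms by (simp add: norm_sd_def real_sqrt_divide real_sqrt_mult)
  ultimately have "\<bar>norm_sd (k * m) - norm_sd m\<bar> = \<bar>sqrt (V (k * m)) - sqrt (k * V m)\<bar> / sqrt (k * m)"
    by (simp add: diff_divide_distrib[symmetric])
  also have "\<dots> \<le> D * k / sqrt (k * m)" by (intro divide_right_mono sqrt_V_mult) simp
  also have "\<dots> = D * sqrt k / sqrt m"
    using assms by (simp add: real_sqrt_mult field_simps)
  finally show ?thesis .
qed

text \<open>The errors of the successive doublings form a geometric series. The constant \<open>5\<close> satisfies
  \<open>5 / sqrt 2 + sqrt 2 \<le> 5\<close>, which closes the induction.\<close>

lemma norm_sd_power2:
  assumes "m > 0"
  shows "\<bar>norm_sd (2 ^ j * m) - norm_sd m\<bar> \<le> 5 * D / sqrt m"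
  using assms
proof (induction j arbitrary: m)
  case 0
  then show ?case using D_nonneg by simp
next
  case (Suc j)
  have "\<bar>norm_sd (2 ^ j * (2 * m)) - norm_sd (2 * m)\<bar> \<le> 5 * D / sqrt (2 * m)"
    using Suc.IH[of "2 * m"] Suc.prems by simp
  moreover have "\<bar>norm_sd (2 * m) - norm_sd m\<bar> \<le> D * sqrt 2 / sqrt m"
    using norm_sd_mult[of m 2] Suc.prems by simp
  moreover have "5 * D / sqrt (2 * m) + D * sqrt 2 / sqrt m \<le> 5 * D / sqrt m"
  proof -
    have "5 / sqrt 2 + sqrt 2 = 7 / 2 * sqrt 2" by (simp add: field_simps)
    also have "\<dots> \<le> 7 / 2 * (10 / 7)" by (intro mult_left_mono real_le_lsqrt) (auto simp: power2_eq_square)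
    finally have "5 / sqrt 2 + sqrt 2 \<le> 5" by simp
    from mult_left_mono[OF this, of "D / sqrt m"] show ?thesis
      using D_nonneg by (simp add: real_sqrt_mult algebra_simps)
  qed
  ultimately show ?case by (simp add: mult.assoc[symmetric] mult.commute[of _ 2])
qed

text \<open>Both sides are compared at the common length \<open>2 ^ j * m * n\<close>. Passing from \<open>2 ^ j * m\<close> to this length
  costs \<open>D * sqrt n / sqrt (2 ^ j * m)\<close>, which vanishes as \<open>j\<close> grows.\<close>

lemma norm_sd_diff:
  assumes "m > 0" "n > 0"
  shows "\<bar>norm_sd m - norm_sd n\<bar> \<le> 5 * D / sqrt m + 5 * D / sqrt n"
proof -
  have "\<bar>norm_sd m - norm_sd n\<bar> \<le> 5 * D / sqrt m + 5 * D / sqrt n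
      + (D * sqrt n / sqrt (2 ^ j * m) + D * sqrt m / sqrt (2 ^ j * n))" for j
    using norm_sd_power2[of m j] norm_sd_power2[of n j] norm_sd_mult[of "2 ^ j * m" n]
      norm_sd_mult[of "2 ^ j * n" m] assms
    by (simp add: mult.commute mult.left_commute)
  moreover have "(\<lambda>j. 5 * D / sqrt m + 5 * D / sqrt n
      + (D * sqrt n / sqrt (2 ^ j * m) + D * sqrt m / sqrt (2 ^ j * n)))
      \<longlonglongrightarrow> 5 * D / sqrt m + 5 * D / sqrt n + (0 + 0)"
  proof (intro tendsto_intros)
    have *: "(\<lambda>j. c / sqrt (2 ^ j * x)) \<longlonglongrightarrow> 0" if "x > 0" for c x :: real
      using that by real_asymp
    show "(\<lambda>j. D * sqrt n / sqrt (2 ^ j * m)) \<longlonglongrightarrow> 0" "(\<lambda>j. D * sqrt m / sqrt (2 ^ j * n)) \<longlonglongrightarrow> 0"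
      using *[of m] *[of n] assms by simp_all
  qed
  ultimately show ?thesis
    by (intro LIMSEQ_le_const[where X = "\<lambda>j. 5 * D / sqrt m + 5 * D / sqrt n
      + (D * sqrt n / sqrt (2 ^ j * m) + D * sqrt m / sqrt (2 ^ j * n))"]) auto
qed

lemma convergent_norm_sd: "convergent norm_sd"
proof (rule Cauchy_convergent, rule metric_CauchyI)
  fix e :: real assume e: "e > 0"
  have "(\<lambda>n. 5 * D / sqrt (real n)) \<longlonglongrightarrow> 0" by real_asymp
  then have "eventually (\<lambda>n. 5 * D / sqrt n < e / 2) sequentially"
    using e by (intro order_tendstoD) auto
  then obtain N :: nat where N: "\<And>n::nat. n \<ge> N \<Longrightarrow> 5 * D / sqrt n < e / 2"
    unfolding eventually_sequentially by auto
  show "\<exists>M. \<forall>m\<ge>M. \<forall>n\<ge>M. dist (norm_sd m) (norm_sd n) < e"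
  proof (intro exI allI impI)
    fix m n assume "m \<ge> N + 1" "n \<ge> N + 1"
    then show "dist (norm_sd m) (norm_sd n) < e"
      using norm_sd_diff[of m n] N[of m] N[of n] by (simp add: dist_real_def)
  qed
qed

definition sd :: real where "sd = lim norm_sd"

lemma norm_sd_tendsto: "norm_sd \<longlonglongrightarrow> sd"
  using convergent_norm_sd unfolding sd_def by (simp add: convergent_LIMSEQ_iff)

lemma sd_nonneg: "0 \<le> sd"
  using norm_sd_tendsto by (rule LIMSEQ_le_const) (auto simp: norm_sd_def V_nonneg)

end

lemma cmod_iexp_diff_le: "cmod (iexp a - iexp b) \<le> \<bar>a - b\<bar>"
proof -
  have "iexp a - iexp b = iexp b * (iexp (a - b) - 1)"
    by (simp add: right_diff_distrib exp_diff)
  then have "cmod (iexp a - iexp b) = cmod (iexp (a - b) - 1)" by (simp add: norm_mult)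
  also have "\<dots> \<le> \<bar>a - b\<bar>" using iexp_approx1[of "a - b" 0] by simp
  finally show ?thesis .
qed

lemma exp_minus_bounds:
  fixes y :: real
  assumes "0 \<le> y"
  shows "\<bar>exp (- y) - (1 - y)\<bar> \<le> y\<^sup>2"
proof -
  have "exp (- y) * (1 + y) \<le> exp (- y) * exp y"
    using exp_ge_add_one_self[of y] by (intro mult_left_mono) auto
  also have "\<dots> \<le> 1 + y ^ 3" using assms by (simp add: exp_minus)
  also have "\<dots> = (1 - y + y\<^sup>2) * (1 + y)"
    by (simp add: algebra_simps power2_eq_square power3_eq_cube)
  finally have "exp (- y) \<le> 1 - y + y\<^sup>2" using assms by simp
  then show ?thesis using exp_ge_add_one_self[of "- y"] by simp
qed

context sign_quasimorphism
begin

lemma cmod_chf_le_1: "cmod (chf n \<theta>) \<le> 1"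
  unfolding chf_def by (rule norm_sign_avg_bound) simp

lemma chf_mult: "chf m \<theta> * chf n \<theta> = sign_avg m (\<lambda>xs. sign_avg n (\<lambda>ys. iexp (\<theta> * (G xs + G ys))))"
proof -
  have "sign_avg n (\<lambda>ys. iexp (\<theta> * (G xs + G ys))) = iexp (\<theta> * G xs) * chf n \<theta>" for xs
    unfolding chf_def sign_avg_mult_left[symmetric] by (simp add: exp_add[symmetric] algebra_simps)
  then show ?thesis by (simp add: chf_def sign_avg_mult_right)
qed

text \<open>Independence makes characteristic functions of additive functionals multiplicative; the defect
  costs \<open>\<bar>\<theta>\<bar> * D\<close>.\<close>

lemma chf_add: "cmod (chf (m + n) \<theta> - chf m \<theta> * chf n \<theta>) \<le> \<bar>\<theta>\<bar> * D"
  unfolding chf_mult unfolding chf_def sign_avg_append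
proof (intro norm_sign_avg_diff_le)
  fix xs ys assume "xs \<in> sign_lists m" "ys \<in> sign_lists n"
  from mult_left_mono[OF defect_lists[OF this], of "\<bar>\<theta>\<bar>"]
  show "cmod (iexp (\<theta> * G (xs @ ys)) - iexp (\<theta> * (G xs + G ys))) \<le> \<bar>\<theta>\<bar> * D"
    by (intro order_trans[OF cmod_iexp_diff_le])
      (simp only: right_diff_distrib[symmetric] abs_mult abs_ge_zero)
qed

lemma chf_power: "cmod (chf (k * m) \<theta> - chf m \<theta> ^ k) \<le> k * (\<bar>\<theta>\<bar> * D)"
proof (induction k)
  case 0
  then show ?case using centred[of 0] by (simp add: chf_def)
next
  case (Suc k)
  have "chf (Suc k * m) \<theta> - chf m \<theta> ^ Suc k
      = (chf (k * m + m) \<theta> - chf (k * m) \<theta> * chf m \<theta>) + (chf (k * m) \<theta> - chf m \<theta> ^ k) * chf m \<theta>"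
    by (simp add: algebra_simps)
  also have "cmod \<dots> \<le> \<bar>\<theta>\<bar> * D + cmod (chf (k * m) \<theta> - chf m \<theta> ^ k) * cmod (chf m \<theta>)"
    by (intro order_trans[OF norm_triangle_ineq] add_mono chf_add) (simp add: norm_mult)
  also have "\<dots> \<le> \<bar>\<theta>\<bar> * D + k * (\<bar>\<theta>\<bar> * D) * 1"
    using D_nonneg by (intro add_left_mono mult_mono Suc.IH cmod_chf_le_1) auto
  finally show ?case by (simp add: algebra_simps)
qed

lemma chf_remainder: "cmod (chf (m + r) \<theta> - chf m \<theta>) \<le> \<bar>\<theta>\<bar> * (D * (2 + 2 * r))"
proof -
  have "cmod (chf (m + r) \<theta> - sign_avg m (\<lambda>xs. sign_avg r (\<lambda>_. iexp (\<theta> * G xs)))) \<le> \<bar>\<theta>\<bar> * (D * (2 + 2 * r))"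
    unfolding chf_def sign_avg_append
  proof (intro norm_sign_avg_diff_le)
    fix xs ys assume *: "xs \<in> sign_lists m" "ys \<in> sign_lists r"
    have "\<bar>G (xs @ ys) - G xs\<bar> \<le> D * (2 + 2 * r)"
      using abs_G_le[of ys] defect_lists[OF *] *(2) by (auto simp: sign_lists_def algebra_simps)
    from mult_left_mono[OF this, of "\<bar>\<theta>\<bar>"]
    show "cmod (iexp (\<theta> * G (xs @ ys)) - iexp (\<theta> * G xs)) \<le> \<bar>\<theta>\<bar> * (D * (2 + 2 * r))"
      by (intro order_trans[OF cmod_iexp_diff_le])
        (simp only: right_diff_distrib[symmetric] abs_mult abs_ge_zero)
  qed
  then show ?thesis by (simp add: chf_def)
qed

lemma chf_approx: "cmod (chf n \<theta> - (1 - \<theta>\<^sup>2 * V n / 2)) \<le> (3 * D) ^ 3 * (\<bar>\<theta>\<bar> * sqrt n) ^ 3"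
proof -
  let ?p = "\<lambda>xs. 1 + \<i> * of_real \<theta> * complex_of_real (G xs) - complex_of_real (\<theta>\<^sup>2 / 2) * of_real ((G xs)\<^sup>2)"
  have lin: "linear complex_of_real" by (auto intro: linearI simp: scaleR_conv_of_real)
  have "sign_avg n ?p = 1 - \<theta>\<^sup>2 * V n / 2"
    by (subst sign_avg_diff, subst sign_avg_add, (subst sign_avg_mult_left sign_avg_linear[OF lin])+)
      (simp add: centred V_def)
  then have "cmod (chf n \<theta> - (1 - \<theta>\<^sup>2 * V n / 2))
      = cmod (sign_avg n (\<lambda>xs. iexp (\<theta> * G xs) - ?p xs))"
    unfolding chf_def sign_avg_diff[symmetric] by (simp add: sign_avg_diff)
  also have "\<dots> \<le> sign_avg n (\<lambda>xs. cmod (iexp (\<theta> * G xs) - ?p xs))"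
    by (rule norm_sign_avg_le)
  also have "\<dots> \<le> sign_avg n (\<lambda>xs. \<bar>\<theta>\<bar> ^ 3 / 6 * \<bar>G xs\<bar> ^ 3)"
  proof (rule sign_avg_mono)
    fix xs
    have "(\<Sum>k\<le>2. (\<i> * of_real (\<theta> * G xs)) ^ k / fact k) = ?p xs"
      by (simp add: numeral_2_eq_2 power2_eq_square field_simps)
    moreover have "\<bar>\<theta> * G xs\<bar> ^ Suc 2 / fact (Suc 2) = \<bar>\<theta>\<bar> ^ 3 / 6 * \<bar>G xs\<bar> ^ 3"
      unfolding abs_mult power_mult_distrib by (simp add: fact_numeral numeral_3_eq_3)
    ultimately show "cmod (iexp (\<theta> * G xs) - ?p xs) \<le> \<bar>\<theta>\<bar> ^ 3 / 6 * \<bar>G xs\<bar> ^ 3"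
      using iexp_approx1[of "\<theta> * G xs" 2] by metis
  qed
  also have "\<dots> = \<bar>\<theta>\<bar> ^ 3 / 6 * sign_avg n (\<lambda>xs. \<bar>G xs\<bar> ^ 3)" by (rule sign_avg_mult_left)
  also have "\<dots> \<le> \<bar>\<theta>\<bar> ^ 3 / 6 * (2 * (3 * D) ^ 3 * sqrt n ^ 3)"
    by (intro mult_left_mono third_moment_le) auto
  also have "\<dots> \<le> (3 * D) ^ 3 * (\<bar>\<theta>\<bar> * sqrt n) ^ 3"
    using D_nonneg by (simp add: power_mult_distrib field_simps)
  finally show ?thesis .
qed

text \<open>A short block at frequency \<open>\<theta>\<close> looks Gaussian, by the third order Taylor expansion of the
  characteristic function.\<close>

lemma chf_gaussian:
  "cmod (chf n \<theta> - exp (- (\<theta>\<^sup>2 * V n / 2))) \<le> (3 * D) ^ 3 * (\<bar>\<theta>\<bar> * sqrt n) ^ 3 + (3 * D) ^ 4 * (\<bar>\<theta>\<bar> * sqrt n) ^ 4"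
proof -
  let ?y = "\<theta>\<^sup>2 * V n / 2"
  have y: "0 \<le> ?y" using V_nonneg by simp
  have sq: "(\<bar>\<theta>\<bar> * sqrt n) ^ 4 = (\<theta>\<^sup>2 * n)\<^sup>2"
  proof -
    have "(\<bar>\<theta>\<bar> * sqrt n) ^ 4 = ((\<bar>\<theta>\<bar> * sqrt n)\<^sup>2)\<^sup>2" by simp
    then show ?thesis by (simp only: power_mult_distrib power2_abs) simp
  qed
  have "\<theta>\<^sup>2 * V n / 2 \<le> \<theta>\<^sup>2 * (n * (3 * D)\<^sup>2)"
    using mult_left_mono[OF V_le[of n], of "\<theta>\<^sup>2"] y zero_le_power2[of \<theta>] by linarith
  then have "?y\<^sup>2 \<le> (\<theta>\<^sup>2 * (n * (3 * D)\<^sup>2))\<^sup>2" using y by (rule power_mono)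
  also have "\<dots> = (3 * D) ^ 4 * (\<bar>\<theta>\<bar> * sqrt n) ^ 4" unfolding sq by (simp add: power_mult_distrib)
  finally have "\<bar>exp (- ?y) - (1 - ?y)\<bar> \<le> (3 * D) ^ 4 * (\<bar>\<theta>\<bar> * sqrt n) ^ 4"
    using exp_minus_bounds[OF y] by linarith
  then have "cmod (of_real (1 - ?y) - of_real (exp (- ?y))) \<le> (3 * D) ^ 4 * (\<bar>\<theta>\<bar> * sqrt n) ^ 4"
    unfolding of_real_diff[symmetric] norm_of_real by (simp add: abs_minus_commute)
  then have "cmod (chf n \<theta> - of_real (1 - ?y)) + cmod (of_real (1 - ?y) - of_real (exp (- ?y)))
      \<le> (3 * D) ^ 3 * (\<bar>\<theta>\<bar> * sqrt n) ^ 3 + (3 * D) ^ 4 * (\<bar>\<theta>\<bar> * sqrt n) ^ 4"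
    using chf_approx[of n \<theta>] by (intro add_mono) (simp_all add: power_mult_distrib)
  then show ?thesis
    using norm_triangle_ineq[of "chf n \<theta> - of_real (1 - ?y)" "of_real (1 - ?y) - of_real (exp (- ?y))"]
    by (simp del: of_real_diff add: exp_of_real)
qed

text \<open>The block argument. With \<open>n = k * m + r\<close> and \<open>r < k\<close>, splitting off the blocks costs \<open>O(k / sqrt n)\<close>,
  and replacing each of the \<open>k\<close> factors by a Gaussian one costs \<open>k * O(k powr (- 3 / 2))\<close>.\<close>

lemma chf_tendsto: "(\<lambda>n. chf n (t / sqrt n)) \<longlonglongrightarrow> of_real (exp (- (t\<^sup>2 * sd\<^sup>2 / 2)))"
proof -
  \<comment> \<open>any exponent strictly between \<open>0\<close> and \<open>1 / 2\<close> would serve\<close>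
  define k where "k n = nat \<lfloor>real n powr (1 / 4)\<rfloor>" for n
  define m where "m n = n div k n" for n
  define r where "r n = n mod k n" for n
  have n: "n = k n * m n + r n" for n by (simp add: m_def r_def)
  have klim: "filterlim k at_top sequentially" unfolding k_def by real_asymp
  have kpos: "eventually (\<lambda>n. k n > 0 \<and> n > 0) sequentially"
    using eventually_gt_at_top[of 0] filterlim_at_top[THEN iffD1, OF klim, rule_format, of 1]
    by eventually_elim simp
  have ksqrt: "(\<lambda>n. real (k n) / sqrt n) \<longlonglongrightarrow> 0" unfolding k_def by real_asymp
  have kn: "(\<lambda>n. real (k n) / n) \<longlonglongrightarrow> 0" unfolding k_def by real_asymp
  have kinf: "filterlim (\<lambda>n. real (k n)) at_top sequentially"
    using klim by (rule filterlim_compose[OF filterlim_real_sequentially])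
  have rk: "r n < k n" if "k n > 0" for n using that by (simp add: r_def)
  have km_le: "k n * m n \<le> n" for n by (subst (2) n) simp
  have mlim: "filterlim m at_top sequentially"
  proof -
    have "filterlim (\<lambda>n. real n / real (k n) - 1) at_top sequentially"
      unfolding k_def by real_asymp
    moreover have "eventually (\<lambda>n. real n / real (k n) - 1 \<le> real (m n)) sequentially"
      using kpos
    proof eventually_elim
      case (elim n)
      have "n < k n * m n + k n" using n[of n] rk[of n] elim by linarith
      then have "real n < k n * m n + k n" by (metis of_nat_add of_nat_less_iff of_nat_mult)
      then show ?case using elim by (simp add: field_simps)
    qed
    ultimately have "filterlim (\<lambda>n. real (m n)) at_top sequentially"
      by (rule filterlim_at_top_mono)
    then show ?thesis by (simp add: filterlim_sequentially_iff_filterlim_real)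
  qed
  have kmn: "(\<lambda>n. real (k n * m n) / n) \<longlonglongrightarrow> 1"
  proof (rule tendsto_sandwich)
    show "(\<lambda>n. 1 - real (k n) / n) \<longlonglongrightarrow> 1"
      using tendsto_diff[OF tendsto_const[of 1] kn] by simp
    show "eventually (\<lambda>n. 1 - real (k n) / n \<le> real (k n * m n) / n) sequentially"
      using kpos
    proof eventually_elim
      case (elim n)
      have "n \<le> k n * m n + k n" using n[of n] rk[of n] elim by linarith
      then have "real n \<le> real (k n * m n) + k n" by (metis of_nat_add of_nat_le_iff)
      then have "(real n - k n) / n \<le> real (k n * m n) / n" by (intro divide_right_mono) auto
      then show ?case using elim by (simp add: diff_divide_distrib)
    qed
    show "eventually (\<lambda>n. real (k n * m n) / n \<le> 1) sequentially"
      using kpos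
    proof eventually_elim
      case (elim n)
      have "real (k n * m n) \<le> n" using km_le by (rule of_nat_mono)
      then show ?case using elim by (simp add: field_simps)
    qed
  qed simp
  define g where "g n = complex_of_real (exp (- (t\<^sup>2 / 2 * (real (k n * m n) / n) * (norm_sd (m n))\<^sup>2)))" for n
  have "(\<lambda>n. complex_of_real (exp (- (t\<^sup>2 / 2 * (real (k n * m n) / n) * (norm_sd (m n))\<^sup>2))))
      \<longlonglongrightarrow> of_real (exp (- (t\<^sup>2 / 2 * 1 * sd\<^sup>2)))"
    by (intro tendsto_intros kmn filterlim_compose[OF norm_sd_tendsto mlim])
  then have g: "g \<longlonglongrightarrow> of_real (exp (- (t\<^sup>2 * sd\<^sup>2 / 2)))" by (simp add: g_def[abs_def])
  define E where "E n = 2 * \<bar>t\<bar> * D / sqrt n + 3 * \<bar>t\<bar> * D * (real (k n) / sqrt n)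
      + (3 * D) ^ 3 * \<bar>t\<bar> ^ 3 / sqrt (k n) + (3 * D) ^ 4 * \<bar>t\<bar> ^ 4 / k n" for n
  have "E \<longlonglongrightarrow> 0 + 3 * \<bar>t\<bar> * D * 0 + 0 + 0"
    unfolding E_def
  proof (intro tendsto_intros ksqrt)
    show "(\<lambda>n. 2 * \<bar>t\<bar> * D / sqrt (real n)) \<longlonglongrightarrow> 0" by real_asymp
    show "(\<lambda>n. (3 * D) ^ 3 * \<bar>t\<bar> ^ 3 / sqrt (real (k n))) \<longlonglongrightarrow> 0"
      by (rule real_tendsto_divide_at_top[OF tendsto_const filterlim_compose[OF sqrt_at_top kinf]])
    show "(\<lambda>n. (3 * D) ^ 4 * \<bar>t\<bar> ^ 4 / real (k n)) \<longlonglongrightarrow> 0"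
      by (rule real_tendsto_divide_at_top[OF tendsto_const kinf])
  qed
  then have E: "E \<longlonglongrightarrow> 0" by simp
  have "eventually (\<lambda>n. norm (chf n (t / sqrt n) - g n) \<le> E n) sequentially"
    using kpos
  proof eventually_elim
    case (elim n)
    define \<theta> where "\<theta> = t / sqrt n"
    define h where "h = complex_of_real (exp (- (\<theta>\<^sup>2 * V (m n) / 2)))"
    have "exp (- (\<theta>\<^sup>2 * V (m n) / 2)) ^ k n
        = exp (- (t\<^sup>2 / 2 * (real (k n * m n) / n) * (norm_sd (m n))\<^sup>2))"
    proof -
      have "real (m n) * (norm_sd (m n))\<^sup>2 = V (m n)"
        using V_le[of 0] V_nonneg[of 0] V_nonneg[of "m n"] by (cases "m n = 0") (simp_all add: norm_sd_def)
      then have "t\<^sup>2 / 2 * (real (k n * m n) / n) * (norm_sd (m n))\<^sup>2 = real (k n) * (\<theta>\<^sup>2 * V (m n) / 2)"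
        by (simp add: \<theta>_def power_divide mult_ac)
      then show ?thesis by (simp add: exp_of_nat_mult[symmetric])
    qed
    then have gh: "g n = h ^ k n" by (simp add: g_def h_def of_real_power[symmetric] del: of_real_power)
    have h1: "cmod h \<le> 1" using V_nonneg by (simp add: h_def)
    have \<theta>m: "\<bar>\<theta>\<bar> * sqrt (m n) \<le> \<bar>t\<bar> / sqrt (k n)"
    proof -
      have "real (k n * m n) \<le> n" using km_le by (rule of_nat_mono)
      then have "sqrt (k n) * sqrt (m n) \<le> sqrt n" by (simp add: real_sqrt_mult[symmetric])
      then have "\<bar>t\<bar> * (sqrt (k n) * sqrt (m n)) \<le> \<bar>t\<bar> * sqrt n" by (intro mult_left_mono) auto
      then show ?thesis using elim by (simp add: \<theta>_def field_simps)
    qed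
    have "cmod (chf (m n) \<theta> - h)
        \<le> (3 * D) ^ 3 * (\<bar>\<theta>\<bar> * sqrt (m n)) ^ 3 + (3 * D) ^ 4 * (\<bar>\<theta>\<bar> * sqrt (m n)) ^ 4"
      using chf_gaussian[of "m n" \<theta>] by (simp add: h_def exp_of_real)
    also have "\<dots> \<le> (3 * D) ^ 3 * (\<bar>t\<bar> / sqrt (k n)) ^ 3 + (3 * D) ^ 4 * (\<bar>t\<bar> / sqrt (k n)) ^ 4"
      using \<theta>m D_nonneg by (intro add_mono mult_left_mono power_mono) auto
    finally have 1: "cmod (chf (m n) \<theta> - h) \<le> \<dots>" .
    have "cmod (chf (m n) \<theta> ^ k n - h ^ k n) \<le> real (k n) * cmod (chf (m n) \<theta> - h)"
      by (rule norm_power_diff[OF cmod_chf_le_1 h1])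
    also have "\<dots> \<le> real (k n) * ((3 * D) ^ 3 * (\<bar>t\<bar> / sqrt (k n)) ^ 3 + (3 * D) ^ 4 * (\<bar>t\<bar> / sqrt (k n)) ^ 4)"
      by (intro mult_left_mono 1) simp
    also have "\<dots> = (3 * D) ^ 3 * \<bar>t\<bar> ^ 3 / sqrt (k n) + (3 * D) ^ 4 * \<bar>t\<bar> ^ 4 / k n"
    proof -
      define q where "q = sqrt (k n)"
      have q: "q > 0" "real (k n) = q * q" using elim by (auto simp: q_def)
      show ?thesis unfolding q_def[symmetric] unfolding q(2) using q(1)
        by (simp add: field_simps power3_eq_cube power4_eq_xxxx)
    qed
    finally have 2: "cmod (chf (m n) \<theta> ^ k n - g n)
        \<le> (3 * D) ^ 3 * \<bar>t\<bar> ^ 3 / sqrt (k n) + (3 * D) ^ 4 * \<bar>t\<bar> ^ 4 / k n" unfolding gh .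
    have "\<bar>\<theta>\<bar> * (D * (2 + 2 * r n)) + k n * (\<bar>\<theta>\<bar> * D) \<le> \<bar>\<theta>\<bar> * (D * (2 + 2 * k n)) + k n * (\<bar>\<theta>\<bar> * D)"
      using rk[of n] elim D_nonneg by (intro add_mono mult_left_mono) auto
    also have "\<dots> = 2 * \<bar>t\<bar> * D / sqrt n + 3 * \<bar>t\<bar> * D * (real (k n) / sqrt n)"
      using elim by (simp add: \<theta>_def field_simps)
    finally have 3: "\<bar>\<theta>\<bar> * (D * (2 + 2 * r n)) + k n * (\<bar>\<theta>\<bar> * D) \<le> \<dots>" .
    have "cmod (chf n \<theta> - g n) \<le> cmod (chf n \<theta> - chf (k n * m n) \<theta>)
        + cmod (chf (k n * m n) \<theta> - chf (m n) \<theta> ^ k n) + cmod (chf (m n) \<theta> ^ k n - g n)"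
      by (rule order_trans[OF _ norm_triangle_ineq[THEN order_trans, OF add_right_mono[OF norm_triangle_ineq]]]) simp
    also have "\<dots> \<le> \<bar>\<theta>\<bar> * (D * (2 + 2 * r n)) + k n * (\<bar>\<theta>\<bar> * D)
        + ((3 * D) ^ 3 * \<bar>t\<bar> ^ 3 / sqrt (k n) + (3 * D) ^ 4 * \<bar>t\<bar> ^ 4 / k n)"
      using chf_remainder[of "k n * m n" "r n" \<theta>] n[of n] by (intro add_mono chf_power 2) simp
    also have "\<dots> \<le> E n" unfolding E_def using 3 by linarith
    finally show ?case by (simp add: \<theta>_def)
  qed
  then have "(\<lambda>n. chf n (t / sqrt n) - g n) \<longlonglongrightarrow> 0"
    using E by (rule Lim_null_comparison)
  from tendsto_add[OF this g] show ?thesis by simp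
qed

end

section \<open>Random signs and the central limit theorem\<close>

lemma sign_lists_Suc: "sign_lists (Suc n) = (#) 1 ` sign_lists n \<union> (#) (- 1) ` sign_lists n"
  by (auto simp: sign_lists_def length_Suc_conv)

lemma finite_sign_lists [simp]: "finite (sign_lists n)"
  by (induction n) (auto simp: sign_lists_Suc)

lemma sign_avg_eq_sum: "sign_avg n f = (1 / 2) ^ n *\<^sub>R (\<Sum>xs\<in>sign_lists n. f xs)"
proof (induction n arbitrary: f)
  case (Suc n)
  have "(\<Sum>xs\<in>sign_lists (Suc n). f xs)
      = (\<Sum>xs\<in>sign_lists n. f (1 # xs)) + (\<Sum>xs\<in>sign_lists n. f (- 1 # xs))"
    unfolding sign_lists_Suc by (subst sum.union_disjoint) (auto simp: sum.reindex)
  then show ?case by (simp add: Suc.IH algebra_simps)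
qed simp

locale random_signs = prob_space M for M :: "'a measure" +
  fixes s :: "nat \<Rightarrow> 'a \<Rightarrow> real"
  assumes indep: "indep_vars (\<lambda>_. borel) s {1..}"
    and sign: "i \<ge> 1 \<Longrightarrow> \<omega> \<in> space M \<Longrightarrow> s i \<omega> \<in> {1, - 1}"
    and prob_sign: "i \<ge> 1 \<Longrightarrow> x \<in> {1, - 1} \<Longrightarrow> prob {\<omega> \<in> space M. s i \<omega> = x} = 1 / 2"
begin

definition word :: "nat \<Rightarrow> 'a \<Rightarrow> real list" where
  "word n \<omega> = map (\<lambda>i. s i \<omega>) [1..<Suc n]"

lemma word_in_sign_lists: "\<omega> \<in> space M \<Longrightarrow> word n \<omega> \<in> sign_lists n"
  using sign by (fastforce simp: word_def sign_lists_def)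

lemma word_eq_iff:
  assumes "xs \<in> sign_lists n"
  shows "word n \<omega> = xs \<longleftrightarrow> (\<forall>i\<in>{1..n}. s i \<omega> = xs ! (i - 1))"
proof -
  have "word n \<omega> = xs \<longleftrightarrow> (\<forall>j<n. s (Suc j) \<omega> = xs ! j)"
    using assms by (simp add: word_def sign_lists_def list_eq_iff_nth_eq del: upt_Suc)
  also have "\<dots> \<longleftrightarrow> (\<forall>i\<in>{1..n}. s i \<omega> = xs ! (i - 1))"
  proof safe
    fix i assume "\<forall>j<n. s (Suc j) \<omega> = xs ! j" "i \<in> {1..n}"
    then show "s i \<omega> = xs ! (i - 1)" by (cases i) auto
  next
    fix j assume *: "\<forall>i\<in>{1..n}. s i \<omega> = xs ! (i - 1)" "j < n"
    then show "s (Suc j) \<omega> = xs ! j" using bspec[OF *(1), of "Suc j"] by simp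
  qed
  finally show ?thesis .
qed

lemma s_measurable: "i \<ge> 1 \<Longrightarrow> s i \<in> borel_measurable M"
  using indep by (simp add: indep_vars_def2)

lemma word_event: "xs \<in> sign_lists n \<Longrightarrow> {\<omega> \<in> space M. word n \<omega> = xs} \<in> sets M"
  and prob_word: "xs \<in> sign_lists n \<Longrightarrow> prob {\<omega> \<in> space M. word n \<omega> = xs} = (1 / 2) ^ n"
proof -
  assume xs: "xs \<in> sign_lists n"
  let ?E = "\<lambda>i. s i -` {xs ! (i - 1)} \<inter> space M"
  show "{\<omega> \<in> space M. word n \<omega> = xs} \<in> sets M"
  proof (cases "n = 0")
    case False
    have "{\<omega> \<in> space M. word n \<omega> = xs} = (\<Inter>i\<in>{1..n}. ?E i)"
      using False by (auto simp: word_eq_iff[OF xs])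
    also have "\<dots> \<in> sets M"
      using False by (intro sets.finite_INT measurable_sets[OF s_measurable]) auto
    finally show ?thesis .
  qed (use xs in \<open>simp add: word_def\<close>)
  show "prob {\<omega> \<in> space M. word n \<omega> = xs} = (1 / 2) ^ n"
  proof (cases "n = 0")
    case True
    then show ?thesis using xs prob_space by (simp add: word_def)
  next
    case False
    have "{\<omega> \<in> space M. word n \<omega> = xs} = (\<Inter>i\<in>{1..n}. ?E i)"
      using False by (auto simp: word_eq_iff[OF xs])
    also have "prob \<dots> = (\<Prod>i\<in>{1..n}. prob (?E i))"
      using False by (intro indep_varsD[OF indep]) auto
    also have "\<dots> = (\<Prod>i\<in>{1..n}. 1 / 2)"
    proof (rule prod.cong[OF refl])
      fix i assume i: "i \<in> {1..n}"
      then have "xs ! (i - 1) \<in> {1, - 1}" using xs nth_mem[of "i - 1" xs] by (fastforce simp: sign_lists_def)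
      moreover have "?E i = {\<omega> \<in> space M. s i \<omega> = xs ! (i - 1)}" by auto
      ultimately show "prob (?E i) = 1 / 2" using prob_sign[of i] i by simp
    qed
    finally show ?thesis by simp
  qed
qed

lemma has_integral_word:
  fixes f :: "real list \<Rightarrow> 'b::{banach, second_countable_topology}"
  shows "has_bochner_integral M (\<lambda>\<omega>. f (word n \<omega>)) (sign_avg n f)"
proof -
  let ?g = "\<lambda>\<omega>. \<Sum>xs\<in>sign_lists n. indicator {\<omega> \<in> space M. word n \<omega> = xs} \<omega> *\<^sub>R f xs"
  have "has_bochner_integral M ?g (\<Sum>xs\<in>sign_lists n. prob {\<omega> \<in> space M. word n \<omega> = xs} *\<^sub>R f xs)"
    by (intro has_bochner_integral_sum has_bochner_integral_scaleR_left has_bochner_integral_real_indicator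
        word_event) (auto simp: less_top[symmetric])
  also have "(\<Sum>xs\<in>sign_lists n. prob {\<omega> \<in> space M. word n \<omega> = xs} *\<^sub>R f xs) = sign_avg n f"
    by (simp add: prob_word sign_avg_eq_sum scaleR_sum_right)
  finally show ?thesis
  proof (rule has_bochner_integral_cong[THEN iffD1, rotated -1])
    fix \<omega> assume \<omega>: "\<omega> \<in> space M"
    then have "?g \<omega> = (\<Sum>xs\<in>sign_lists n. if xs = word n \<omega> then f xs else 0)"
      by (intro sum.cong) (auto simp: indicator_def)
    then show "?g \<omega> = f (word n \<omega>)" using word_in_sign_lists[OF \<omega>, of n] by simp
  qed auto
qed

lemma word_measurable: "(\<lambda>\<omega>. f (word n \<omega>)) \<in> borel_measurable M"
  for f :: "real list \<Rightarrow> 'b::{banach, second_countable_topology}"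
  using has_integral_word[of f n] by (auto simp: has_bochner_integral_iff)

end

lemma real_distribution_gaussian: "0 \<le> \<sigma> \<Longrightarrow> real_distribution (gaussian \<sigma>)"
proof (cases "\<sigma> = 0")
  case True
  have "prob_space (return borel (0::real))" by (rule prob_space_return) simp
  then show ?thesis using True
    by (simp add: gaussian_def real_distribution_def real_distribution_axioms_def)
next
  case False
  assume "0 \<le> \<sigma>"
  with False have "prob_space (density lborel (normal_density 0 \<sigma>))"
    by (intro prob_space_normal_density) simp
  then show ?thesis using False
    by (simp add: gaussian_def real_distribution_def real_distribution_axioms_def)
qed

lemma char_gaussian:
  assumes "0 \<le> \<sigma>"
  shows "char (gaussian \<sigma>) t = of_real (exp (- (t\<^sup>2 * \<sigma>\<^sup>2 / 2)))"
proof (cases "\<sigma> = 0")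
  case True
  then show ?thesis by (simp add: gaussian_def char_def integral_return)
next
  case False
  with assms have \<sigma>: "\<sigma> > 0" by simp
  interpret std: prob_space std_normal_distribution by (rule prob_space_normal_density) simp
  have "distributed std_normal_distribution lborel (\<lambda>x. x) (normal_density 0 1)"
    by (simp add: distributed_def distr_id2 distr_cong[of _ _ lborel borel])
  from std.normal_density_affine[OF this _ \<open>\<sigma> \<noteq> 0\<close>, of 0]
  have "distributed std_normal_distribution lborel (\<lambda>x. \<sigma> * x) (normal_density 0 \<sigma>)"
    using \<sigma> by simp
  then have "distr std_normal_distribution lborel (\<lambda>x. \<sigma> * x) = density lborel (normal_density 0 \<sigma>)"
    by (simp add: distributed_def)
  then have "gaussian \<sigma> = distr std_normal_distribution borel (\<lambda>x. \<sigma> * x)"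
    using False by (simp add: gaussian_def cong: distr_cong)
  then have "char (gaussian \<sigma>) t = char std_normal_distribution (t * \<sigma>)"
    unfolding char_def by (simp add: integral_distr mult.assoc)
  then show ?thesis by (simp add: char_std_normal_distribution power_mult_distrib)
qed

context random_signs
begin

text \<open>A bounded error disappears after division by \<open>sqrt n\<close>, so Levy's continuity theorem reduces the
  claim to \<open>chf_tendsto\<close>.\<close>

lemma central_limit_bounded_distance:
  fixes X :: "nat \<Rightarrow> 'a \<Rightarrow> real"
  assumes "sign_quasimorphism G D"
    and X: "\<And>n. X n \<in> borel_measurable M"
    and close: "\<And>n \<omega>. n \<ge> 1 \<Longrightarrow> \<omega> \<in> space M \<Longrightarrow> \<bar>X n \<omega> - G (word n \<omega>)\<bar> \<le> B"
  shows "satisfies_clt_mean_0 M X"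
  unfolding satisfies_clt_mean_0_def
proof (intro conjI allI exI)
  interpret G: sign_quasimorphism G D by fact
  show "X n \<in> borel_measurable M" for n by (rule X)
  show "0 \<le> G.sd" by (rule G.sd_nonneg)
  let ?\<mu> = "\<lambda>n. distr M borel (\<lambda>\<omega>. X n \<omega> / sqrt (real n))"
  show "weak_conv_m ?\<mu> (gaussian G.sd)"
  proof (rule levy_continuity)
    show "real_distribution (?\<mu> n)" for n
      using X by (intro real_distribution_distr) simp
    show "real_distribution (gaussian G.sd)"
      by (rule real_distribution_gaussian[OF G.sd_nonneg])
    fix t
    have "eventually (\<lambda>n. norm (char (?\<mu> n) t - G.chf n (t / sqrt n)) \<le> \<bar>t\<bar> * B / sqrt n) sequentially"
      using eventually_gt_at_top[of 0]
    proof eventually_elim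
      case (elim n)
      let ?f = "\<lambda>\<omega>. iexp (t * (X n \<omega> / sqrt n))" and ?g = "\<lambda>\<omega>. iexp (t / sqrt n * G (word n \<omega>))"
      have f: "integrable M ?f" using X
        by (intro integrable_const_bound[where B = 1]) (auto simp: norm_mult)
      have g: "integrable M ?g" "integral\<^sup>L M ?g = G.chf n (t / sqrt n)"
        using has_integral_word[of "\<lambda>xs. iexp (t / sqrt n * G xs)" n]
        by (simp_all add: has_bochner_integral_iff G.chf_def)
      have "char (?\<mu> n) t = integral\<^sup>L M ?f"
        unfolding char_def using X by (subst integral_distr) auto
      then have "norm (char (?\<mu> n) t - G.chf n (t / sqrt n)) = norm (\<integral>\<omega>. ?f \<omega> - ?g \<omega> \<partial>M)"
        using f g by (simp add: Bochner_Integration.integral_diff)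
      also have "\<dots> \<le> (LINT \<omega>|M. \<bar>t\<bar> * B / sqrt n)"
      proof (rule order_trans[OF integral_norm_bound integral_mono])
        fix \<omega> assume \<omega>: "\<omega> \<in> space M"
        have "norm (?f \<omega> - ?g \<omega>) \<le> \<bar>t * (X n \<omega> / sqrt n) - t / sqrt n * G (word n \<omega>)\<bar>"
          by (rule cmod_iexp_diff_le)
        also have "t * (X n \<omega> / sqrt n) - t / sqrt n * G (word n \<omega>) = t / sqrt n * (X n \<omega> - G (word n \<omega>))"
          by (simp add: algebra_simps)
        also have "\<bar>\<dots>\<bar> \<le> \<bar>t\<bar> / sqrt n * B"
          unfolding abs_mult using close[of n \<omega>] \<omega> elim by (intro mult_mono) auto
        finally show "norm (?f \<omega> - ?g \<omega>) \<le> \<bar>t\<bar> * B / sqrt n" by simp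
      qed (use f g in simp_all)
      finally show ?case by (simp add: prob_space)
    qed
    moreover have "(\<lambda>n. \<bar>t\<bar> * B / sqrt (real n)) \<longlonglongrightarrow> 0" by real_asymp
    ultimately have "(\<lambda>n. char (?\<mu> n) t - G.chf n (t / sqrt n)) \<longlonglongrightarrow> 0"
      by (rule Lim_null_comparison)
    from tendsto_add[OF this G.chf_tendsto[of t]]
    show "(\<lambda>n. char (?\<mu> n) t) \<longlonglongrightarrow> char (gaussian G.sd) t"
      by (simp add: char_gaussian[OF G.sd_nonneg])
  qed
qed

end

section \<open>Integration of radial functions over the plane\<close>

lemma ball_measurable [measurable]: "ball z r \<in> sets borel" for z :: complex
  by simp

lemma nn_integral_lborel_translate:
  fixes f :: "'a::euclidean_space \<Rightarrow> ennreal"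
  assumes "f \<in> borel_measurable borel"
  shows "(\<integral>\<^sup>+z. f (z + a) \<partial>lborel) = (\<integral>\<^sup>+z. f z \<partial>lborel)"
proof -
  have "(\<integral>\<^sup>+z. f z \<partial>lborel) = (\<integral>\<^sup>+z. f z \<partial>distr lborel borel ((+) a))"
    by (simp add: lborel_distr_plus)
  also have "\<dots> = (\<integral>\<^sup>+z. f (z + a) \<partial>lborel)"
    using assms by (subst nn_integral_distr) (auto simp: add.commute)
  finally show ?thesis ..
qed

text \<open>Uniqueness of translation invariant measures: the double integral of
  \<open>indicator A (c * x) * indicator B (y - c * x)\<close>, for \<open>B\<close> the unit disc, is evaluated in both orders.
  The scaling factor is \<open>1\<close> because the disc is invariant under rotation.\<close>

lemma lborel_distr_unit_mult:
  assumes c: "cmod c = 1"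
  shows "distr lborel borel (\<lambda>z. c * z) = (lborel :: complex measure)"
proof (rule measure_eqI)
  fix A assume "A \<in> sets (distr lborel borel (\<lambda>z. c * z))"
  then have A[measurable]: "A \<in> sets borel" by simp
  have c0: "c \<noteq> 0" using c by auto
  let ?a = "indicator A :: complex \<Rightarrow> ennreal"
    and ?b = "indicator (ball 0 1) :: complex \<Rightarrow> ennreal"
  let ?\<nu> = "\<integral>\<^sup>+x. ?a (c * x) \<partial>lborel"
  have b: "(\<integral>\<^sup>+y. ?b y \<partial>lborel) = emeasure lborel (ball 0 1 :: complex set)" by simp
  have "?\<nu> * emeasure lborel (ball 0 1 :: complex set) = (\<integral>\<^sup>+x. ?a (c * x) * (\<integral>\<^sup>+y. ?b y \<partial>lborel) \<partial>lborel)"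
    unfolding b by (rule nn_integral_multc[symmetric]) measurable
  also have "\<dots> = (\<integral>\<^sup>+x. (\<integral>\<^sup>+y. ?a (c * x) * ?b (y - c * x) \<partial>lborel) \<partial>lborel)"
  proof (rule nn_integral_cong)
    fix x
    have "(\<integral>\<^sup>+y. ?b y \<partial>lborel) = (\<integral>\<^sup>+y. ?b (y - c * x) \<partial>lborel)"
      using nn_integral_lborel_translate[of ?b "- (c * x)", OF borel_measurable_indicator] by simp
    then show "?a (c * x) * (\<integral>\<^sup>+y. ?b y \<partial>lborel) = (\<integral>\<^sup>+y. ?a (c * x) * ?b (y - c * x) \<partial>lborel)"
      by (subst nn_integral_cmult) measurable
  qed
  also have "\<dots> = (\<integral>\<^sup>+y. (\<integral>\<^sup>+x. ?a (c * x) * ?b (y - c * x) \<partial>lborel) \<partial>lborel)"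
    by (rule lborel_pair.Fubini'[symmetric]) measurable
  also have "\<dots> = (\<integral>\<^sup>+y. (\<integral>\<^sup>+x. ?a (c * x + y) * ?b x \<partial>lborel) \<partial>lborel)"
  proof (rule nn_integral_cong)
    fix y
    have "(\<integral>\<^sup>+x. ?a (c * x) * ?b (y - c * x) \<partial>lborel)
        = (\<integral>\<^sup>+x. ?a (c * (x + y / c)) * ?b (y - c * (x + y / c)) \<partial>lborel)"
      by (rule nn_integral_lborel_translate[symmetric]) measurable
    also have "\<dots> = (\<integral>\<^sup>+x. ?a (c * x + y) * ?b x \<partial>lborel)"
      using c c0 by (intro nn_integral_cong) (auto simp: algebra_simps indicator_def norm_mult)
    finally show "(\<integral>\<^sup>+x. ?a (c * x) * ?b (y - c * x) \<partial>lborel)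
        = (\<integral>\<^sup>+x. ?a (c * x + y) * ?b x \<partial>lborel)" .
  qed
  also have "\<dots> = (\<integral>\<^sup>+x. (\<integral>\<^sup>+y. ?a (c * x + y) * ?b x \<partial>lborel) \<partial>lborel)"
    by (rule lborel_pair.Fubini') measurable
  also have "\<dots> = (\<integral>\<^sup>+x. emeasure lborel A * ?b x \<partial>lborel)"
  proof (rule nn_integral_cong)
    fix x
    have "(\<integral>\<^sup>+y. ?a (y + c * x) \<partial>lborel) = emeasure lborel A"
      using nn_integral_lborel_translate[of ?a "c * x", OF borel_measurable_indicator[OF A]] by simp
    then show "(\<integral>\<^sup>+y. ?a (c * x + y) * ?b x \<partial>lborel) = emeasure lborel A * ?b x"
      by (subst nn_integral_multc) (auto simp: add.commute)
  qed
  also have "\<dots> = emeasure lborel A * emeasure lborel (ball 0 1 :: complex set)"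
    by (subst nn_integral_cmult) auto
  finally have *: "?\<nu> * emeasure lborel (ball 0 1 :: complex set)
      = emeasure lborel A * emeasure lborel (ball 0 1 :: complex set)" .
  have "emeasure lborel (ball 0 1 :: complex set) = ennreal pi"
    using emeasure_ball[of 1 "0 :: complex"] by (simp add: unit_ball_vol_2)
  then have "?\<nu> = emeasure lborel A"
    using * pi_gt_zero by (simp add: mult.commute[of _ "ennreal pi"] ennreal_mult_cancel_left)
  moreover have "(\<integral>\<^sup>+z. ?a z \<partial>distr lborel borel (\<lambda>z. c * z)) = ?\<nu>"
    by (rule nn_integral_distr) measurable
  ultimately show "emeasure (distr lborel borel (\<lambda>z. c * z)) A = emeasure lborel A" by simp
qed simp

lemma emeasure_lborel_complex_ball:
  "0 \<le> r \<Longrightarrow> emeasure lborel (ball z r :: complex set) = ennreal (pi * r\<^sup>2)"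
  "0 \<le> r \<Longrightarrow> emeasure lborel (cball z r :: complex set) = ennreal (pi * r\<^sup>2)"
  using emeasure_ball[of r z] emeasure_cball[of r z] by (simp_all add: unit_ball_vol_2)

text \<open>Polar coordinates for radial functions, read off from the areas of annuli.\<close>

lemma distr_cmod_ball:
  assumes R: "0 < R"
  shows "distr (density lborel (indicator (ball 0 R))) borel cmod
    = density lborel (\<lambda>x. ennreal (2 * pi * x) * indicator {0..R} x)" (is "?L = ?R")
proof (rule measure_eqI_lessThan)
  define v where "v a = ennreal (if a < 0 then pi * R\<^sup>2 else if a < R then pi * R\<^sup>2 - pi * a\<^sup>2 else 0)" for a
  have L: "emeasure ?L {a<..} = v a" for a
  proof -
    have "emeasure ?L {a<..} = (\<integral>\<^sup>+z. indicator (ball 0 R) z * indicator {z. a < cmod z} z \<partial>lborel)"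
    proof -
      have "{z :: complex. a < cmod z} \<in> sets borel" by measurable
      then show ?thesis
        by (simp add: emeasure_distr vimage_def) (rule emeasure_density, measurable)
    qed
    also have "\<dots> = (\<integral>\<^sup>+z. indicator (ball 0 R \<inter> {z. a < cmod z}) z \<partial>lborel)"
      by (intro nn_integral_cong) (auto simp: indicator_def)
    also have "\<dots> = emeasure lborel (ball 0 R \<inter> {z. a < cmod z})"
      by (rule nn_integral_indicator) measurable
    also have "\<dots> = v a"
    proof -
      consider "a < 0" | "0 \<le> a" "a < R" | "R \<le> a" by linarith
      then show ?thesis
      proof cases
        case 1
        then have "ball 0 R \<inter> {z. a < cmod z} = ball 0 R"
          by (auto intro: less_le_trans[OF _ norm_ge_zero])
        then show ?thesis using 1 R by (simp add: emeasure_lborel_complex_ball v_def)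
      next
        case 2
        have "ball 0 R \<inter> {z. a < cmod z} = ball 0 R - cball 0 a" by auto
        moreover have "emeasure lborel (ball 0 R - cball 0 a :: complex set)
            = emeasure lborel (ball 0 R :: complex set) - emeasure lborel (cball 0 a :: complex set)"
          using 2 by (intro emeasure_Diff) (auto simp: emeasure_lborel_complex_ball)
        ultimately show ?thesis using 2
          by (simp add: emeasure_lborel_complex_ball v_def ennreal_minus)
      next
        case 3
        then have "ball 0 R \<inter> {z. a < cmod z} = ({} :: complex set)" by auto
        then show ?thesis using 3 R by (auto simp: v_def)
      qed
    qed
    finally show ?thesis .
  qed
  have Rr: "emeasure ?R {a<..} = v a" for a
  proof -
    define m where "m = max a 0"
    have "emeasure ?R {a<..} = (\<integral>\<^sup>+x. ennreal (2 * pi * x) * indicator {0..R} x * indicator {a<..} x \<partial>lborel)"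
      by (subst emeasure_density) auto
    also have "\<dots> = (\<integral>\<^sup>+x. ennreal (2 * pi * x) * indicator {m..R} x \<partial>lborel)"
    proof (rule nn_integral_cong_AE, use AE_lborel_singleton[of m] in eventually_elim)
      case (elim x)
      then show ?case by (auto simp: indicator_def m_def)
    qed
    also have "\<dots> = v a"
    proof (cases "m \<le> R")
      case True
      have "(\<integral>\<^sup>+x. ennreal (2 * pi * x) * indicator {m..R} x \<partial>lborel) = ennreal (pi * R\<^sup>2 - pi * m\<^sup>2)"
        using True by (intro nn_integral_FTC_Icc) (auto intro!: derivative_eq_intros simp: m_def)
      then show ?thesis using R True by (auto simp: v_def m_def max_def)
    next
      case False
      then have "{m..R} = {}" by auto
      then show ?thesis using False R by (auto simp: v_def m_def max_def split: if_splits)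
    qed
    finally show ?thesis .
  qed
  show "emeasure ?L {a<..} = emeasure ?R {a<..}" for a unfolding L Rr ..
  show "emeasure ?L {a<..} < \<infinity>" for a unfolding L by (simp add: v_def)
qed auto

lemma nn_integral_radial:
  assumes "0 < R" and [measurable]: "h \<in> borel_measurable borel"
  shows "(\<integral>\<^sup>+z. h (cmod z) * indicator (ball 0 R) z \<partial>lborel)
    = (\<integral>\<^sup>+x. h x * ennreal (2 * pi * x) * indicator {0..R} x \<partial>lborel)"
proof -
  have "(\<integral>\<^sup>+x. h x \<partial>distr (density lborel (indicator (ball 0 R))) borel cmod)
      = (\<integral>\<^sup>+x. h x \<partial>density lborel (\<lambda>x. ennreal (2 * pi * x) * indicator {0..R} x))"
    unfolding distr_cmod_ball[OF assms(1)] ..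
  then have "(\<integral>\<^sup>+z. h (cmod z) \<partial>density lborel (indicator (ball 0 R)))
      = (\<integral>\<^sup>+x. h x * (ennreal (2 * pi * x) * indicator {0..R} x) \<partial>lborel)"
    by (simp add: nn_integral_distr nn_integral_density mult_ac)
  moreover have "(\<integral>\<^sup>+z. h (cmod z) \<partial>density lborel (indicator (ball 0 R)))
      = (\<integral>\<^sup>+z. indicator (ball 0 R) z * h (cmod z) \<partial>lborel)"
    by (rule nn_integral_density) simp_all
  ultimately show ?thesis by (simp add: mult_ac)
qed

text \<open>The singularity of the Cauchy kernel is integrable in the plane, which is what Fubini's theorem
  needs in \<open>cauchy_transform_Fubini\<close>.\<close>

lemma nn_integral_inverse_cmod:
  assumes "0 < R"
  shows "(\<integral>\<^sup>+z. ennreal (1 / cmod z) * indicator (ball 0 R) z \<partial>lborel) \<le> ennreal (2 * pi * R)"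
proof -
  have "(\<integral>\<^sup>+z. ennreal (1 / cmod z) * indicator (ball 0 R) z \<partial>lborel)
      = (\<integral>\<^sup>+x. ennreal (1 / x) * ennreal (2 * pi * x) * indicator {0..R} x \<partial>lborel)"
    by (rule nn_integral_radial[OF assms]) measurable
  also have "\<dots> \<le> (\<integral>\<^sup>+x. ennreal (2 * pi) * indicator {0..R} x \<partial>lborel)"
    by (intro nn_integral_mono) (auto simp: indicator_def ennreal_mult[symmetric])
  also have "\<dots> = ennreal (2 * pi * R)"
    using assms by (simp add: nn_integral_cmult ennreal_mult[symmetric])
  finally show ?thesis .
qed

lemma emeasure_harea_ball:
  assumes "0 \<le> R" "R < 1"
  shows "emeasure harea (ball 0 R) = ennreal (4 * pi * R\<^sup>2 / (1 - R\<^sup>2))"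
proof (cases "R = 0")
  case False
  with assms have R: "0 < R" by simp
  have "emeasure harea (ball 0 R)
      = (\<integral>\<^sup>+z. ennreal (4 / (1 - (cmod z)\<^sup>2)\<^sup>2) * indicator (ball 0 R) z \<partial>lborel)"
    unfolding harea_def using assms
    by (subst emeasure_density) (auto intro!: nn_integral_cong simp: indicator_def)
  also have "\<dots> = (\<integral>\<^sup>+x. ennreal (4 / (1 - x\<^sup>2)\<^sup>2) * ennreal (2 * pi * x) * indicator {0..R} x \<partial>lborel)"
    by (rule nn_integral_radial[OF R]) measurable
  also have "\<dots> = (\<integral>\<^sup>+x. ennreal (8 * pi * x / (1 - x\<^sup>2)\<^sup>2) * indicator {0..R} x \<partial>lborel)"
    by (intro nn_integral_cong) (auto simp: indicator_def ennreal_mult[symmetric])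
  also have "\<dots> = ennreal (4 * pi / (1 - R\<^sup>2) - 4 * pi / (1 - 0\<^sup>2))"
  proof (rule nn_integral_FTC_Icc)
    fix x assume "x \<in> {0..R}"
    then have x: "0 \<le> x" "x \<le> R" by auto
    then have "x\<^sup>2 < 1" using assms by (simp add: abs_square_less_1)
    then have "1 - x\<^sup>2 \<noteq> 0" by simp
    then show "((\<lambda>x. 4 * pi / (1 - x\<^sup>2)) has_real_derivative 8 * pi * x / (1 - x\<^sup>2)\<^sup>2) (at x)"
      by (auto intro!: derivative_eq_intros simp: power2_eq_square)
    show "0 \<le> 8 * pi * x / (1 - x\<^sup>2)\<^sup>2" using x by simp
  qed (use R in auto)
  also have "4 * pi / (1 - R\<^sup>2) - 4 * pi / (1 - 0\<^sup>2) = 4 * pi * R\<^sup>2 / (1 - R\<^sup>2)"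
  proof -
    have "R\<^sup>2 < 1" using assms by (simp add: abs_square_less_1)
    then show ?thesis by (simp add: field_simps)
  qed
  finally show ?thesis .
qed simp

section \<open>The Cauchy transform of hyperbolic area\<close>

text \<open>Hyperbolic area has infinite total mass. A closed curve in the disc of radius \<open>r < 1\<close> has winding
  number zero outside that disc, so the restriction to it carries the whole algebraic area.\<close>

definition hball :: "real \<Rightarrow> complex measure" where
  "hball r = density lborel (\<lambda>z. ennreal (4 / (1 - (cmod z)\<^sup>2)\<^sup>2 * indicator (ball 0 r) z))"

definition cauchy_transform :: "real \<Rightarrow> complex \<Rightarrow> complex" where
  "cauchy_transform r w = (LINT z|hball r. 1 / (w - z))"

lemma sets_hball [measurable_cong, simp]: "sets (hball r) = sets borel"
  by (simp add: hball_def)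

lemma space_hball [simp]: "space (hball r) = UNIV"
  by (simp add: hball_def)

lemma emeasure_hball_ball:
  assumes "0 \<le> R" "R \<le> r" "r < 1"
  shows "emeasure (hball r) (ball 0 R) = ennreal (4 * pi * R\<^sup>2 / (1 - R\<^sup>2))"
proof -
  have "emeasure (hball r) (ball 0 R) = emeasure harea (ball 0 R)"
    unfolding hball_def harea_def using assms
    by (subst (1 2) emeasure_density) (auto intro!: nn_integral_cong simp: indicator_def)
  then show ?thesis using assms by (simp add: emeasure_harea_ball)
qed

lemma finite_measure_hball:
  assumes "0 \<le> r" "r < 1"
  shows "finite_measure (hball r)"
proof
  have "emeasure (hball r) UNIV = emeasure (hball r) (ball 0 r)"
    unfolding hball_def by (subst (1 2) emeasure_density) (auto intro!: nn_integral_cong simp: indicator_def)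
  then show "emeasure (hball r) (space (hball r)) \<noteq> \<infinity>"
    using assms by (simp add: emeasure_hball_ball)
qed

lemma AE_hball: "AE z in lborel. P z \<Longrightarrow> AE z in hball r. P z"
  unfolding hball_def by (subst AE_density) auto

lemma nn_integral_hball:
  "f \<in> borel_measurable borel \<Longrightarrow> (\<integral>\<^sup>+z. f z \<partial>hball r)
     = (\<integral>\<^sup>+z. ennreal (4 / (1 - (cmod z)\<^sup>2)\<^sup>2 * indicator (ball 0 r) z) * f z \<partial>lborel)"
  unfolding hball_def by (rule nn_integral_density) auto

lemma hball_distr_unit_mult:
  assumes "cmod c = 1"
  shows "distr (hball r) borel (\<lambda>z. c * z) = hball r"
proof (rule measure_eqI)
  fix A assume "A \<in> sets (distr (hball r) borel (\<lambda>z. c * z))"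
  then have [measurable]: "A \<in> sets borel" by simp
  let ?d = "\<lambda>z. ennreal (4 / (1 - (cmod z)\<^sup>2)\<^sup>2 * indicator (ball 0 r) z)"
  have "(\<integral>\<^sup>+z. indicator A z \<partial>distr (hball r) borel (\<lambda>z. c * z)) = (\<integral>\<^sup>+z. indicator A (c * z) \<partial>hball r)"
    by (rule nn_integral_distr) measurable
  also have "\<dots> = (\<integral>\<^sup>+z. ?d z * indicator A (c * z) \<partial>lborel)"
    by (rule nn_integral_hball) measurable
  also have "\<dots> = (\<integral>\<^sup>+z. ?d (c * z) * indicator A (c * z) \<partial>lborel)"
    using assms by (intro nn_integral_cong) (simp add: norm_mult indicator_def)
  also have "\<dots> = (\<integral>\<^sup>+z. ?d z * indicator A z \<partial>distr lborel borel (\<lambda>z. c * z))"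
    by (rule nn_integral_distr[symmetric]) measurable
  also have "\<dots> = (\<integral>\<^sup>+z. ?d z * indicator A z \<partial>lborel)"
    unfolding lborel_distr_unit_mult[OF assms] ..
  also have "\<dots> = (\<integral>\<^sup>+z. indicator A z \<partial>hball r)"
    by (rule nn_integral_hball[symmetric]) measurable
  finally show "emeasure (distr (hball r) borel (\<lambda>z. c * z)) A = emeasure (hball r) A" by simp
qed simp

lemma cauchy_transform_unit_mult:
  assumes "cmod c = 1"
  shows "c * cauchy_transform r (c * w) = cauchy_transform r w"
proof -
  have c0: "c \<noteq> 0" using assms by auto
  have "cauchy_transform r (c * w) = (LINT z|distr (hball r) borel (\<lambda>z. c * z). 1 / (c * w - z))"
    unfolding cauchy_transform_def hball_distr_unit_mult[OF assms] ..
  also have "\<dots> = (LINT z|hball r. 1 / (c * w - c * z))"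
    by (rule integral_distr) measurable
  also have "\<dots> = (LINT z|hball r. (1 / c) * (1 / (w - z)))"
    using c0 by (intro Bochner_Integration.integral_cong) (simp_all add: field_simps flip: right_diff_distrib)
  also have "\<dots> = (1 / c) * cauchy_transform r w"
    unfolding cauchy_transform_def by (rule integral_mult_right_zero)
  finally show ?thesis using c0 by simp
qed

lemma nn_integral_cauchy_kernel:
  assumes "cmod w < 1" "0 < r" "r < 1"
  shows "(\<integral>\<^sup>+z. ennreal (cmod (1 / (w - z))) \<partial>hball r) \<le> ennreal (16 * pi / (1 - r\<^sup>2)\<^sup>2)"
proof -
  have r2: "r\<^sup>2 < 1" using assms by (simp add: abs_square_less_1)
  have "(\<integral>\<^sup>+z. ennreal (cmod (1 / (w - z))) \<partial>hball r)
      = (\<integral>\<^sup>+z. ennreal (4 / (1 - (cmod z)\<^sup>2)\<^sup>2 * indicator (ball 0 r) z) * ennreal (cmod (1 / (w - z))) \<partial>lborel)"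
    by (rule nn_integral_hball) measurable
  also have "\<dots> \<le> (\<integral>\<^sup>+z. ennreal (4 / (1 - r\<^sup>2)\<^sup>2) * (ennreal (1 / cmod (z - w)) * indicator (ball 0 2) (z - w)) \<partial>lborel)"
  proof (rule nn_integral_mono)
    fix z
    show "ennreal (4 / (1 - (cmod z)\<^sup>2)\<^sup>2 * indicator (ball 0 r) z) * ennreal (cmod (1 / (w - z)))
        \<le> ennreal (4 / (1 - r\<^sup>2)\<^sup>2) * (ennreal (1 / cmod (z - w)) * indicator (ball 0 2) (z - w))"
    proof (cases "cmod z < r")
      case True
      have "cmod (z - w) < 2" using norm_triangle_ineq4[of z w] True assms by simp
      moreover have "4 / (1 - (cmod z)\<^sup>2)\<^sup>2 \<le> 4 / (1 - r\<^sup>2)\<^sup>2"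
        using True r2 power_mono[of "cmod z" r 2] by (intro divide_left_mono power_mono) (auto intro!: mult_pos_pos)
      ultimately show ?thesis using True
        by (simp add: norm_divide norm_minus_commute mult_right_mono ennreal_leI)
    qed simp
  qed
  also have "\<dots> = ennreal (4 / (1 - r\<^sup>2)\<^sup>2) * (\<integral>\<^sup>+z. ennreal (1 / cmod (z - w)) * indicator (ball 0 2) (z - w) \<partial>lborel)"
    by (rule nn_integral_cmult) measurable
  also have "(\<integral>\<^sup>+z. ennreal (1 / cmod (z - w)) * indicator (ball 0 2) (z - w) \<partial>lborel)
      = (\<integral>\<^sup>+z. ennreal (1 / cmod z) * indicator (ball 0 2) z \<partial>lborel)"
    using nn_integral_lborel_translate[of "\<lambda>z. ennreal (1 / cmod z) * indicator (ball 0 2) z" "- w"] by simp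
  also have "ennreal (4 / (1 - r\<^sup>2)\<^sup>2) * \<dots> \<le> ennreal (4 / (1 - r\<^sup>2)\<^sup>2) * ennreal (2 * pi * 2)"
    by (intro mult_left_mono nn_integral_inverse_cmod) auto
  also have "\<dots> = ennreal (16 * pi / (1 - r\<^sup>2)\<^sup>2)" by (simp add: ennreal_mult[symmetric])
  finally show ?thesis .
qed

lemma cauchy_transform_Fubini:
  fixes \<sigma> \<sigma>' :: "real \<Rightarrow> complex"
  assumes r: "0 < r" "r < 1"
    and cont: "continuous_on {0..1} \<sigma>" "continuous_on {0..1} \<sigma>'"
    and disc: "\<And>t. t \<in> {0..1} \<Longrightarrow> cmod (\<sigma> t) < 1"
  shows "has_bochner_integral (hball r) (\<lambda>z. LINT t:{0..1}|lborel. \<sigma>' t / (\<sigma> t - z))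
           (LINT t:{0..1}|lborel. \<sigma>' t * cauchy_transform r (\<sigma> t))"
proof -
  let ?I = "indicator {0..1} :: real \<Rightarrow> real"
  define F where "F t z = (?I t *\<^sub>R \<sigma>' t) / (?I t *\<^sub>R \<sigma> t - z)" for t z
  interpret H: finite_measure "hball r" using r by (intro finite_measure_hball) auto
  interpret P: pair_sigma_finite lborel "hball r" ..
  have [measurable]: "(\<lambda>t. ?I t *\<^sub>R \<sigma> t) \<in> borel_measurable borel" "(\<lambda>t. ?I t *\<^sub>R \<sigma>' t) \<in> borel_measurable borel"
    using cont by (auto intro!: borel_measurable_continuous_on_indicator)
  obtain K where K: "\<And>t. t \<in> {0..1} \<Longrightarrow> cmod (\<sigma>' t) \<le> K"
    using compact_imp_bounded[OF compact_continuous_image[OF cont(2) compact_Icc]]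
    unfolding bounded_iff by (metis imageI)
  have K0: "0 \<le> K" using order_trans[OF norm_ge_zero K[of 0]] by simp
  have "integrable (lborel \<Otimes>\<^sub>M hball r) (case_prod F)"
  proof (rule integrableI_bounded)
    show [measurable]: "case_prod F \<in> borel_measurable (lborel \<Otimes>\<^sub>M hball r)"
      unfolding F_def by measurable
    have "(\<integral>\<^sup>+ x. ennreal (norm (case_prod F x)) \<partial>(lborel \<Otimes>\<^sub>M hball r))
        = (\<integral>\<^sup>+t. (\<integral>\<^sup>+z. ennreal (cmod (F t z)) \<partial>hball r) \<partial>lborel)"
      by (subst H.nn_integral_fst[symmetric]) auto
    also have "\<dots> \<le> (\<integral>\<^sup>+t. ennreal (K * (16 * pi / (1 - r\<^sup>2)\<^sup>2)) * indicator {0..1::real} t \<partial>lborel)"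
    proof (rule nn_integral_mono)
      fix t
      show "(\<integral>\<^sup>+z. ennreal (cmod (F t z)) \<partial>hball r) \<le> ennreal (K * (16 * pi / (1 - r\<^sup>2)\<^sup>2)) * indicator {0..1} t"
      proof (cases "t \<in> {0..1}")
        case True
        have "(\<integral>\<^sup>+z. ennreal (cmod (F t z)) \<partial>hball r) \<le> (\<integral>\<^sup>+z. ennreal K * ennreal (cmod (1 / (\<sigma> t - z))) \<partial>hball r)"
        proof (rule nn_integral_mono)
          fix z
          have "cmod (\<sigma>' t) * (1 / cmod (\<sigma> t - z)) \<le> K * (1 / cmod (\<sigma> t - z))"
            using K[OF True] by (rule mult_right_mono) simp
          then show "ennreal (cmod (F t z)) \<le> ennreal K * ennreal (cmod (1 / (\<sigma> t - z)))"
            using True K0 by (simp add: F_def norm_divide ennreal_mult[symmetric] ennreal_leI)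
        qed
        also have "\<dots> = ennreal K * (\<integral>\<^sup>+z. ennreal (cmod (1 / (\<sigma> t - z))) \<partial>hball r)"
          by (rule nn_integral_cmult) measurable
        also have "\<dots> \<le> ennreal K * ennreal (16 * pi / (1 - r\<^sup>2)\<^sup>2)"
          by (intro mult_left_mono nn_integral_cauchy_kernel disc True r) auto
        finally show ?thesis using True K0 by (simp add: ennreal_mult[symmetric])
      qed (simp add: F_def)
    qed
    also have "\<dots> < \<infinity>" by (subst nn_integral_cmult) (auto simp: ennreal_mult_less_top)
    finally show "(\<integral>\<^sup>+ x. ennreal (norm (case_prod F x)) \<partial>(lborel \<Otimes>\<^sub>M hball r)) < \<infinity>" .
  qed
  from P.integrable_snd[OF this] P.Fubini_integral[OF this]
  have "has_bochner_integral (hball r) (\<lambda>z. LINT t|lborel. F t z) (LINT t|lborel. LINT z|hball r. F t z)"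
    by (simp add: has_bochner_integral_iff)
  moreover have "(LINT t|lborel. F t z) = (LINT t:{0..1}|lborel. \<sigma>' t / (\<sigma> t - z))" for z
    unfolding set_lebesgue_integral_def F_def
    by (intro Bochner_Integration.integral_cong) (auto simp: indicator_def)
  moreover have "(LINT z|hball r. F t z) = ?I t *\<^sub>R (\<sigma>' t * cauchy_transform r (\<sigma> t))" for t
  proof (cases "t \<in> {0..1}")
    case True
    then have "(LINT z|hball r. F t z) = (LINT z|hball r. \<sigma>' t * (1 / (\<sigma> t - z)))"
      by (simp add: F_def)
    also have "\<dots> = \<sigma>' t * (LINT z|hball r. 1 / (\<sigma> t - z))" by (rule integral_mult_right_zero)
    finally show ?thesis using True by (simp add: cauchy_transform_def)
  qed (simp add: F_def)
  ultimately show ?thesis by (simp add: set_lebesgue_integral_def)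
qed

lemma contour_integral_eq_set_integral:
  assumes der: "\<And>t. t \<in> {0..1} \<Longrightarrow> (\<sigma> has_vector_derivative \<sigma>' t) (at t within {0..1})"
    and cont: "continuous_on {0..1} \<sigma>'" and z: "z \<notin> path_image \<sigma>"
  shows "((\<lambda>w. 1 / (w - z)) has_contour_integral (LINT t:{0..1}|lborel. \<sigma>' t / (\<sigma> t - z))) \<sigma>"
proof -
  let ?f = "\<lambda>t. \<sigma>' t / (\<sigma> t - z)"
  have "continuous_on {0..1} \<sigma>"
    using der by (meson continuous_on_eq_continuous_within has_vector_derivative_continuous)
  then have "continuous_on {0..1} ?f"
    using z cont by (intro continuous_intros) (auto simp: path_image_def)
  then have int: "set_integrable lborel {0..1} ?f" by (rule borel_integrable_atLeastAtMost')
  have "(?f has_integral (LINT t:{0..1}|lborel. ?f t)) {0..1}"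
    using set_borel_integral_eq_integral[OF int] by (simp add: has_integral_iff)
  then have "((\<lambda>t. (1 / (\<sigma> t - z)) * vector_derivative \<sigma> (at t within {0..1}))
      has_integral (LINT t:{0..1}|lborel. ?f t)) {0..1}"
  proof (rule has_integral_eq[rotated])
    fix t :: real assume t: "t \<in> {0..1}"
    then have "vector_derivative \<sigma> (at t within {0..1}) = \<sigma>' t"
      by (intro vector_derivative_within_cbox[of 0 1, simplified] der) auto
    then show "?f t = (1 / (\<sigma> t - z)) * vector_derivative \<sigma> (at t within {0..1})" by simp
  qed
  then show ?thesis by (simp add: has_contour_integral_def)
qed

text \<open>Newton's theorem in the plane: only the mass inside the circle through \<open>w\<close> acts, as if
  concentrated at \<open>0\<close>. By rotation invariance \<open>w * cauchy_transform r w\<close> depends on \<open>|w|\<close> only, and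
  its mean over the circle is, by Fubini's theorem, the integral of the winding number of the circle,
  that is the mass inside.\<close>

lemma cauchy_transform_hball:
  assumes r: "0 < r" "r < 1" and w: "cmod w < r"
  shows "cauchy_transform r w = 4 * pi * cnj w / (1 - (cmod w)\<^sup>2)"
proof (cases "w = 0")
  case True
  have "- 1 * cauchy_transform r (- 1 * 0) = cauchy_transform r 0"
    by (rule cauchy_transform_unit_mult) simp
  then show ?thesis using True by simp
next
  case False
  define \<rho> where "\<rho> = cmod w"
  have \<rho>: "0 < \<rho>" "\<rho> < r" using w False by (simp_all add: \<rho>_def)
  define \<sigma> where "\<sigma> t = \<rho> * exp (2 * pi * \<i> * of_real t)" for t
  define \<sigma>' where "\<sigma>' t = 2 * pi * \<i> * \<sigma> t" for t
  have cmod_\<sigma>: "cmod (\<sigma> t) = \<rho>" for t using \<rho> by (simp add: \<sigma>_def norm_mult)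
  have circ: "\<sigma> = circlepath 0 \<rho>" by (simp add: \<sigma>_def circlepath fun_eq_iff)
  have der: "(\<sigma> has_vector_derivative \<sigma>' t) (at t within {0..1})" for t
    unfolding \<sigma>_def \<sigma>'_def
    by (auto intro!: derivative_eq_intros has_vector_derivative_real_field)
  have cont: "continuous_on {0..1} \<sigma>" "continuous_on {0..1} \<sigma>'"
    unfolding \<sigma>_def \<sigma>'_def by (intro continuous_intros)+
  interpret H: finite_measure "hball r" using r by (intro finite_measure_hball) auto
  \<comment> \<open>the circle through \<open>w\<close>, with both orders of integration evaluated in turn\<close>
  have "(LINT z|hball r. (LINT t:{0..1}|lborel. \<sigma>' t / (\<sigma> t - z)))
      = (LINT t:{0..1}|lborel. \<sigma>' t * cauchy_transform r (\<sigma> t))"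
    using cauchy_transform_Fubini[OF r cont] \<rho> r cmod_\<sigma> by (simp add: has_bochner_integral_iff)
  also have "\<dots> = (LINT t:{0..1::real}|lborel. 2 * pi * \<i> * (\<rho> * cauchy_transform r \<rho>))"
  proof (rule set_lebesgue_integral_cong)
    show "\<forall>t. t \<in> {0..1} \<longrightarrow> \<sigma>' t * cauchy_transform r (\<sigma> t) = 2 * pi * \<i> * (\<rho> * cauchy_transform r \<rho>)"
    proof safe
      fix t :: real
      have "exp (2 * pi * \<i> * of_real t) * cauchy_transform r (exp (2 * pi * \<i> * of_real t) * \<rho>) = cauchy_transform r \<rho>"
        by (rule cauchy_transform_unit_mult) simp
      then show "\<sigma>' t * cauchy_transform r (\<sigma> t) = 2 * pi * \<i> * (\<rho> * cauchy_transform r \<rho>)"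
        by (simp add: \<sigma>'_def \<sigma>_def mult_ac)
    qed
  qed simp
  also have "\<dots> = 2 * pi * \<i> * (\<rho> * cauchy_transform r \<rho>)"
    by (simp add: set_lebesgue_integral_def)
  also have "(LINT z|hball r. (LINT t:{0..1}|lborel. \<sigma>' t / (\<sigma> t - z)))
      = (LINT z|hball r. 2 * pi * \<i> * indicator (ball 0 \<rho>) z)"
  proof (rule integral_cong_AE)
    show "(\<lambda>z. LINT t:{0..1}|lborel. \<sigma>' t / (\<sigma> t - z)) \<in> borel_measurable (hball r)"
      using cauchy_transform_Fubini[OF r cont] \<rho> r cmod_\<sigma> by (auto simp: has_bochner_integral_iff)
    have "AE z::complex in lborel. z \<notin> sphere 0 \<rho>"
      using negligible_sphere[of "0 :: complex" \<rho>]
      by (intro AE_not_in) (auto simp: null_sets_completion_iff negligible_iff_null_sets)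
    then have "AE z in hball r. z \<notin> sphere 0 \<rho>" by (rule AE_hball)
    then show "AE z in hball r. (LINT t:{0..1}|lborel. \<sigma>' t / (\<sigma> t - z)) = 2 * pi * \<i> * indicator (ball 0 \<rho>) z"
    proof eventually_elim
      case (elim z)
      have z: "z \<notin> path_image \<sigma>" using elim \<rho> by (simp add: circ path_image_circlepath)
      have "(LINT t:{0..1}|lborel. \<sigma>' t / (\<sigma> t - z)) = contour_integral \<sigma> (\<lambda>w. 1 / (w - z))"
        using contour_integral_eq_set_integral[OF der cont(2) z] by (simp add: contour_integral_unique)
      also have "\<dots> = 2 * pi * \<i> * winding_number \<sigma> z"
        using z by (subst winding_number_valid_path) (auto simp: circ)
      also have "winding_number \<sigma> z = indicator (ball 0 \<rho>) z"
      proof (cases "cmod z < \<rho>")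
        case True
        then show ?thesis by (simp add: circ winding_number_circlepath)
      next
        case False
        have "winding_number \<sigma> z = 0"
          unfolding circ using False elim \<rho>
          by (intro winding_number_zero_outside[of _ "cball 0 \<rho>"]) (auto simp: circ path_image_circlepath)
        then show ?thesis using False by simp
      qed
      finally show ?case .
    qed
  qed measurable
  also have "\<dots> = 2 * pi * \<i> * of_real (measure (hball r) (ball 0 \<rho>))"
  proof -
    have "(LINT z|hball r. complex_of_real (indicator (ball 0 \<rho>) z)) = of_real (measure (hball r) (ball 0 \<rho>))"
      unfolding integral_complex_of_real by simp
    then show ?thesis by (subst integral_mult_right_zero) (simp add: of_real_indicator)
  qed
  also have "measure (hball r) (ball 0 \<rho>) = 4 * pi * \<rho>\<^sup>2 / (1 - \<rho>\<^sup>2)"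
    using emeasure_hball_ball[of \<rho> r] \<rho> r abs_square_less_1[of \<rho>] by (simp add: measure_def)
  finally have "2 * pi * \<i> * of_real (4 * pi * \<rho>\<^sup>2 / (1 - \<rho>\<^sup>2)) = 2 * pi * \<i> * (\<rho> * cauchy_transform r \<rho>)" .
  then have "\<rho> * cauchy_transform r \<rho> = of_real (4 * pi * \<rho>\<^sup>2 / (1 - \<rho>\<^sup>2))"
    unfolding mult_cancel_left by auto
  then have "\<rho> * cauchy_transform r \<rho> = complex_of_real \<rho> * complex_of_real (4 * pi * \<rho> / (1 - \<rho>\<^sup>2))"
    by (simp add: power2_eq_square mult_ac)
  then have *: "cauchy_transform r \<rho> = of_real (4 * pi * \<rho> / (1 - \<rho>\<^sup>2))"
    using \<rho> unfolding mult_cancel_left by auto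
  have "w / \<rho> * cauchy_transform r (w / \<rho> * \<rho>) = cauchy_transform r \<rho>"
    using \<rho> by (intro cauchy_transform_unit_mult) (simp add: norm_divide \<rho>_def)
  then have "w * cauchy_transform r w = of_real (4 * pi * \<rho>\<^sup>2 / (1 - \<rho>\<^sup>2))"
    using \<rho> * by (simp add: field_simps power2_eq_square)
  also have "\<dots> = w * (4 * pi * cnj w / (1 - (cmod w)\<^sup>2))"
    using complex_norm_square[of w] by (simp add: \<rho>_def mult_ac)
  finally have "w * cauchy_transform r w = w * (4 * pi * cnj w / (1 - (cmod w)\<^sup>2))" .
  then show ?thesis using False unfolding mult_cancel_left by simp
qed

section \<open>Geodesic segments\<close>

text \<open>The signed hyperbolic area of the geodesic triangle with vertices \<open>0\<close>, \<open>p\<close>, \<open>q\<close>. The principal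
  logarithm is the right branch because \<open>1 - cnj p * q\<close> has positive real part, and this also gives
  the bound \<open>pi\<close> on the absolute value.\<close>

definition fan_area :: "complex \<Rightarrow> complex \<Rightarrow> real" where
  "fan_area p q = - 2 * Im (Ln (1 - cnj p * q))"

lemma Re_one_plus_pos: "cmod z < 1 \<Longrightarrow> 0 < Re (1 + z)"
  using abs_Re_le_cmod[of z] by simp

lemma one_plus_notin_nonpos: "cmod z < 1 \<Longrightarrow> 1 + z \<notin> \<real>\<^sub>\<le>\<^sub>0"
  using Re_one_plus_pos[of z] complex_nonpos_Reals_iff[of "1 + z"] by simp

lemma one_plus_nonzero: "cmod z < 1 \<Longrightarrow> 1 + z \<noteq> 0"
  using one_plus_notin_nonpos[of z] by auto

lemma abs_Im_Ln_one_plus: "cmod z < 1 \<Longrightarrow> \<bar>Im (Ln (1 + z))\<bar> < pi / 2"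
  by (rule Re_Ln_pos_lt_imp[OF Re_one_plus_pos])

lemma cmod_cnj_mult_less_1: "cmod a < 1 \<Longrightarrow> cmod b < 1 \<Longrightarrow> cmod (cnj a * b) < 1"
  using mult_strict_mono'[of "cmod a" 1 "cmod b" 1] by (simp add: norm_mult)

lemma htrans_has_derivative:
  assumes "cmod a < 1" "cmod w < 1"
  shows "(htrans a has_field_derivative of_real (1 - (cmod a)\<^sup>2) / (1 + cnj a * w)\<^sup>2) (at w)"
proof -
  have nz: "1 + cnj a * w \<noteq> 0" using assms by (rule htrans_denom_nonzero)
  have "(htrans a has_field_derivative (1 - a * cnj a) / (1 + cnj a * w)\<^sup>2) (at w)"
    unfolding htrans_def
    by (rule derivative_eq_intros refl nz | simp)+ (simp add: power2_eq_square algebra_simps)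
  then show ?thesis by (simp flip: complex_norm_square)
qed

text \<open>The position of \<open>q\<close> seen from \<open>p\<close>, after the isometry that moves \<open>p\<close> to \<open>0\<close>.\<close>

definition chord :: "complex \<Rightarrow> complex \<Rightarrow> complex" where
  "chord p q = htrans (- p) q"

definition hseg' :: "complex \<Rightarrow> complex \<Rightarrow> real \<Rightarrow> complex" where
  "hseg' p q t = chord p q * (1 - (cmod p)\<^sup>2) / (1 + cnj p * (of_real t * chord p q))\<^sup>2"

lemma cmod_chord: "cmod p < 1 \<Longrightarrow> cmod q < 1 \<Longrightarrow> cmod (chord p q) < 1"
  unfolding chord_def by (rule cmod_htrans_less_1) auto

lemma hseg_eq: "hseg p q t = (of_real t * chord p q + p) / (1 + cnj p * (of_real t * chord p q))"
  by (simp add: hseg_def chord_def htrans_def)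

context
  fixes p q :: complex
  assumes p: "cmod p < 1" and q: "cmod q < 1"
begin

lemma cmod_hseg_arg: "t \<in> {0..1} \<Longrightarrow> cmod (of_real t * chord p q) < 1"
  using cmod_chord[OF p q] mult_le_one[of t "cmod (chord p q)"] mult_left_le_one_le[of "cmod (chord p q)" t]
  by (simp add: norm_mult) 

lemma hseg_denom: "t \<in> {0..1} \<Longrightarrow> 1 + cnj p * (of_real t * chord p q) \<noteq> 0"
  by (rule htrans_denom_nonzero[OF p cmod_hseg_arg])

lemma cmod_hseg: "t \<in> {0..1} \<Longrightarrow> cmod (hseg p q t) < 1"
  unfolding hseg_def chord_def[symmetric] by (rule cmod_htrans_less_1[OF p cmod_hseg_arg])

lemma htrans_inverse: "htrans p (htrans (- p) q) = q"
proof -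
  have nz: "1 - cnj p * q \<noteq> 0" using htrans_denom_nonzero[of "- p" q] p q by simp
  have pp: "1 - cnj p * p \<noteq> 0" using htrans_denom_nonzero[of "- p" p] p by simp
  have "1 + cnj p * ((q - p) / (1 - cnj p * q)) = (1 - cnj p * p) / (1 - cnj p * q)"
    using nz by (simp add: field_simps)
  moreover have "(q - p) / (1 - cnj p * q) + p = q * (1 - cnj p * p) / (1 - cnj p * q)"
    using nz by (simp add: field_simps)
  ultimately show ?thesis using nz pp by (simp add: htrans_def)
qed

lemma hseg_ends: "hseg p q 0 = p" "hseg p q 1 = q"
  using htrans_inverse by (simp_all add: hseg_def) (simp add: htrans_def)

lemma hseg_has_derivative:
  assumes "t \<in> {0..1}"
  shows "(hseg p q has_vector_derivative hseg' p q t) (at t)"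
proof -
  let ?b = "chord p q"
  have 1: "((\<lambda>t. of_real t * ?b) has_vector_derivative ?b) (at t)"
    by (auto intro!: derivative_eq_intros has_vector_derivative_real_field)
  note 2 = htrans_has_derivative[OF p cmod_hseg_arg[OF assms]]
  have "(hseg p q has_vector_derivative (?b * (of_real (1 - (cmod p)\<^sup>2) / (1 + cnj p * (of_real t * ?b))\<^sup>2))) (at t)"
    using field_vector_diff_chain_at[OF 1 2] by (simp add: o_def hseg_def[abs_def] chord_def)
  then show ?thesis by (simp add: hseg'_def)
qed

lemma continuous_hseg: "continuous_on {0..1} (hseg p q)"
  unfolding hseg_eq[abs_def] using hseg_denom by (intro continuous_intros) auto

lemma continuous_hseg': "continuous_on {0..1} (hseg' p q)"
  unfolding hseg'_def[abs_def] using hseg_denom by (intro continuous_intros) auto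

lemma valid_path_hseg: "valid_path (hseg p q)"
proof -
  have "hseg p q C1_differentiable_on {0..1}"
    unfolding C1_differentiable_on_def using hseg_has_derivative continuous_hseg' by blast
  then show ?thesis unfolding valid_path_def by (rule C1_differentiable_imp_piecewise)
qed

lemma negligible_path_image_hseg: "negligible (path_image (hseg p q))"
proof -
  have "hseg p q differentiable_on {0..1}"
    unfolding differentiable_on_def using hseg_has_derivative
    by (meson differentiableI_vector differentiable_at_withinI)
  then show ?thesis unfolding path_image_def by (intro negligible_differentiable_image_lowdim) auto
qed

lemma one_plus_chord: "1 + cnj p * chord p q = (1 - (cmod p)\<^sup>2) / (1 - cnj p * q)"
proof -
  have nz: "1 - cnj p * q \<noteq> 0" using htrans_denom_nonzero[of "- p" q] p q by simp
  have "1 + cnj p * ((q - p) / (1 - cnj p * q)) = (1 - p * cnj p) / (1 - cnj p * q)"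
    using nz by (simp add: field_simps)
  then show ?thesis by (simp add: chord_def htrans_def flip: complex_norm_square)
qed

lemma fan_area_chord: "2 * Im (Ln (1 + cnj p * chord p q)) = fan_area p q"
proof -
  have pos: "0 < 1 - (cmod p)\<^sup>2" using p by (simp add: abs_square_less_1)
  have "cmod (- (cnj p * q)) < 1" using cmod_cnj_mult_less_1[OF p q] by simp
  from one_plus_notin_nonpos[OF this] have np: "1 - cnj p * q \<notin> \<real>\<^sub>\<le>\<^sub>0" by simp
  then have nz: "1 - cnj p * q \<noteq> 0" by auto
  have "Ln (1 + cnj p * chord p q) = Ln (of_real (1 - (cmod p)\<^sup>2) * inverse (1 - cnj p * q))"
    by (simp add: one_plus_chord divide_inverse)
  also have "\<dots> = ln (1 - (cmod p)\<^sup>2) + Ln (inverse (1 - cnj p * q))"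
    using pos nz Ln_times_of_real[OF pos, of "inverse (1 - cnj p * q)"] Ln_of_real[OF pos] by simp
  also have "Ln (inverse (1 - cnj p * q)) = - Ln (1 - cnj p * q)" using np by (rule Ln_inverse)
  finally show ?thesis by (simp add: fan_area_def)
qed

text \<open>Up to real terms the area form on a geodesic segment is a logarithmic derivative, so it has an
  elementary primitive.\<close>

lemma hseg_area_integrand:
  assumes t: "t \<in> {0..1}"
  defines "b \<equiv> chord p q"
  shows "hseg' p q t * (4 * pi * cnj (hseg p q t) / (1 - (cmod (hseg p q t))\<^sup>2))
    = 4 * pi * (cnj p * b / (1 + cnj p * (of_real t * b)) + t * (cmod b)\<^sup>2 / (1 - t\<^sup>2 * (cmod b)\<^sup>2))"
proof -
  define d where "d = 1 + cnj p * (of_real t * b)"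
  define P where "P = complex_of_real (1 - (cmod p)\<^sup>2)"
  define Q where "Q = complex_of_real (1 - t\<^sup>2 * (cmod b)\<^sup>2)"
  have d: "d \<noteq> 0" unfolding d_def b_def by (rule hseg_denom[OF t])
  have P: "P \<noteq> 0" unfolding P_def using p abs_square_less_1[of "cmod p"] by (simp only: of_real_eq_0_iff) simp
  have tb: "cmod (of_real t * b) < 1" unfolding b_def by (rule cmod_hseg_arg[OF t])
  then have "(t * cmod b)\<^sup>2 < 1" using t by (simp add: norm_mult abs_square_less_1)
  then have Q: "Q \<noteq> 0" unfolding Q_def by (simp only: of_real_eq_0_iff) (simp add: power_mult_distrib)
  have "1 - (cmod (hseg p q t))\<^sup>2 = (1 - (cmod p)\<^sup>2) * (1 - (cmod (of_real t * b))\<^sup>2) / (cmod d)\<^sup>2"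
    unfolding hseg_def chord_def[symmetric] b_def[symmetric] d_def
    by (rule one_minus_cmod_htrans[OF p tb])
  then have "complex_of_real (1 - (cmod (hseg p q t))\<^sup>2) = P * Q / of_real ((cmod d)\<^sup>2)"
    by (simp add: P_def Q_def norm_mult power_mult_distrib)
  also have "\<dots> = P * Q / (d * cnj d)" unfolding complex_norm_square ..
  finally have 1: "complex_of_real (1 - (cmod (hseg p q t))\<^sup>2) = P * Q / (d * cnj d)" .
  have 2: "hseg' p q t = b * P / d\<^sup>2" by (simp add: hseg'_def b_def d_def P_def)
  have 3: "cnj (hseg p q t) = (of_real t * cnj b + cnj p) / cnj d"
    by (simp add: hseg_eq b_def d_def)
  have bb: "b * cnj b = of_real ((cmod b)\<^sup>2)" by (rule complex_norm_square[symmetric])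
  have "hseg' p q t * (4 * pi * cnj (hseg p q t) / of_real (1 - (cmod (hseg p q t))\<^sup>2))
      = 4 * pi * (b * (of_real t * cnj b + cnj p) / (d * Q))"
    unfolding 1 2 3 using d P Q by (simp add: field_simps power2_eq_square)
  also have "b * (of_real t * cnj b + cnj p) = of_real t * of_real ((cmod b)\<^sup>2) + cnj p * b"
    unfolding bb[symmetric] by (simp add: algebra_simps)
  also have "\<dots> / (d * Q) = cnj p * b / d + t * (cmod b)\<^sup>2 / Q"
  proof -
    have "of_real t * of_real ((cmod b)\<^sup>2) + cnj p * b = cnj p * b * Q + t * (cmod b)\<^sup>2 * d"
      by (simp add: Q_def d_def algebra_simps power2_eq_square)
    then show ?thesis using d Q by (simp add: add_divide_distrib)
  qed
  finally show ?thesis by (simp add: d_def Q_def)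
qed

lemma hseg_area_integral:
  "(LINT t:{0..1}|lborel. hseg' p q t * (4 * pi * cnj (hseg p q t) / (1 - (cmod (hseg p q t))\<^sup>2)))
   = 4 * pi * (Ln (1 + cnj p * chord p q) - of_real (ln (1 - (cmod (chord p q))\<^sup>2) / 2))"
proof -
  define b where "b = chord p q"
  define \<Phi> where "\<Phi> t = 4 * pi * (Ln (1 + cnj p * (of_real t * b)) - of_real (ln (1 - t\<^sup>2 * (cmod b)\<^sup>2) / 2))" for t
  define f where "f t = 4 * pi * (cnj p * b / (1 + cnj p * (of_real t * b)) + complex_of_real (t * (cmod b)\<^sup>2 / (1 - t\<^sup>2 * (cmod b)\<^sup>2)))" for t
  have pos: "1 - t\<^sup>2 * (cmod b)\<^sup>2 > 0" if "t \<in> {0..1}" for t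
    using cmod_hseg_arg[OF that] that by (simp add: b_def norm_mult abs_square_less_1 flip: power_mult_distrib)
  have der: "(\<Phi> has_vector_derivative f t) (at t within {0..1})" if t: "t \<in> {0..1}" for t
  proof -
    have "1 + cnj p * (of_real t * b) \<notin> \<real>\<^sub>\<le>\<^sub>0"
      using cmod_cnj_mult_less_1[OF p cmod_hseg_arg[OF t]] unfolding b_def by (rule one_plus_notin_nonpos)
    then have 1: "((\<lambda>x. Ln (1 + cnj p * (x * b))) has_field_derivative (inverse (1 + cnj p * (of_real t * b)) * (b * cnj p))) (at (of_real t))"
      by (auto intro!: derivative_eq_intros simp: divide_inverse)
    have 2: "((\<lambda>t. ln (1 - t\<^sup>2 * (cmod b)\<^sup>2) / 2) has_real_derivative - (t * (cmod b)\<^sup>2 / (1 - t\<^sup>2 * (cmod b)\<^sup>2))) (at t)"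
      using pos[OF t] by (auto intro!: derivative_eq_intros simp: field_simps)
    have 3: "((\<lambda>t. complex_of_real (ln (1 - t\<^sup>2 * (cmod b)\<^sup>2) / 2)) has_vector_derivative
        of_real (- (t * (cmod b)\<^sup>2 / (1 - t\<^sup>2 * (cmod b)\<^sup>2)))) (at t)"
      using 2 by (intro has_vector_derivative_of_real) (simp add: has_real_derivative_iff_has_vector_derivative)
    have 4: "((\<lambda>t. Ln (1 + cnj p * (of_real t * b))) has_vector_derivative (cnj p * b / (1 + cnj p * (of_real t * b)))) (at t)"
    proof -
      have eq: "inverse (1 + cnj p * (of_real t * b)) * (b * cnj p) = cnj p * b / (1 + cnj p * (of_real t * b))"
        by (simp only: divide_inverse mult.commute)
      show ?thesis using has_vector_derivative_real_field[OF 1] unfolding eq .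
    qed
    have "(\<Phi> has_vector_derivative 4 * pi * (cnj p * b / (1 + cnj p * (of_real t * b))
        - of_real (- (t * (cmod b)\<^sup>2 / (1 - t\<^sup>2 * (cmod b)\<^sup>2))))) (at t)"
      unfolding \<Phi>_def by (intro has_vector_derivative_mult_right has_vector_derivative_diff 3 4)
    then have "(\<Phi> has_vector_derivative f t) (at t)" unfolding f_def of_real_minus diff_minus_eq_add .
    then show ?thesis by (rule has_vector_derivative_at_within)
  qed
  have "(LINT t:{0..1}|lborel. hseg' p q t * (4 * pi * cnj (hseg p q t) / (1 - (cmod (hseg p q t))\<^sup>2)))
      = (LINT t:{0..1}|lborel. f t)"
    using hseg_area_integrand unfolding f_def b_def by (intro set_lebesgue_integral_cong) auto
  also have "\<dots> = \<Phi> 1 - \<Phi> 0"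
    unfolding set_lebesgue_integral_def
  proof (rule integral_FTC_atLeastAtMost)
    have "1 + cnj p * (of_real t * b) \<noteq> 0" "1 - t\<^sup>2 * (cmod b)\<^sup>2 \<noteq> 0" if "t \<in> {0..1}" for t
      using hseg_denom[OF that] pos[OF that] unfolding b_def by (blast, linarith)
    then show "continuous_on {0..1} f"
      unfolding f_def by (intro continuous_intros) blast+
  qed (use der in auto)
  finally show ?thesis by (simp add: \<Phi>_def b_def)
qed

end

section \<open>Algebraic area of closed geodesic polygons\<close>

lemma range_disc: "range p \<subseteq> ball 0 1 \<Longrightarrow> cmod (p k) < 1" for p :: "'i \<Rightarrow> complex"
  by (auto simp: image_subset_iff)

lemma path_image_hchain_Suc:
  assumes "pathfinish (hchain p k) = p k" "cmod (p k) < 1" "cmod (p (Suc k)) < 1"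
  shows "path_image (hchain p (Suc k)) = path_image (hchain p k) \<union> path_image (hseg (p k) (p (Suc k)))"
  using assms hseg_ends[of "p k" "p (Suc k)"] by (simp add: path_image_join pathstart_def)

lemma hchain_ends:
  assumes p: "range p \<subseteq> ball 0 1"
  shows "pathstart (hchain p n) = p 0" "pathfinish (hchain p n) = p n"
  using hseg_ends[OF range_disc[OF p] range_disc[OF p]] by (induction n) (simp_all add: pathstart_def pathfinish_def joinpaths_def)

lemma hchain_valid_path:
  assumes p: "range p \<subseteq> ball 0 1"
  shows "valid_path (hchain p n) \<and> path_image (hchain p n) \<subseteq> ball 0 1 \<and> negligible (path_image (hchain p n))"
proof (induction n)
  case 0
  have "(\<lambda>_. p 0) = linepath (p 0) (p 0)" by (simp add: linepath_def fun_eq_iff algebra_simps flip: scaleR_add_left)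
  then have "valid_path (\<lambda>_. p 0)" by simp
  moreover have "path_image (\<lambda>_::real. p 0) = {p 0}" by (auto simp: path_image_def)
  ultimately show ?case using range_disc[OF p] by simp
next
  case (Suc n)
  have img: "path_image (hseg (p n) (p (Suc n))) \<subseteq> ball 0 1"
    using cmod_hseg[OF range_disc[OF p] range_disc[OF p]] by (auto simp: path_image_def)
  have ends: "pathfinish (hchain p n) = pathstart (hseg (p n) (p (Suc n)))"
    using hchain_ends[OF p] hseg_ends[OF range_disc[OF p] range_disc[OF p]] by (simp add: pathstart_def)
  have "valid_path (hchain p (Suc n))"
    using Suc valid_path_hseg[OF range_disc[OF p] range_disc[OF p]] ends by (auto intro: valid_path_join)
  then show ?case
    unfolding path_image_hchain_Suc[OF hchain_ends(2)[OF p] range_disc[OF p] range_disc[OF p]]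
    using Suc img negligible_path_image_hseg[OF range_disc[OF p] range_disc[OF p]] by (auto intro: negligible_Un)
qed

definition cauchy_edge :: "(nat \<Rightarrow> complex) \<Rightarrow> nat \<Rightarrow> complex \<Rightarrow> complex" where
  "cauchy_edge p k z = (LINT t:{0..1}|lborel. hseg' (p k) (p (Suc k)) t / (hseg (p k) (p (Suc k)) t - z))"

lemma has_contour_integral_hchain:
  assumes p: "range p \<subseteq> ball 0 1"
  shows "z \<notin> path_image (hchain p n) \<Longrightarrow>
    ((\<lambda>w. 1 / (w - z)) has_contour_integral (\<Sum>k<n. cauchy_edge p k z)) (hchain p n)"
proof (induction n)
  case 0
  have "(\<lambda>_. p 0) = linepath (p 0) (p 0)" by (simp add: linepath_def fun_eq_iff algebra_simps flip: scaleR_add_left)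
  then show ?case using has_contour_integral_trivial[of "\<lambda>w. 1 / (w - z)" "p 0"] by simp
next
  case (Suc n)
  have z: "z \<notin> path_image (hchain p n)" "z \<notin> path_image (hseg (p n) (p (Suc n)))"
    using Suc.prems unfolding path_image_hchain_Suc[OF hchain_ends(2)[OF p] range_disc[OF p] range_disc[OF p]] by auto
  have "((\<lambda>w. 1 / (w - z)) has_contour_integral cauchy_edge p n z) (hseg (p n) (p (Suc n)))"
    unfolding cauchy_edge_def
  proof (rule contour_integral_eq_set_integral[OF _ _ z(2)])
    let ?p = "p n" and ?q = "p (Suc n)"
    show "(hseg ?p ?q has_vector_derivative hseg' ?p ?q t) (at t within {0..1})" if "t \<in> {0..1}" for t
      by (rule has_vector_derivative_at_within[OF hseg_has_derivative[OF range_disc[OF p] range_disc[OF p] that]])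
    show "continuous_on {0..1} (hseg' ?p ?q)" by (rule continuous_hseg'[OF range_disc[OF p] range_disc[OF p]])
  qed
  then show ?case
    using has_contour_integral_join[OF Suc.IH[OF z(1)]] hchain_valid_path[OF p] valid_path_hseg[OF range_disc[OF p] range_disc[OF p]]
    by simp
qed

lemma has_integral_cauchy_edge:
  assumes p: "range p \<subseteq> ball 0 1" and r: "0 < r" "r < 1"
    and img: "path_image (hseg (p k) (p (Suc k))) \<subseteq> ball 0 r"
  shows "has_bochner_integral (hball r) (cauchy_edge p k)
    (4 * pi * (Ln (1 + cnj (p k) * chord (p k) (p (Suc k))) - of_real (ln (1 - (cmod (chord (p k) (p (Suc k))))\<^sup>2) / 2)))"
proof -
  let ?\<sigma> = "hseg (p k) (p (Suc k))" and ?\<sigma>' = "hseg' (p k) (p (Suc k))"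
  have "has_bochner_integral (hball r) (cauchy_edge p k) (LINT t:{0..1}|lborel. ?\<sigma>' t * cauchy_transform r (?\<sigma> t))"
    unfolding cauchy_edge_def[abs_def]
    by (intro cauchy_transform_Fubini r continuous_hseg continuous_hseg' cmod_hseg range_disc[OF p])
  also have "(LINT t:{0..1}|lborel. ?\<sigma>' t * cauchy_transform r (?\<sigma> t))
      = (LINT t:{0..1}|lborel. ?\<sigma>' t * (4 * pi * cnj (?\<sigma> t) / (1 - (cmod (?\<sigma> t))\<^sup>2)))"
  proof (rule set_lebesgue_integral_cong)
    have "cmod (?\<sigma> t) < r" if "t \<in> {0..1}" for t
      using img that unfolding path_image_def by (meson image_subset_iff mem_ball_0)
    then show "\<forall>t. t \<in> {0..1} \<longrightarrow> ?\<sigma>' t * cauchy_transform r (?\<sigma> t) = ?\<sigma>' t * (4 * pi * cnj (?\<sigma> t) / (1 - (cmod (?\<sigma> t))\<^sup>2))"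
      using cauchy_transform_hball[OF r] by simp
  qed simp
  also have "\<dots> = 4 * pi * (Ln (1 + cnj (p k) * chord (p k) (p (Suc k))) - of_real (ln (1 - (cmod (chord (p k) (p (Suc k))))\<^sup>2) / 2))"
    by (rule hseg_area_integral[OF range_disc[OF p] range_disc[OF p]])
  finally show ?thesis .
qed

lemma path_image_hchain_subset:
  assumes p: "range p \<subseteq> ball 0 1" and "k < n"
  shows "path_image (hseg (p k) (p (Suc k))) \<subseteq> path_image (hchain p n)"
  using assms(2)
proof (induction n)
  case (Suc n)
  then show ?case unfolding path_image_hchain_Suc[OF hchain_ends(2)[OF p] range_disc[OF p] range_disc[OF p]]
    by (cases "k = n") auto
qed simp

text \<open>Off the curve, which is a null set, the winding number is a sum of Cauchy integrals over the
  edges; integrating them over the hyperbolic disc gives the Cauchy transform along each edge.\<close>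

theorem algebraic_area_hchain:
  assumes p: "range p \<subseteq> ball 0 1" and closed: "p n = p 0"
  shows "algebraic_area (hchain p n) = (\<Sum>k<n. fan_area (p k) (p (Suc k)))"
proof -
  define \<gamma> where "\<gamma> = hchain p n"
  have \<gamma>: "valid_path \<gamma>" "path_image \<gamma> \<subseteq> ball 0 1" "negligible (path_image \<gamma>)" "path \<gamma>" "pathfinish \<gamma> = pathstart \<gamma>"
    using hchain_valid_path[OF p] hchain_ends[OF p] closed by (auto simp: \<gamma>_def valid_path_imp_path)
  have cpt: "compact (path_image \<gamma>)" by (rule compact_path_image[OF \<gamma>(4)])
  \<comment> \<open>the curve is compact, so it stays in a smaller disc\<close>
  obtain r where r: "0 < r" "r < 1" and img: "path_image \<gamma> \<subseteq> ball 0 r"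
  proof -
    obtain w where w: "w \<in> path_image \<gamma>" "\<And>z. z \<in> path_image \<gamma> \<Longrightarrow> cmod z \<le> cmod w"
      using continuous_attains_sup[OF cpt path_image_nonempty continuous_on_norm_id] by auto
    have "cmod w < 1" using w(1) \<gamma>(2) by auto
    then obtain r where "cmod w < r" "r < 1" using dense by metis
    show ?thesis
    proof (rule that[OF _ \<open>r < 1\<close>])
      show "0 < r" using \<open>cmod w < r\<close> norm_ge_zero[of w] by linarith
      show "path_image \<gamma> \<subseteq> ball 0 r" using w(2) \<open>cmod w < r\<close> by (meson le_less_trans mem_ball_0 subsetI)
    qed
  qed
  define S where "S z = 1 / (2 * pi * \<i>) * (\<Sum>k<n. cauchy_edge p k z)" for z
  have wn: "winding_number \<gamma> z = S z" if "z \<notin> path_image \<gamma>" for z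
    using has_contour_integral_hchain[OF p, of z n] that \<gamma>(1)
    by (simp add: winding_number_valid_path contour_integral_unique S_def \<gamma>_def)
  have "has_bochner_integral (hball r) S
    (1 / (2 * pi * \<i>) * (\<Sum>k<n. 4 * pi * (Ln (1 + cnj (p k) * chord (p k) (p (Suc k)))
       - of_real (ln (1 - (cmod (chord (p k) (p (Suc k))))\<^sup>2) / 2))))"
    unfolding S_def
  proof (rule has_bochner_integral_mult_right, rule has_bochner_integral_sum, rule has_integral_cauchy_edge[OF p r])
    fix k assume "k \<in> {..<n}"
    then show "path_image (hseg (p k) (p (Suc k))) \<subseteq> ball 0 r"
      using path_image_hchain_subset[OF p, of k n] img unfolding \<gamma>_def by simp
  qed
  note S = has_bochner_integral_bounded_linear[OF bounded_linear_Re this]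
  have sum: "Re (1 / (2 * pi * \<i>) * (\<Sum>k<n. 4 * pi * (Ln (1 + cnj (p k) * chord (p k) (p (Suc k)))
       - of_real (ln (1 - (cmod (chord (p k) (p (Suc k))))\<^sup>2) / 2)))) = (\<Sum>k<n. fan_area (p k) (p (Suc k)))"
  proof -
    have "Re (1 / (2 * pi * \<i>) * (4 * pi * (x - of_real y))) = 2 * Im x" for x :: complex and y :: real
    proof -
      have "1 / (2 * pi * \<i>) * (4 * pi * (x - of_real y)) = - 2 * \<i> * (x - of_real y)"
        by (simp add: field_simps)
      then show ?thesis by simp
    qed
    from this[of "Ln (1 + cnj (p k) * chord (p k) (p (Suc k)))" "ln (1 - (cmod (chord (p k) (p (Suc k))))\<^sup>2) / 2" for k]
    have "Re (1 / (2 * pi * \<i>) * (4 * pi * (Ln (1 + cnj (p k) * chord (p k) (p (Suc k)))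
       - of_real (ln (1 - (cmod (chord (p k) (p (Suc k))))\<^sup>2) / 2)))) = fan_area (p k) (p (Suc k))" for k
      unfolding fan_area_chord[OF range_disc[OF p] range_disc[OF p], symmetric] .
    then show ?thesis by (simp only: sum_distrib_left Re_sum)
  qed
  have Re_S: "has_bochner_integral (hball r) (\<lambda>z. Re (S z)) (\<Sum>k<n. fan_area (p k) (p (Suc k)))"
    using S unfolding sum .
  let ?C = "- path_image \<gamma>"
  let ?w = "\<lambda>z. indicator ?C z *\<^sub>R Re (winding_number \<gamma> z)"
  have C: "?C \<in> sets borel" using cpt by (auto intro: borel_open simp: compact_imp_closed open_Compl)
  have w[measurable]: "?w \<in> borel_measurable borel"
    using C by (intro borel_measurable_continuous_on_indicator continuous_on_Re continuous_on_winding_number \<gamma>(4))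
  have [measurable]: "(\<lambda>z. Re (S z)) \<in> borel_measurable borel"
    using Re_S by (auto simp: has_bochner_integral_iff cong: measurable_cong_sets)
  have "algebraic_area \<gamma> = (LINT z|harea. ?w z)"
    by (simp add: algebraic_area_def set_lebesgue_integral_def)
  also have "harea = density lborel (\<lambda>z. ennreal (4 / (1 - (cmod z)\<^sup>2)\<^sup>2 * indicator (ball 0 1) z))"
    unfolding harea_def by (intro density_cong) (auto simp: indicator_def)
  also have "(LINT z|\<dots>. ?w z) = (LINT z|lborel. (4 / (1 - (cmod z)\<^sup>2)\<^sup>2 * indicator (ball 0 1) z) *\<^sub>R ?w z)"
    using w by (intro integral_density) auto
  also have "\<dots> = (LINT z|lborel. (4 / (1 - (cmod z)\<^sup>2)\<^sup>2 * indicator (ball 0 r) z) *\<^sub>R Re (S z))"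
  proof (rule integral_cong_AE)
    have "AE z in lborel. z \<notin> path_image \<gamma>"
      using \<gamma>(3) compact_imp_closed[OF cpt]
      by (intro AE_not_in) (auto simp: null_sets_completion_iff negligible_iff_null_sets)
    then show "AE z in lborel. (4 / (1 - (cmod z)\<^sup>2)\<^sup>2 * indicator (ball 0 1) z) *\<^sub>R ?w z
        = (4 / (1 - (cmod z)\<^sup>2)\<^sup>2 * indicator (ball 0 r) z) *\<^sub>R Re (S z)"
    proof eventually_elim
      case (elim z)
      show ?case
      proof (cases "cmod z < r")
        case True
        then show ?thesis using elim wn r by simp
      next
        case False
        then have "winding_number \<gamma> z = 0"
          using img by (intro winding_number_zero_outside[OF \<gamma>(4) _ \<gamma>(5), of "ball 0 r"]) auto
        then show ?thesis using False by simp
      qed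
    qed
  qed measurable
  also have "\<dots> = (LINT z|hball r. Re (S z))"
    unfolding hball_def by (rule integral_density[symmetric]) auto
  also have "\<dots> = (\<Sum>k<n. fan_area (p k) (p (Suc k)))"
    using Re_S by (simp add: has_bochner_integral_iff)
  finally show ?thesis by (simp add: \<gamma>_def)
qed

section \<open>Isometries and reflections acting on the walk\<close>

text \<open>The unit number by which the derivative of \<open>htrans a\<close> at \<open>z\<close> rotates directions, see
  \<open>sgn_htrans_derivative\<close>.\<close>

definition isom_twist :: "complex \<Rightarrow> complex \<Rightarrow> complex" where
  "isom_twist a z = (1 + a * cnj z) / (1 + cnj a * z)"

text \<open>The action of the orientation preserving isometry \<open>z \<mapsto> htrans a (c * z)\<close> on pairs of a location
  and a direction.\<close>

definition isom_act :: "complex \<Rightarrow> complex \<Rightarrow> complex \<times> complex \<Rightarrow> complex \<times> complex" where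
  "isom_act a c = (\<lambda>(p, v). (htrans a (c * p), isom_twist a (c * p) * c * v))"

definition walk_step :: "real \<Rightarrow> real \<Rightarrow> complex \<times> complex \<Rightarrow> complex \<times> complex" where
  "walk_step l \<theta> = (\<lambda>(p, v). (hgeod p v l, cis \<theta> * sgn (vector_derivative (hgeod p v) (at l))))"

lemma walk_Suc: "walk l \<alpha> u s (Suc i) = walk_step l (s (Suc i) * \<alpha>) (walk l \<alpha> u s i)"
  by (simp add: walk_step_def Let_def split_beta)

lemma htrans_htrans:
  assumes "cmod a < 1" "cmod p < 1" "cmod z < 1"
  shows "htrans a (htrans p z) = htrans (htrans a p) (isom_twist a p * z)"
proof -
  have d1: "1 + cnj p * z \<noteq> 0" using assms by (intro htrans_denom_nonzero)
  have d2: "1 + cnj a * p \<noteq> 0" using assms by (intro htrans_denom_nonzero)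
  have d3: "1 + a * cnj p \<noteq> 0"
    using htrans_denom_nonzero[OF assms(2,1)] by (simp add: mult.commute)
  define N where "N = z + p + a * (1 + cnj p * z)"
  define M where "M = 1 + cnj p * z + cnj a * (z + p)"
  have "(z + p) / (1 + cnj p * z) + a = N / (1 + cnj p * z)"
    using d1 by (simp add: N_def field_simps)
  moreover have "1 + cnj a * ((z + p) / (1 + cnj p * z)) = M / (1 + cnj p * z)"
    using d1 by (simp add: M_def field_simps)
  ultimately have L: "htrans a (htrans p z) = N / M" using d1 by (simp add: htrans_def)
  have "(1 + a * cnj p) / (1 + cnj a * p) * z + (p + a) / (1 + cnj a * p) = N / (1 + cnj a * p)"
  proof -
    have "N = (1 + a * cnj p) * z + (p + a)" by (simp add: N_def algebra_simps)
    then show ?thesis by (simp only: add_divide_distrib[of "(1 + a * cnj p) * z" "p + a"] times_divide_eq_left)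
  qed
  moreover have "1 + cnj ((p + a) / (1 + cnj a * p)) * ((1 + a * cnj p) / (1 + cnj a * p) * z) = M / (1 + cnj a * p)"
  proof -
    have "cnj ((p + a) / (1 + cnj a * p)) * ((1 + a * cnj p) / (1 + cnj a * p) * z)
        = (cnj p + cnj a) * z / (1 + cnj a * p)"
      using d3 by simp
    moreover have "M = (1 + cnj a * p) + (cnj p + cnj a) * z" by (simp add: M_def algebra_simps)
    ultimately show ?thesis using d2 by (simp add: add_divide_distrib)
  qed
  ultimately have "htrans (htrans a p) (isom_twist a p * z) = N / M"
    using d2 by (simp add: htrans_def isom_twist_def)
  then show ?thesis using L by simp
qed

lemma htrans_rotate: "cmod c = 1 \<Longrightarrow> htrans (c * p) (c * z) = c * htrans p z"
proof -
  assume c: "cmod c = 1"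
  have "cnj c * c = 1" using complex_norm_square[of c] c by (simp add: mult.commute)
  then have "cnj (c * p) * (c * z) = cnj p * z" by (simp add: algebra_simps)
  then show ?thesis by (simp add: htrans_def flip: distrib_left)
qed

lemma sgn_htrans_derivative:
  assumes "cmod a < 1" "cmod w < 1"
  shows "sgn (of_real (1 - (cmod a)\<^sup>2) / (1 + cnj a * w)\<^sup>2) = isom_twist a w"
proof -
  define d where "d = 1 + cnj a * w"
  have d: "d \<noteq> 0" unfolding d_def using assms by (rule htrans_denom_nonzero)
  have pos: "0 < 1 - (cmod a)\<^sup>2" using assms by (simp add: abs_square_less_1)
  have "sgn (of_real (1 - (cmod a)\<^sup>2) / d\<^sup>2) = of_real ((cmod d)\<^sup>2) / d\<^sup>2"
    using pos d by (simp add: sgn_eq norm_divide norm_power del: of_real_diff)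
  also have "\<dots> = cnj d / d"
    unfolding complex_norm_square using d by (simp add: power2_eq_square)
  finally show ?thesis by (simp add: d_def isom_twist_def)
qed

lemma hgeod_differentiable:
  assumes "cmod p < 1" "cmod v = 1"
  shows "(hgeod p v has_vector_derivative vector_derivative (hgeod p v) (at t)) (at t)"
proof -
  have z: "cmod (of_real (tanh (t / 2)) * v) < 1"
    using assms(2) tanh_real_lt_1[of "t/2"] tanh_real_gt_neg1[of "t/2"]
    by (auto simp: norm_mult abs_less_iff)
  have 1: "((\<lambda>t. of_real (tanh (t / 2)) * v) has_vector_derivative
      (of_real ((1 - tanh (t / 2) ^ 2) / 2) * v)) (at t)"
    by (rule has_vector_derivative_eq_rhs,
        rule has_vector_derivative_mult_left,
        rule has_vector_derivative_of_real, (auto intro!: derivative_eq_intros))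
  show ?thesis
    using field_vector_diff_chain_at[OF 1 htrans_has_derivative[OF assms(1) z]]
    by (subst vector_derivative_works[symmetric])
      (auto simp: o_def hgeod_def[abs_def] intro: differentiableI_vector)
qed

lemma hgeod_isom_act:
  assumes "cmod a < 1" "cmod c = 1" "cmod p < 1" "cmod v = 1"
  shows "hgeod (htrans a (c * p)) (isom_twist a (c * p) * c * v) = (\<lambda>t. htrans a (c * hgeod p v t))"
proof
  fix t
  let ?x = "complex_of_real (tanh (t / 2))"
  have z: "cmod (c * (?x * v)) < 1"
    using assms tanh_real_lt_1[of "t/2"] tanh_real_gt_neg1[of "t/2"]
    by (auto simp: norm_mult abs_less_iff)
  have "htrans a (c * hgeod p v t) = htrans a (htrans (c * p) (c * (?x * v)))"
    unfolding hgeod_def htrans_rotate[OF assms(2)] ..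
  also have "\<dots> = htrans (htrans a (c * p)) (isom_twist a (c * p) * (c * (?x * v)))"
    using assms z by (intro htrans_htrans) (auto simp: norm_mult)
  finally show "hgeod (htrans a (c * p)) (isom_twist a (c * p) * c * v) t = htrans a (c * hgeod p v t)"
    by (simp add: hgeod_def mult_ac)
qed

text \<open>A step of the walk is defined by the metric and oriented angles alone, so it commutes with
  isometries.\<close>

lemma walk_step_isom_act:
  assumes "cmod a < 1" "cmod c = 1" "cmod p < 1" "cmod v = 1"
  shows "walk_step l \<theta> (isom_act a c (p, v)) = isom_act a c (walk_step l \<theta> (p, v))"
proof -
  define D where "D = vector_derivative (hgeod p v) (at l)"
  let ?z = "hgeod p v l"
  have z: "cmod (c * ?z) < 1" using cmod_hgeod_less_1[OF assms(3,4)] assms by (simp add: norm_mult)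
  have "((\<lambda>t. c * hgeod p v t) has_vector_derivative c * D) (at l)"
    unfolding D_def using assms by (intro has_vector_derivative_mult_right hgeod_differentiable)
  from field_vector_diff_chain_at[OF this htrans_has_derivative[OF assms(1) z]]
  have "((\<lambda>t. htrans a (c * hgeod p v t)) has_vector_derivative
      c * D * (of_real (1 - (cmod a)\<^sup>2) / (1 + cnj a * (c * ?z))\<^sup>2)) (at l)"
    by (simp add: o_def)
  then have "vector_derivative (\<lambda>t. htrans a (c * hgeod p v t)) (at l)
      = c * D * (of_real (1 - (cmod a)\<^sup>2) / (1 + cnj a * (c * ?z))\<^sup>2)"
    by (rule vector_derivative_at)
  then have "sgn (vector_derivative (\<lambda>t. htrans a (c * hgeod p v t)) (at l))
      = sgn c * sgn D * isom_twist a (c * ?z)"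
    by (simp only: sgn_mult sgn_htrans_derivative[OF assms(1) z])
  also have "sgn c = c" using assms(2) by (simp add: sgn_eq)
  finally have "sgn (vector_derivative (hgeod (htrans a (c * p)) (isom_twist a (c * p) * c * v)) (at l))
      = c * sgn D * isom_twist a (c * ?z)"
    unfolding hgeod_isom_act[OF assms] .
  moreover have "hgeod (htrans a (c * p)) (isom_twist a (c * p) * c * v) l = htrans a (c * ?z)"
    by (simp only: hgeod_isom_act[OF assms])
  ultimately show ?thesis
    unfolding walk_step_def isom_act_def prod.case by (simp only: D_def mult_ac)
qed

text \<open>The isometry that takes the initial state \<open>(0, u)\<close> to the state after \<open>m\<close> moves takes the walk with
  the remaining signs to the continuation of the walk.\<close>

lemma walk_add:
  assumes u: "cmod u = 1"
  shows "walk l \<alpha> u s (m + n)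
    = isom_act (fst (walk l \<alpha> u s m)) (snd (walk l \<alpha> u s m) / u) (walk l \<alpha> u (\<lambda>i. s (m + i)) n)"
proof (induction n)
  case 0
  have "u \<noteq> 0" using u by auto
  then show ?case by (simp add: isom_act_def isom_twist_def htrans_def split_beta)
next
  case (Suc n)
  let ?a = "fst (walk l \<alpha> u s m)" and ?c = "snd (walk l \<alpha> u s m) / u"
    and ?w = "walk l \<alpha> u (\<lambda>i. s (m + i)) n"
  have "walk l \<alpha> u s (m + Suc n) = walk_step l (s (m + Suc n) * \<alpha>) (isom_act ?a ?c ?w)"
    by (simp only: add_Suc_right walk_Suc Suc)
  also have "\<dots> = isom_act ?a ?c (walk_step l (s (m + Suc n) * \<alpha>) ?w)"
    using walk_unit[OF u, of l \<alpha> s m] walk_unit[OF u, of l \<alpha> "\<lambda>i. s (m + i)" n] u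
      walk_step_isom_act[of ?a ?c "fst ?w" "snd ?w"]
    by (simp add: norm_divide)
  finally show ?case by (simp only: walk_Suc)
qed

lemma walk_cong: "(\<And>j. 0 < j \<Longrightarrow> j \<le> i \<Longrightarrow> s j = s' j) \<Longrightarrow> walk l \<alpha> u s i = walk l \<alpha> u s' i"
proof (induction i)
  case (Suc i)
  then have "walk l \<alpha> u s i = walk l \<alpha> u s' i" by auto
  then show ?case unfolding walk_Suc using Suc.prems[of "Suc i"] by simp
qed simp

lemma fan_area_rotate: "cmod c = 1 \<Longrightarrow> fan_area (c * p) (c * q) = fan_area p q"
proof -
  assume c: "cmod c = 1"
  have "cnj c * c = 1" using complex_norm_square[of c] c by (simp add: mult.commute)
  then have "cnj (c * p) * (c * q) = cnj p * q" by (simp add: algebra_simps)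
  then show ?thesis by (simp only: fan_area_def)
qed

text \<open>The potential whose differences measure how \<open>fan_area\<close> changes when its base point is moved by
  \<open>htrans a\<close>.\<close>

definition visual_angle :: "complex \<Rightarrow> complex \<Rightarrow> real" where
  "visual_angle a z = 2 * Im (Ln (1 + cnj a * z))"

lemma abs_visual_angle: "cmod a < 1 \<Longrightarrow> cmod z < 1 \<Longrightarrow> \<bar>visual_angle a z\<bar> \<le> pi"
  using abs_Im_Ln_one_plus[OF cmod_cnj_mult_less_1[of a z]] by (simp add: visual_angle_def)

text \<open>The factorisation \<open>(1 - cnj P * Q) * (1 + a * cnj p) * (1 + cnj a * q) = (1 - |a|^2) * (1 - cnj p * q)\<close>
  determines the arguments modulo \<open>2 pi\<close>. Each of the four arguments is less than \<open>pi / 2\<close> in absolute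
  value, so the multiple of \<open>2 pi\<close> vanishes.\<close>

lemma fan_area_htrans:
  assumes a: "cmod a < 1" and p: "cmod p < 1" and q: "cmod q < 1"
  shows "fan_area (htrans a p) (htrans a q) = fan_area p q + visual_angle a q - visual_angle a p"
proof -
  define P Q where "P = htrans a p" and "Q = htrans a q"
  define A B C D where "A = 1 - cnj P * Q" and "B = 1 + a * cnj p" and "C = 1 + cnj a * q"
    and "D = 1 - cnj p * q"
  define r where "r = 1 - (cmod a)\<^sup>2"
  have P: "cmod P < 1" and Q: "cmod Q < 1" using assms by (auto simp: P_def Q_def cmod_htrans_less_1)
  have small: "cmod (- (cnj P * Q)) < 1" "cmod (cnj (cnj a * p)) < 1" "cmod (cnj a * q) < 1" "cmod (- (cnj p * q)) < 1"
    using cmod_cnj_mult_less_1 assms P Q by (simp_all add: norm_mult)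
  have Im: "\<bar>Im (Ln A)\<bar> < pi / 2" "\<bar>Im (Ln B)\<bar> < pi / 2" "\<bar>Im (Ln C)\<bar> < pi / 2" "\<bar>Im (Ln D)\<bar> < pi / 2"
    using small[THEN abs_Im_Ln_one_plus] by (simp_all add: A_def B_def C_def D_def)
  have nz: "A \<noteq> 0" "B \<noteq> 0" "C \<noteq> 0" "D \<noteq> 0"
    using small[THEN one_plus_nonzero] by (simp_all add: A_def B_def C_def D_def)
  have r: "r > 0" using a by (simp add: r_def abs_square_less_1)
  have ar: "a * cnj a = 1 - of_real r" by (simp add: r_def flip: complex_norm_square)
  have "A * (B * C) = of_real r * D"
  proof -
    have "cnj P * B = cnj p + cnj a" "Q * C = q + a"
      using nz by (simp_all add: P_def Q_def B_def C_def htrans_def)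
    then have "A * (B * C) = B * C - (cnj p + cnj a) * (q + a)"
      by (simp add: A_def left_diff_distrib) (metis mult.assoc mult.left_commute)
    also have "\<dots> = (1 - a * cnj a) * D" by (simp add: B_def C_def D_def algebra_simps)
    also have "1 - a * cnj a = of_real r" unfolding ar by simp
    finally show ?thesis .
  qed
  then have "exp (Ln A + Ln B + Ln C) = exp (of_real (ln r) + Ln D)"
    using nz r by (simp add: exp_add exp_of_real mult.assoc)
  then obtain n :: int where n: "Ln A + Ln B + Ln C = of_real (ln r) + Ln D + (of_int (2 * n) * pi) * \<i>"
    unfolding exp_eq by auto
  have Imn: "Im (Ln A) + Im (Ln B) + Im (Ln C) = Im (Ln D) + 2 * n * pi"
    using arg_cong[OF n, of Im] by simp
  then have "\<bar>2 * n * pi\<bar> < 2 * pi" using Im by linarith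
  then have "n = 0" by (simp add: abs_mult)
  then have main: "Im (Ln A) = Im (Ln D) - Im (Ln B) - Im (Ln C)" using Imn by simp
  have "1 + cnj a * p \<notin> \<real>\<^sub>\<le>\<^sub>0" by (rule one_plus_notin_nonpos[OF cmod_cnj_mult_less_1[OF a p]])
  from cnj_Ln[OF this] have "Ln B = cnj (Ln (1 + cnj a * p))" by (simp add: B_def)
  then have "Im (Ln B) = - Im (Ln (1 + cnj a * p))" by simp
  then show ?thesis
    using main by (simp add: fan_area_def visual_angle_def A_def C_def D_def P_def Q_def)
qed

definition letters :: "real list \<Rightarrow> nat \<Rightarrow> real" where
  "letters xs i = xs ! (i - 1)"

definition walk_area :: "real \<Rightarrow> real \<Rightarrow> complex \<Rightarrow> (nat \<Rightarrow> real) \<Rightarrow> nat \<Rightarrow> real" where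
  "walk_area l \<alpha> u s n = (\<Sum>k<n. fan_area (fst (walk l \<alpha> u s k)) (fst (walk l \<alpha> u s (Suc k))))"

lemma walk_area_cong:
  "(\<And>j. 0 < j \<Longrightarrow> j \<le> n \<Longrightarrow> s j = s' j) \<Longrightarrow> walk_area l \<alpha> u s n = walk_area l \<alpha> u s' n"
  unfolding walk_area_def
proof (rule sum.cong[OF refl])
  fix k assume *: "\<And>j. 0 < j \<Longrightarrow> j \<le> n \<Longrightarrow> s j = s' j" "k \<in> {..<n}"
  then have "walk l \<alpha> u s k = walk l \<alpha> u s' k" "walk l \<alpha> u s (Suc k) = walk l \<alpha> u s' (Suc k)"
    by (auto intro!: walk_cong simp del: walk.simps)
  then show "fan_area (fst (walk l \<alpha> u s k)) (fst (walk l \<alpha> u s (Suc k)))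
      = fan_area (fst (walk l \<alpha> u s' k)) (fst (walk l \<alpha> u s' (Suc k)))" by simp
qed

text \<open>The coboundary in \<open>fan_area_htrans\<close> telescopes along the second part of the walk and leaves a single
  \<open>visual_angle\<close>.\<close>

lemma walk_area_add:
  assumes u: "cmod u = 1"
  shows "\<bar>walk_area l \<alpha> u s (m + n) - walk_area l \<alpha> u s m - walk_area l \<alpha> u (\<lambda>i. s (m + i)) n\<bar> \<le> pi"
proof -
  define a c where "a = fst (walk l \<alpha> u s m)" and "c = snd (walk l \<alpha> u s m) / u"
  define p where "p k = fst (walk l \<alpha> u (\<lambda>i. s (m + i)) k)" for k
  have a: "cmod a < 1" and c: "cmod c = 1" and p: "cmod (p k) < 1" for k
    using walk_unit[OF u] u by (auto simp: a_def c_def p_def norm_divide)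
  have walk: "fst (walk l \<alpha> u s (m + k)) = htrans a (c * p k)" for k
    unfolding walk_add[OF u] by (simp add: isom_act_def split_beta a_def c_def p_def)
  let ?h = "\<lambda>k. visual_angle a (c * p k)"
  have fan: "fan_area (htrans a (c * p k)) (htrans a (c * p (Suc k))) = fan_area (p k) (p (Suc k)) + (?h (Suc k) - ?h k)" for k
    using a c p by (subst fan_area_htrans) (auto simp: norm_mult fan_area_rotate)
  have "walk_area l \<alpha> u s (m + n)
      = walk_area l \<alpha> u s m + (\<Sum>k<n. fan_area (fst (walk l \<alpha> u s (m + k))) (fst (walk l \<alpha> u s (m + Suc k))))"
    unfolding walk_area_def by (induction n) (simp_all del: walk.simps)
  also have "\<dots> = walk_area l \<alpha> u s m + ((\<Sum>k<n. fan_area (p k) (p (Suc k))) + (\<Sum>k<n. ?h (Suc k) - ?h k))"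
    unfolding walk fan sum.distrib ..
  also have "(\<Sum>k<n. ?h (Suc k) - ?h k) = ?h n - ?h 0" by (rule sum_lessThan_telescope)
  also have "?h 0 = 0" by (simp add: p_def visual_angle_def)
  finally have "walk_area l \<alpha> u s (m + n) - walk_area l \<alpha> u s m - walk_area l \<alpha> u (\<lambda>i. s (m + i)) n = ?h n"
    by (simp add: walk_area_def p_def del: walk.simps)
  moreover have "\<bar>?h n\<bar> \<le> pi" using a c p by (intro abs_visual_angle) (auto simp: norm_mult)
  ultimately show ?thesis by simp
qed

lemma htrans_reflect:
  assumes "cmod w = 1"
  shows "htrans (w * cnj p) (w * cnj z) = w * cnj (htrans p z)"
proof -
  have "cnj w * w = 1" using complex_norm_square[of w] assms by (simp add: mult.commute)
  then have "cnj (w * cnj p) * (w * cnj z) = p * cnj z" by (simp add: algebra_simps)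
  then show ?thesis by (simp add: htrans_def flip: distrib_left)
qed

text \<open>Left and right turns are exchanged by \<open>z \<mapsto> u\<^sup>2 * cnj z\<close>, the reflection in the line that contains
  the first move.\<close>

lemma walk_reflect:
  assumes u: "cmod u = 1"
  shows "walk l \<alpha> u (\<lambda>i. - s i) n = (u\<^sup>2 * cnj (fst (walk l \<alpha> u s n)), u\<^sup>2 * cnj (snd (walk l \<alpha> u s n)))"
proof (induction n)
  case 0
  have "u\<^sup>2 * cnj u = u * (u * cnj u)" by (simp add: power2_eq_square)
  also have "u * cnj u = 1" using complex_norm_square[of u] u by simp
  finally show ?case by simp
next
  case (Suc n)
  obtain p v where pv: "walk l \<alpha> u s n = (p, v)" by fastforce
  have p: "cmod p < 1" and v: "cmod v = 1" using walk_unit[OF u, of l \<alpha> s n] by (auto simp: pv)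
  define w where "w = u\<^sup>2"
  have w: "cmod w = 1" using u by (simp add: w_def norm_power)
  define D where "D = vector_derivative (hgeod p v) (at l)"
  have geod: "hgeod (w * cnj p) (w * cnj v) = (\<lambda>t. w * cnj (hgeod p v t))"
  proof
    fix t
    show "hgeod (w * cnj p) (w * cnj v) t = w * cnj (hgeod p v t)"
      using htrans_reflect[OF w, of p "of_real (tanh (t / 2)) * v"]
      by (simp add: hgeod_def mult.left_commute)
  qed
  have "((\<lambda>t. w * cnj (hgeod p v t)) has_vector_derivative w * cnj D) (at l)"
    using hgeod_differentiable[OF p v, of l]
    by (intro has_vector_derivative_mult_right has_vector_derivative_cnj) (simp add: D_def)
  then have "vector_derivative (\<lambda>t. w * cnj (hgeod p v t)) (at l) = w * cnj D"
    by (rule vector_derivative_at)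
  moreover have "sgn (w * cnj D) = w * cnj (sgn D)"
    using w by (simp add: sgn_eq norm_mult)
  ultimately show ?case
    by (simp only: walk_Suc Suc pv fst_conv snd_conv w_def[symmetric])
      (simp add: walk_step_def geod D_def cis_cnj[symmetric])
qed

lemma fan_area_reflect:
  assumes "cmod w = 1" "cmod p < 1" "cmod q < 1"
  shows "fan_area (w * cnj p) (w * cnj q) = - fan_area p q"
proof -
  have np: "1 - cnj p * q \<notin> \<real>\<^sub>\<le>\<^sub>0"
    using one_plus_notin_nonpos[of "- (cnj p * q)"] cmod_cnj_mult_less_1[OF assms(2,3)] by simp
  have "fan_area (w * cnj p) (w * cnj q) = fan_area (cnj p) (cnj q)"
    by (rule fan_area_rotate[OF assms(1)])
  also have "\<dots> = - 2 * Im (Ln (cnj (1 - cnj p * q)))" by (simp add: fan_area_def)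
  also have "Ln (cnj (1 - cnj p * q)) = cnj (Ln (1 - cnj p * q))" using cnj_Ln[OF np] by simp
  finally show ?thesis by (simp add: fan_area_def)
qed

lemma walk_area_uminus:
  assumes u: "cmod u = 1"
  shows "walk_area l \<alpha> u (\<lambda>i. - s i) n = - walk_area l \<alpha> u s n"
  unfolding walk_area_def sum_negf[symmetric] walk_reflect[OF u] fst_conv
  using u walk_unit[OF u] by (intro sum.cong refl fan_area_reflect) (auto simp: norm_power simp del: walk.simps)

lemma sign_avg_map_uminus: "sign_avg n (\<lambda>xs. f (map uminus xs)) = sign_avg n f"
proof (induction n arbitrary: f)
  case (Suc n)
  show ?case
    using Suc[of "\<lambda>xs. f (1 # xs)"] Suc[of "\<lambda>xs. f (- 1 # xs)"] by (simp add: add.commute)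
qed simp

lemma sign_avg_odd:
  fixes f :: "real list \<Rightarrow> real"
  assumes "\<And>xs. length xs = n \<Longrightarrow> f (map uminus xs) = - f xs"
  shows "sign_avg n f = 0"
proof -
  have "sign_avg n f = sign_avg n (\<lambda>xs. f (map uminus xs))" by (rule sign_avg_map_uminus[symmetric])
  also have "\<dots> = sign_avg n (\<lambda>xs. (- 1) * f xs)"
    using assms by (intro sign_avg_cong) (simp add: sign_lists_def)
  also have "\<dots> = - sign_avg n f" unfolding sign_avg_mult_left by simp
  finally show ?thesis by simp
qed

lemma word_area_append:
  assumes "cmod u = 1"
  shows "\<bar>walk_area l \<alpha> u (letters (xs @ ys)) (length (xs @ ys))
    - walk_area l \<alpha> u (letters xs) (length xs) - walk_area l \<alpha> u (letters ys) (length ys)\<bar> \<le> pi"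
proof -
  have "walk_area l \<alpha> u (letters (xs @ ys)) (length xs) = walk_area l \<alpha> u (letters xs) (length xs)"
    by (rule walk_area_cong) (auto simp: letters_def nth_append)
  moreover have "walk_area l \<alpha> u (\<lambda>i. letters (xs @ ys) (length xs + i)) (length ys) = walk_area l \<alpha> u (letters ys) (length ys)"
    by (rule walk_area_cong) (auto simp: letters_def nth_append)
  ultimately show ?thesis
    using walk_area_add[OF assms, of l \<alpha> "letters (xs @ ys)" "length xs" "length ys"] by simp
qed

lemma word_area_uminus:
  assumes "cmod u = 1"
  shows "walk_area l \<alpha> u (letters (map uminus xs)) (length xs) = - walk_area l \<alpha> u (letters xs) (length xs)"
  unfolding walk_area_uminus[OF assms, symmetric] by (rule walk_area_cong) (simp add: letters_def)

lemma word_area_single: "walk_area l \<alpha> u (letters [x]) 1 = 0"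
  by (simp add: walk_area_def fan_area_def)

text \<open>The winding number predicted by Gauss-Bonnet when the turning angles are exactly those of the
  walk.\<close>

definition turning_functional :: "real \<Rightarrow> real \<Rightarrow> complex \<Rightarrow> real list \<Rightarrow> real" where
  "turning_functional l \<alpha> u xs = (\<alpha> * sum_list xs - walk_area l \<alpha> u (letters xs) (length xs)) / (2 * pi)"

lemma sign_quasimorphism_area:
  assumes "cmod u = 1"
  shows "sign_quasimorphism (\<lambda>xs. walk_area l \<alpha> u (letters xs) (length xs)) pi"
proof
  show "sign_avg n (\<lambda>xs. walk_area l \<alpha> u (letters xs) (length xs)) = 0" for n
    by (rule sign_avg_odd) (metis length_map word_area_uminus[OF assms])
  show "\<bar>walk_area l \<alpha> u (letters [x]) (length [x])\<bar> \<le> pi" for x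
    using word_area_single[of l \<alpha> u x] by simp
qed (rule word_area_append[OF assms])

lemma sign_quasimorphism_turning:
  assumes "cmod u = 1"
  shows "sign_quasimorphism (turning_functional l \<alpha> u) (1 + \<bar>\<alpha>\<bar>)"
proof
  have pi2: "1 \<le> 2 * pi" using pi_ge_two by simp
  show "sign_avg n (turning_functional l \<alpha> u) = 0" for n
  proof (rule sign_avg_odd)
    fix xs :: "real list"
    have "sum_list (map uminus xs) = - sum_list xs" by (induction xs) auto
    then show "turning_functional l \<alpha> u (map uminus xs) = - turning_functional l \<alpha> u xs"
      by (simp add: turning_functional_def word_area_uminus[OF assms] field_simps)
  qed
  fix xs ys
  have "turning_functional l \<alpha> u (xs @ ys) - turning_functional l \<alpha> u xs - turning_functional l \<alpha> u ys
      = - (walk_area l \<alpha> u (letters (xs @ ys)) (length (xs @ ys))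
        - walk_area l \<alpha> u (letters xs) (length xs) - walk_area l \<alpha> u (letters ys) (length ys)) / (2 * pi)"
    by (simp add: turning_functional_def field_simps)
  also have "\<bar>\<dots>\<bar> \<le> pi / (2 * pi)"
    unfolding abs_divide abs_minus_cancel using word_area_append[OF assms, of l \<alpha> xs ys] by (intro frac_le) auto
  also have "\<dots> \<le> 1 + \<bar>\<alpha>\<bar>" by simp
  finally show "\<bar>turning_functional l \<alpha> u (xs @ ys) - turning_functional l \<alpha> u xs - turning_functional l \<alpha> u ys\<bar> \<le> 1 + \<bar>\<alpha>\<bar>" .
next
  fix x :: real assume x: "x \<in> {1, - 1}"
  have "\<bar>turning_functional l \<alpha> u [x]\<bar> = \<bar>\<alpha>\<bar> / (2 * pi)"
    using word_area_single[of l \<alpha> u x] x by (auto simp: turning_functional_def abs_mult)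
  also have "\<dots> \<le> \<bar>\<alpha>\<bar> / 1" using pi_ge_two by (intro divide_left_mono) auto
  finally show "\<bar>turning_functional l \<alpha> u [x]\<bar> \<le> 1 + \<bar>\<alpha>\<bar>" by simp
qed

section \<open>Rotation of the tangent lift\<close>

text \<open>The total angle is expressed through \<open>winding_number\<close>, which is defined for paths that are not
  closed and is additive under concatenation.\<close>

definition unit_rotation :: "(real \<Rightarrow> complex) \<Rightarrow> real \<Rightarrow> bool" where
  "unit_rotation \<gamma> \<theta> \<longleftrightarrow> path \<gamma> \<and> (\<forall>t\<in>{0..1}. cmod (\<gamma> t) = 1) \<and> 2 * pi * Re (winding_number \<gamma> 0) = \<theta>"

lemma unit_rotation_exp:
  assumes cont: "continuous_on {0..1} g" and eq: "\<And>t. t \<in> {0..1} \<Longrightarrow> \<gamma> t = exp (\<i> * of_real (g t))"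
  shows "unit_rotation \<gamma> (g 1 - g 0)"
proof -
  define p where "p t = \<i> * complex_of_real (g t)" for t
  have p: "path p" unfolding path_def p_def using cont by (intro continuous_intros)
  have "path (exp \<circ> p)" using p by (intro path_continuous_image) (auto intro: continuous_intros)
  then have \<gamma>: "path \<gamma>" unfolding path_def
    by (subst continuous_on_cong[OF refl, where g = "exp \<circ> p"]) (auto simp: p_def eq)
  have "winding_number \<gamma> 0 = winding_number (exp \<circ> p) 0"
    by (rule winding_number_cong) (simp add: p_def eq)
  also have "\<dots> = (p 1 - p 0) / (2 * of_real pi * \<i>)"
    unfolding winding_number_compose_exp[OF p] by (simp add: pathfinish_def pathstart_def)
  also have "p 1 - p 0 = \<i> * of_real (g 1 - g 0)" by (simp add: p_def algebra_simps)
  also have "\<dots> / (2 * of_real pi * \<i>) = of_real ((g 1 - g 0) / (2 * pi))" by simp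
  finally have "2 * pi * Re (winding_number \<gamma> 0) = g 1 - g 0" by simp
  then show ?thesis using \<gamma> eq by (simp add: unit_rotation_def)
qed

lemma unit_rotation_notin: "unit_rotation \<gamma> \<theta> \<Longrightarrow> 0 \<notin> path_image \<gamma>"
  by (fastforce simp: unit_rotation_def path_image_def)

lemma unit_rotation_join:
  assumes "unit_rotation \<gamma> \<theta>" "unit_rotation \<gamma>' \<theta>'" "pathfinish \<gamma> = pathstart \<gamma>'"
  shows "unit_rotation (\<gamma> +++ \<gamma>') (\<theta> + \<theta>')"
proof -
  have "winding_number (\<gamma> +++ \<gamma>') 0 = winding_number \<gamma> 0 + winding_number \<gamma>' 0"
    using assms unit_rotation_notin by (intro winding_number_join) (auto simp: unit_rotation_def)
  moreover have "path (\<gamma> +++ \<gamma>')"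
    using assms by (intro path_join_imp) (auto simp: unit_rotation_def)
  moreover have "\<forall>t\<in>{0..1}. cmod ((\<gamma> +++ \<gamma>') t) = 1"
    using assms by (auto simp: unit_rotation_def joinpaths_def)
  ultimately show ?thesis using assms by (simp add: unit_rotation_def distrib_left)
qed

text \<open>The direction of \<open>hseg p q\<close> at time \<open>t\<close> is that of \<open>chord p q / (1 + cnj p * (t * chord p q))\<^sup>2\<close>, and
  its argument has a continuous branch because the denominator stays in the right half plane. For
  \<open>p = q\<close> both sides are zero.\<close>

lemma unit_rotation_edge:
  assumes p: "cmod p < 1" and q: "cmod q < 1"
  shows "unit_rotation (snd \<circ> edge_lift p q) (- fan_area p q)"
proof (cases "p = q")
  case True
  have "unit_rotation (snd \<circ> edge_lift p q) (0 - 0)"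
    by (rule unit_rotation_exp[where g = "\<lambda>_. 0"]) (auto simp: edge_lift_def True)
  moreover have "fan_area p q = 0"
  proof -
    have "0 < 1 - (cmod p)\<^sup>2" using p by (simp add: abs_square_less_1)
    then have "Im (Ln (of_real (1 - (cmod p)\<^sup>2))) = 0" by (subst Ln_of_real) auto
    moreover have "1 - cnj p * q = of_real (1 - (cmod p)\<^sup>2)"
      using complex_norm_square[of p] by (simp add: True mult.commute)
    ultimately show ?thesis unfolding fan_area_def by simp
  qed
  ultimately show ?thesis by simp
next
  case False
  let ?b = "chord p q"
  define g where "g t = Im (Ln ?b) - 2 * Im (Ln (1 + cnj p * (of_real t * ?b)))" for t
  have b: "?b \<noteq> 0"
    using False htrans_denom_nonzero[of "- p" q] p q by (simp add: chord_def htrans_def)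
  have np: "1 + cnj p * (of_real t * ?b) \<notin> \<real>\<^sub>\<le>\<^sub>0" if "t \<in> {0..1}" for t
    by (rule one_plus_notin_nonpos[OF cmod_cnj_mult_less_1[OF p cmod_hseg_arg[OF p q that]]])
  have "unit_rotation (snd \<circ> edge_lift p q) (g 1 - g 0)"
  proof (rule unit_rotation_exp)
    show "continuous_on {0..1} g"
      unfolding g_def using np by (intro continuous_intros) auto
    fix t :: real assume t: "t \<in> {0..1}"
    let ?d = "1 + cnj p * (of_real t * ?b)" and ?P = "1 - (cmod p)\<^sup>2"
    have P: "?P > 0" using p by (simp add: abs_square_less_1)
    have d: "?d \<noteq> 0" by (rule hseg_denom[OF p q t])
    have sgn_exp: "sgn (exp z) = exp (\<i> * of_real (Im z))" for z :: complex
    proof -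
      have "exp z = of_real (exp (Re z)) * exp (\<i> * of_real (Im z))"
        by (metis complex_eq exp_add exp_of_real)
      then show ?thesis by (simp add: sgn_mult sgn_of_real) (simp add: sgn_eq)
    qed
    have "vector_derivative (hseg p q) (at t) = hseg' p q t"
      by (rule vector_derivative_at[OF hseg_has_derivative[OF p q t]])
    also have "\<dots> = exp (Ln ?b + of_real (ln ?P) - 2 * Ln ?d)"
    proof -
      have "exp (2 * Ln ?d) = ?d\<^sup>2" using d by (simp add: exp_double)
      moreover have "exp (complex_of_real (ln ?P)) = ?P" using P by (simp add: exp_of_real)
      ultimately show ?thesis using b by (simp add: hseg'_def exp_add exp_diff)
    qed
    finally have "sgn (vector_derivative (hseg p q) (at t)) = exp (\<i> * of_real (Im (Ln ?b + of_real (ln ?P) - 2 * Ln ?d)))"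
      by (simp only: sgn_exp)
    also have "Im (Ln ?b + of_real (ln ?P) - 2 * Ln ?d) = g t" by (simp add: g_def)
    finally show "(snd \<circ> edge_lift p q) t = exp (\<i> * of_real (g t))"
      using False by (simp add: edge_lift_def)
  qed
  moreover have "g 1 - g 0 = - fan_area p q"
    using fan_area_chord[OF p q] by (simp add: g_def)
  ultimately show ?thesis by simp
qed

lemma unit_rotation_turn:
  assumes "cmod v = 1"
  shows "unit_rotation (snd \<circ> turn_lift p v \<theta>) \<theta>"
proof -
  have v: "exp (\<i> * of_real (Im (Ln v))) = v"
  proof -
    have "v \<noteq> 0" using assms by auto
    moreover have "Ln v = \<i> * of_real (Im (Ln v))"
      using assms \<open>v \<noteq> 0\<close> by (simp add: complex_eq_iff)
    ultimately show ?thesis by (metis exp_Ln)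
  qed
  have "unit_rotation (snd \<circ> turn_lift p v \<theta>) ((1 * \<theta> + Im (Ln v)) - (0 * \<theta> + Im (Ln v)))"
  proof (rule unit_rotation_exp)
    fix t :: real
    have "exp (\<i> * of_real (t * \<theta> + Im (Ln v))) = cis (t * \<theta>) * exp (\<i> * of_real (Im (Ln v)))"
      by (simp add: cis_conv_exp distrib_left flip: exp_add)
    then show "(snd \<circ> turn_lift p v \<theta>) t = exp (\<i> * of_real (t * \<theta> + Im (Ln v)))"
      unfolding v by (simp add: turn_lift_def)
  qed (auto intro!: continuous_intros)
  then show ?thesis by simp
qed

lemma path_of_components: "path (fst \<circ> f) \<Longrightarrow> path (snd \<circ> f) \<Longrightarrow> path f"
  unfolding path_def using continuous_on_Pair[of "{0..1}" "fst \<circ> f" "snd \<circ> f"] by simp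

lemma path_edge_lift:
  assumes "cmod p < 1" "cmod q < 1"
  shows "path (edge_lift p q)"
proof (rule path_of_components)
  show "path (fst \<circ> edge_lift p q)"
    using continuous_hseg[OF assms] by (simp add: path_def edge_lift_def o_def)
  show "path (snd \<circ> edge_lift p q)"
    using unit_rotation_edge[OF assms] by (simp add: unit_rotation_def)
qed

lemma path_turn_lift: "path (turn_lift p v \<theta>)"
  unfolding path_def turn_lift_def cis_conv_exp by (intro continuous_intros)

lemma path_joinD1:
  assumes "path (g +++ h)"
  shows "path g"
proof -
  have "continuous_on {0..1} ((g +++ h) \<circ> (\<lambda>t. t / 2))"
    using assms by (intro continuous_on_compose continuous_intros) (auto simp: path_def intro: continuous_on_subset)
  moreover have "((g +++ h) \<circ> (\<lambda>t. t / 2)) t = g t" if "t \<in> {0..1}" for t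
    using that by (simp add: joinpaths_def)
  ultimately show ?thesis unfolding path_def by (rule continuous_on_eq)
qed

text \<open>Continuity of the lift makes the end of each piece agree with the start of the next one, so the
  rotation angles add up.\<close>

lemma unit_rotation_tangent_lift:
  assumes p: "range p \<subseteq> ball 0 1"
  shows "path (tangent_lift p \<tau> k) \<Longrightarrow>
    unit_rotation (snd \<circ> tangent_lift p \<tau> k) (\<Sum>j<k. \<tau> (Suc j) - fan_area (p j) (p (Suc j)))"
proof (induction k)
  case 0
  define v where "v = snd (edge_lift (p 0) (p 1) 0)"
  have "cmod v = 1"
    using unit_rotation_edge[OF range_disc[OF p] range_disc[OF p], of 0 1] by (simp add: unit_rotation_def v_def)
  from unit_rotation_turn[OF this, of "p 0" 0]
  have "unit_rotation (\<lambda>_. v) 0" by (simp add: turn_lift_def o_def)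
  then show ?case by (simp add: o_def v_def)
next
  case (Suc k)
  let ?T = "tangent_lift p \<tau> k" and ?E = "edge_lift (p k) (p (Suc k))"
  let ?v = "snd (?E 1)"
  let ?R = "turn_lift (p (Suc k)) ?v (\<tau> (Suc k))"
  note pk = range_disc[OF p]
  have E: "path ?E" by (rule path_edge_lift[OF pk pk])
  have rotE: "unit_rotation (snd \<circ> ?E) (- fan_area (p k) (p (Suc k)))" by (rule unit_rotation_edge[OF pk pk])
  have "cmod ?v = 1" using rotE by (simp add: unit_rotation_def)
  then have rotR: "unit_rotation (snd \<circ> ?R) (\<tau> (Suc k))" by (rule unit_rotation_turn)
  have ER: "pathfinish ?E = pathstart ?R"
    using hseg_ends[OF pk pk, of k "Suc k"]
    by (simp add: pathfinish_def pathstart_def turn_lift_def edge_lift_def)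
  have pER: "path (?E +++ ?R)" using E ER path_turn_lift by (simp del: fst_conv)
  have T: "path ?T" using Suc.prems path_joinD1 by simp
  have TE: "pathfinish ?T = pathstart (?E +++ ?R)"
    using Suc.prems by (intro path_join_path_ends pER) simp
  have "unit_rotation ((snd \<circ> ?T) +++ ((snd \<circ> ?E) +++ (snd \<circ> ?R)))
      ((\<Sum>j<k. \<tau> (Suc j) - fan_area (p j) (p (Suc j))) + (- fan_area (p k) (p (Suc k)) + \<tau> (Suc k)))"
    using TE ER by (intro unit_rotation_join Suc.IH[OF T] rotE rotR)
      (simp_all only: pathfinish_compose pathstart_compose pathstart_join)
  then show ?case by (simp only: tangent_lift.simps path_compose_join sum.lessThan_Suc) (simp add: algebra_simps)
qed

lemma gauss_map_closed_path:
  assumes "closed_immersion c"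
  shows "path (gauss_map c)" "pathfinish (gauss_map c) = pathstart (gauss_map c)"
proof -
  obtain D where D: "\<And>t. (c has_vector_derivative D t) (at t)" and cont: "continuous_on UNIV D"
    using assms unfolding closed_immersion_def C1_differentiable_on_def by auto
  have vd: "vector_derivative c (at t) = D t" for t by (rule vector_derivative_at[OF D])
  have nz: "D t \<noteq> 0" for t using assms vd by (auto simp: closed_immersion_def)
  have gm: "gauss_map c = (\<lambda>t. sgn (D t))" by (simp add: gauss_map_def vd fun_eq_iff)
  show "path (gauss_map c)"
    unfolding gm path_def using nz by (intro continuous_on_sgn continuous_on_subset[OF cont]) auto
  have "(c \<circ> (\<lambda>t. t + 1) has_vector_derivative (1 *\<^sub>R D (0 + 1))) (at 0)"
    by (rule vector_diff_chain_at[OF _ D]) (auto intro!: derivative_eq_intros)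
  moreover have "c \<circ> (\<lambda>t. t + 1) = c" using assms by (auto simp: closed_immersion_def)
  ultimately have "D 1 = D 0" using vector_derivative_unique_at[OF D[of 0]] by simp
  then show "pathfinish (gauss_map c) = pathstart (gauss_map c)"
    by (simp add: gm pathfinish_def pathstart_def)
qed

text \<open>The Gauss map of the smoothing is never opposite to the direction of the lift, so the two closed
  paths in the unit circle are homotopic in the punctured plane.\<close>

lemma immersion_winding_smoothing:
  assumes p: "range p \<subseteq> ball 0 1" and L: "L = tangent_lift p \<tau> k"
    and path: "path L" "pathfinish L = pathstart L"
    and smooth: "is_smoothing \<delta> L c" and \<delta>: "\<delta> \<le> 1"
  shows "2 * pi * immersion_winding c = (\<Sum>j<k. \<tau> (Suc j) - fan_area (p j) (p (Suc j)))"
proof -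
  have rot: "unit_rotation (snd \<circ> L) (\<Sum>j<k. \<tau> (Suc j) - fan_area (p j) (p (Suc j)))"
    using unit_rotation_tangent_lift[OF p] path(1) by (simp add: L)
  have c: "closed_immersion c" using smooth by (simp add: is_smoothing_def)
  have "winding_number (gauss_map c) 0 = winding_number (snd \<circ> L) 0"
  proof (rule winding_number_nearby_loops_eq)
    show "path (snd \<circ> L)" using rot by (simp add: unit_rotation_def)
    show "pathfinish (snd \<circ> L) = pathstart (snd \<circ> L)"
      using path(2) by (simp add: pathfinish_compose pathstart_compose)
    fix t :: real assume t: "t \<in> {0..1}"
    then have "dist (gauss_map c t) (snd (L t)) < \<delta>" using smooth by (simp add: is_smoothing_def)
    also have "\<delta> \<le> cmod ((snd \<circ> L) t - 0)" using rot t \<delta> by (simp add: unit_rotation_def)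
    finally show "cmod (gauss_map c t - (snd \<circ> L) t) < cmod ((snd \<circ> L) t - 0)"
      by (simp add: dist_norm)
  qed (use gauss_map_closed_path[OF c] in auto)
  then show ?thesis using rot by (simp add: immersion_winding_def unit_rotation_def)
qed

lemma polygon_vertex_range:
  assumes "cmod u = 1"
  shows "range (polygon_vertex l \<alpha> u s n) \<subseteq> ball 0 1"
  using walk_unit[OF assms] by (auto simp: polygon_vertex_def)

lemma sum_fan_area_polygon:
  "(\<Sum>k<Suc n. fan_area (polygon_vertex l \<alpha> u s n k) (polygon_vertex l \<alpha> u s n (Suc k))) = walk_area l \<alpha> u s n"
proof -
  have "(\<Sum>k<n. fan_area (polygon_vertex l \<alpha> u s n k) (polygon_vertex l \<alpha> u s n (Suc k))) = walk_area l \<alpha> u s n"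
    unfolding walk_area_def by (intro sum.cong) (simp_all add: polygon_vertex_def del: walk.simps)
  moreover have "fan_area (polygon_vertex l \<alpha> u s n n) (polygon_vertex l \<alpha> u s n (Suc n)) = 0"
    by (simp add: polygon_vertex_def fan_area_def)
  ultimately show ?thesis by simp
qed

lemma algebraic_area_polygon:
  assumes "cmod u = 1"
  shows "algebraic_area (polygon_boundary l \<alpha> u s n) = walk_area l \<alpha> u s n"
  unfolding polygon_boundary_def
  by (subst algebraic_area_hchain[OF polygon_vertex_range[OF assms]])
    (simp add: polygon_vertex_def, rule sum_fan_area_polygon)

text \<open>The lift turns by \<open>s i * \<alpha>\<close> at the inner vertices. The sum on the left also contains the sign at
  \<open>p\<^sub>n\<close>, where the lift turns by an arbitrary bounded angle instead.\<close>

lemma polygon_winding_turning: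
  assumes u: "cmod u = 1" and n: "n \<ge> 1" and s: "\<bar>s n\<bar> = 1" and \<delta>: "\<delta> \<le> 1"
    and w: "polygon_winding \<delta> C l \<alpha> u s n w"
  shows "\<bar>w - (\<alpha> * (\<Sum>i=1..n. s i) - walk_area l \<alpha> u s n) / (2 * pi)\<bar> \<le> \<bar>\<alpha>\<bar> + 2 * C"
proof -
  obtain \<tau> c where \<tau>: "\<And>i. 0 < i \<Longrightarrow> i < n \<Longrightarrow> \<tau> i = s i * \<alpha>" "\<bar>\<tau> n\<bar> \<le> C" "\<bar>\<tau> (Suc n)\<bar> \<le> C"
    and L: "path (tangent_lift (polygon_vertex l \<alpha> u s n) \<tau> (Suc n))"
      "pathfinish (tangent_lift (polygon_vertex l \<alpha> u s n) \<tau> (Suc n)) = pathstart (tangent_lift (polygon_vertex l \<alpha> u s n) \<tau> (Suc n))"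
    and c: "is_smoothing \<delta> (tangent_lift (polygon_vertex l \<alpha> u s n) \<tau> (Suc n)) c" "w = immersion_winding c"
    using w unfolding polygon_winding_def Let_def by blast
  have "2 * pi * w = (\<Sum>j<Suc n. \<tau> (Suc j)) - walk_area l \<alpha> u s n"
    unfolding c(2) immersion_winding_smoothing[OF polygon_vertex_range[OF u] refl L c(1) \<delta>]
    by (simp only: sum_subtractf sum_fan_area_polygon)
  also have "(\<Sum>j<Suc n. \<tau> (Suc j)) = \<alpha> * (\<Sum>i=1..n. s i) + (\<tau> n + \<tau> (Suc n) - \<alpha> * s n)"
  proof -
    obtain m where m: "n = Suc m" using n by (cases n) auto
    have "(\<Sum>j<m. \<tau> (Suc j)) = (\<Sum>j<m. \<alpha> * s (Suc j))"
      using \<tau>(1) by (intro sum.cong) (auto simp: m mult.commute)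
    also have "\<dots> = \<alpha> * (\<Sum>i=1..m. s i)"
      by (simp add: sum_distrib_left sum.atLeast1_atMost_eq)
    finally have "(\<Sum>j<m. \<tau> (Suc j)) = \<alpha> * (\<Sum>i=1..m. s i)" .
    then show ?thesis by (simp add: m algebra_simps)
  qed
  finally have "w - (\<alpha> * (\<Sum>i=1..n. s i) - walk_area l \<alpha> u s n) / (2 * pi) = (\<tau> n + \<tau> (Suc n) - \<alpha> * s n) / (2 * pi)"
    by (simp add: field_simps)
  also have "\<bar>\<dots>\<bar> \<le> (\<bar>\<alpha>\<bar> + 2 * C) / 1"
    unfolding abs_divide
  proof (rule frac_le)
    have "\<bar>\<alpha> * s n\<bar> = \<bar>\<alpha>\<bar>" by (simp add: abs_mult s)
    then show "\<bar>\<tau> n + \<tau> (Suc n) - \<alpha> * s n\<bar> \<le> \<bar>\<alpha>\<bar> + 2 * C" using \<tau>(2,3) by linarith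
    show "0 \<le> \<bar>\<alpha>\<bar> + 2 * C" using \<tau>(2) by linarith
    show "1 \<le> \<bar>2 * pi\<bar>" using pi_ge_two by simp
  qed simp
  finally show ?thesis by simp
qed

section \<open>The two central limit theorems\<close>

theorem mainTheorem7:
  fixes l \<alpha> :: real and u :: complex
    and M :: "'a measure" and s :: "nat \<Rightarrow> 'a \<Rightarrow> real"
  assumes "l > 0" and "cmod u = 1"
    and "prob_space M"
    and "prob_space.indep_vars M (\<lambda>_. borel) s {1..}"
    and "\<And>i \<omega>. i \<ge> 1 \<Longrightarrow> \<omega> \<in> space M \<Longrightarrow> s i \<omega> \<in> {1, - 1}"
    and "\<And>i. i \<ge> 1 \<Longrightarrow> measure M {\<omega> \<in> space M. s i \<omega> = 1} = 1 / 2"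
    and "\<And>i. i \<ge> 1 \<Longrightarrow> measure M {\<omega> \<in> space M. s i \<omega> = - 1} = 1 / 2"
  shows "satisfies_clt_mean_0 M
           (\<lambda>n \<omega>. algebraic_area (polygon_boundary l \<alpha> u (\<lambda>i. s i \<omega>) n))
       \<and> (\<forall>W \<delta> C. 0 < \<delta> \<and> \<delta> \<le> 1 \<and> (\<forall>n. W n \<in> borel_measurable M) \<and>
             (\<forall>n\<ge>1. \<forall>\<omega>\<in>space M. polygon_winding \<delta> C l \<alpha> u (\<lambda>i. s i \<omega>) n (W n \<omega>))
           \<longrightarrow> satisfies_clt_mean_0 M W)"
proof -
  interpret prob_space M by fact
  interpret random_signs M s
    using assms(4-7) by unfold_locales auto
  note u = \<open>cmod u = 1\<close>
  have word_area: "walk_area l \<alpha> u (\<lambda>i. s i \<omega>) n = walk_area l \<alpha> u (letters (word n \<omega>)) (length (word n \<omega>))" for n \<omega>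
    by (simp add: word_def del: upt_Suc, rule walk_area_cong) (auto simp: letters_def word_def gr0_conv_Suc simp del: upt_Suc)
  have word_sum: "(\<Sum>i=1..n. s i \<omega>) = sum_list (word n \<omega>)" for n \<omega>
    by (simp add: word_def sum_list_distinct_conv_sum_set atLeastLessThanSuc_atLeastAtMost del: upt_Suc)
  show ?thesis
  proof (intro conjI allI impI)
    have area: "algebraic_area (polygon_boundary l \<alpha> u (\<lambda>i. s i \<omega>) n)
        = walk_area l \<alpha> u (letters (word n \<omega>)) (length (word n \<omega>))" for n \<omega>
      unfolding algebraic_area_polygon[OF u] by (rule word_area)
    show "satisfies_clt_mean_0 M (\<lambda>n \<omega>. algebraic_area (polygon_boundary l \<alpha> u (\<lambda>i. s i \<omega>) n))"
      unfolding area
      by (rule central_limit_bounded_distance[OF sign_quasimorphism_area[OF u], where B = 0])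
        (use word_measurable in auto)
  next
    fix W \<delta> C
    assume W: "0 < \<delta> \<and> \<delta> \<le> 1 \<and> (\<forall>n. W n \<in> borel_measurable M) \<and>
      (\<forall>n\<ge>1. \<forall>\<omega>\<in>space M. polygon_winding \<delta> C l \<alpha> u (\<lambda>i. s i \<omega>) n (W n \<omega>))"
    show "satisfies_clt_mean_0 M W"
    proof (rule central_limit_bounded_distance[OF sign_quasimorphism_turning[OF u]])
      show "W n \<in> borel_measurable M" for n using W by blast
      fix n \<omega> assume n: "(1::nat) \<le> n" and \<omega>: "\<omega> \<in> space M"
      have "\<bar>s n \<omega>\<bar> = 1" using sign[OF n \<omega>] by auto
      then show "\<bar>W n \<omega> - turning_functional l \<alpha> u (word n \<omega>)\<bar> \<le> \<bar>\<alpha>\<bar> + 2 * C"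
        using polygon_winding_turning[OF u n, of "\<lambda>i. s i \<omega>" \<delta> C l \<alpha> "W n \<omega>"] W n \<omega>
        unfolding turning_functional_def word_area[symmetric] word_sum[symmetric] by blast
    qed
  qed
qed

end
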